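(* Let $\hat u^*$ be one of the (possibly multiple) solutions of the nonlinear PML problem $$\hat L\hat u^*-k^2\varepsilon\mathbf 1_{\Omega_0}|\hat u^*+u_{\rm inc}|^2(\hat u^*+u_{\rm inc})=f\ \text{ in }\mathcal D,\qquad \hat u^*=0\ \text{ on }\hat\Gamma.$$ For $g^*\in L^2(\mathcal D)$ let $w^*\in H_0^1(\mathcal D)$ be the solution to the linearized PML problem $$\hat Lw^*-k^2\varepsilon\mathbf 1_{\Omega_0}\big(2|\hat u^*+u_{\rm inc}|^2w^*+(\hat u^*+u_{\rm inc})^2\overline{w^*}\big)=g^*.$$ Suppose that for every $g^*\in L^2(\mathcal D)$ the stability estimate $|||w^*|||\le C^*\|g^*\|_0$ holds, where $C^*$ may depend on $k$ and $\hat u^*$. Put $$N^*:=15\,C^*C_{\rm Nir}^2k^{\frac d2}\varepsilon\|\hat u^*+u_{\rm inc}\|_{L^\infty(\Omega_0)},\qquad \theta^*:=\min\big\{(N^* )^{-1},\;C_{\rm Nir}^{-1}k^{1-\frac d2}\|\hat u^*+u_{\rm inc}\|_{L^\infty(\Omega_0)}\big\}.$$ If the initial guess $\hat u^0\in H_0^1(\mathcal D)$ satisfies $|||\hat u^0-\hat u^*|||\le\theta^*$, then the Newton sequence $\{\hat u^l\}_{l\ge1}\subset H_0^1(\mathcal D)$ defined by $$\hat L\hat u^{l+1}-k^2\varepsilon\mathbf 1_{\Omega_0}\big(2|\hat u^l+u_{\rm inc}|^2\hat u^{l+1}+(\hat u^l+u_{\rm inc})^2\overline{\hat u^{l+1}}\big)=f-k^2\varepsilon\mathbf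 1_{\Omega_0}\big(2|\hat u^l+u_{\rm inc}|^2\hat u^l-(\hat u^l+u_{\rm inc})^2\overline{u_{\rm inc}}\big)$$ for $l=0,1,2,\dots$ converges quadratically to $\hat u^*$, namely $$|||\hat u^{l+1}-\hat u^*|||\lesssim N^*\,|||\hat u^l-\hat u^*|||^2,\qquad l=0,1,2,\dots$$
   Context: Setting. $d\in\{2,3\}$; functions are complex valued; $k\gg1$ is the constant real wave number; $0<\varepsilon\ll1$ is the Kerr constant. For $0<R<\hat R$ let $\Omega=\{x\in\mathbb R^d:|x|<R\}$, $\Gamma=\partial\Omega$, $\mathcal D=\{|x|<\hat R\}$, $\hat\Gamma=\partial\mathcal D$, $\hat\Omega=\{R<|x|<\hat R\}$, $L=\hat R-R$. $\Omega_0\subset\Omega$ is a region with $\mathrm{dist}(\Gamma,\Omega_0)\ge C\,\mathrm{diam}(\Omega_0)$ for some constant $C>0$, with characteristic function $\mathbf 1_{\Omega_0}$. $u_{\rm inc}$ is a given incident wave, bounded on $\Omega_0$; $f\in L^2$ is supported in $\Omega$. PML operator. $\sigma_0>0$ is a constant. With $r=|x|$: $\sigma(r)=\delta(r)=0$ for $r\le R$; $\sigma(r)=\sigma_0$, $\delta(r)=\sigma_0(r-R)/r$ for $r>R$; $\alpha=1+\mathbf i\sigma$, $\beta=1+\mathbf i\delta$. Set $A=H\Lambda H^T$ and $B=\alpha\beta^{d-1}$, where for $d=2$ (polar angle $\vartheta$) $\Lambda=\mathrm{diag}(\beta/\alpha,\alpha/\beta)$, $H=\begin{pmatrix}\cos\vartheta&-\sin\vartheta\\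 \sin\vartheta&\cos\vartheta\end{pmatrix}$, and for $d=3$ (spherical angles $\vartheta,\varphi$) $\Lambda=\mathrm{diag}(\beta^2/\alpha,\alpha,\alpha)$, $H=\begin{pmatrix}\sin\vartheta\cos\varphi&\cos\vartheta\cos\varphi&-\sin\varphi\\ \sin\vartheta\sin\varphi&\cos\vartheta\sin\varphi&\cos\varphi\\ \cos\vartheta&-\sin\vartheta&0\end{pmatrix}$. Then $\hat Lw=-\nabla\cdot(A\nabla w)-Bk^2w$, and $a(u,v)=(A\nabla u,\nabla v)-k^2(Bu,v)$, with $(u,v)_G=\int_G u\bar v$ and $(\cdot,\cdot)=(\cdot,\cdot)_{\mathcal D}$. Equations $\hat Lw=g$ with $w=0$ on $\hat\Gamma$ are understood weakly: $w\in H_0^1(\mathcal D)$ and $a(w,v)=(g,v)$ for all $v\in H^1_0(\mathcal D)$. Norms. $\|\cdot\|_{s,G}$ is the norm of $H^s(G)$; the subscript $G$ is omitted if $G=\mathcal D$. Energy norm: $|||v|||=(\mathrm{Re}\,a(v,v)+2k^2\|v\|_0^2)^{1/2}$. Nirenberg constant. For $2\le p\le \frac{2d}{d-2}$ let $C_{\mathrm{Nir},p}$ be a constant with $\|v\|_{L^p(\Omega)}\le C_{\mathrm{Nir},p}\|v\|_{1,\Omega}^{\frac d2-\frac dp}\|v\|_{0,\Omega}^{1-\frac d2+\frac dp}$ for all $v\in H^1(\Omega)$, and set $C_{\rm Nir}=\max\{(1+\sigma_0^2)^{d/8}C_{\mathrm{Nir},4},\,(1+\sigma_0^2)^{d/6}C_{\mathrm{Nir},6}\}$;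 since $k\gg1$ one has $\|v\|_{L^4(\Omega)}\le C_{\rm Nir}k^{\frac d4-1}|||v|||$ and $\|v\|_{L^6(\Omega)}\le C_{\rm Nir}k^{\frac d3-1}|||v|||$. Constants. $X\lesssim Y$ means $X\le CY$ with a generic constant $C>0$ independent of $k,f,\varepsilon,u_{\rm inc}$ and $l$, which may depend on the fixed geometry and, at most polynomially, on $\sigma_0$ and $L$. *)

theory Defs
  imports "HOL-Analysis.Analysis" "HOL-Probability.Essential_Supremum"
begin

text \<open>
  The dimension is d = CARD('n).  The index type has class comm_ring_1 only so that 1, 2, 3
  denote coordinates; for d = 2 and d = 3 this means 'n is (a copy of) the numeral type 2 or 3,
  with distinct coordinates 1, 2 and 1, 2, 3 respectively.

  Functions on a set G are total functions of which only the values on G matter, up to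
  null sets.
\<close>

section \<open>Lebesgue and Sobolev spaces\<close>

definition in_Lp :: "real \<Rightarrow> (real^'n) set \<Rightarrow> (real^'n \<Rightarrow> complex) \<Rightarrow> bool" where
  "in_Lp p G v \<longleftrightarrow> v \<in> borel_measurable (lebesgue_on G) \<and>
     integrable (lebesgue_on G) (\<lambda>x. cmod (v x) powr p)"

definition Lp_norm :: "real \<Rightarrow> (real^'n) set \<Rightarrow> (real^'n \<Rightarrow> complex) \<Rightarrow> real" where
  "Lp_norm p G v = (LINT x|lebesgue_on G. cmod (v x) powr p) powr (1 / p)"

text \<open>Extended-real valued, so that no finiteness has to be presupposed.\<close>

definition Linf_norm :: "(real^'n) set \<Rightarrow> (real^'n \<Rightarrow> complex) \<Rightarrow> ereal" where
  "Linf_norm G v = esssup (lebesgue_on G) (\<lambda>x. ereal (cmod (v x)))"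

definition inner_L2 :: "(real^'n) set \<Rightarrow> (real^'n \<Rightarrow> complex) \<Rightarrow> (real^'n \<Rightarrow> complex) \<Rightarrow> complex" where
  "inner_L2 G u v = (LINT x|lebesgue_on G. u x * cnj (v x))"

definition pderiv_at :: "'n \<Rightarrow> (real^'n \<Rightarrow> complex) \<Rightarrow> real^'n \<Rightarrow> complex" where
  "pderiv_at i \<phi> x = frechet_derivative \<phi> (at x) (axis i 1)"

text \<open>
  D is stands for the iterated partial derivative of \<phi> along the list of directions is; all of
  them are differentiable, i.e. \<phi> is of class C-infinity.
\<close>

definition smooth_fun :: "(real^'n \<Rightarrow> complex) \<Rightarrow> bool" where
  "smooth_fun \<phi> \<longleftrightarrow> (\<exists>D :: 'n list \<Rightarrow> real^'n \<Rightarrow> complex. D [] = \<phi> \<and>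
     (\<forall>is x. (D is has_derivative (\<lambda>h. \<Sum>i\<in>UNIV. (h $ i) *\<^sub>R D (i # is) x)) (at x)))"

definition test_fun :: "(real^'n) set \<Rightarrow> (real^'n \<Rightarrow> complex) \<Rightarrow> bool" where
  "test_fun G \<phi> \<longleftrightarrow> smooth_fun \<phi> \<and>
     compact (closure {x. \<phi> x \<noteq> 0}) \<and> closure {x. \<phi> x \<noteq> 0} \<subseteq> G"

definition is_weak_gradient ::
  "(real^'n) set \<Rightarrow> (real^'n \<Rightarrow> complex) \<Rightarrow> (real^'n \<Rightarrow> complex^'n) \<Rightarrow> bool" where
  "is_weak_gradient G u g \<longleftrightarrow> (\<forall>i. in_Lp 2 G (\<lambda>x. g x $ i)) \<and>
     (\<forall>\<phi> i. test_fun G \<phi> \<longrightarrow>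
        (LINT x|lebesgue_on G. u x * pderiv_at i \<phi> x) = - (LINT x|lebesgue_on G. g x $ i * \<phi> x))"

definition H1 :: "(real^'n) set \<Rightarrow> (real^'n \<Rightarrow> complex) \<Rightarrow> bool" where
  "H1 G u \<longleftrightarrow> in_Lp 2 G u \<and> (\<exists>g. is_weak_gradient G u g)"

definition wgrad :: "(real^'n) set \<Rightarrow> (real^'n \<Rightarrow> complex) \<Rightarrow> real^'n \<Rightarrow> complex^'n" where
  "wgrad G u = (SOME g. is_weak_gradient G u g)"

definition H1_norm :: "(real^'n) set \<Rightarrow> (real^'n \<Rightarrow> complex) \<Rightarrow> real" where
  "H1_norm G u = sqrt ((Lp_norm 2 G u)\<^sup>2 + (\<Sum>i\<in>UNIV. (Lp_norm 2 G (\<lambda>x. wgrad G u x $ i))\<^sup>2))"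

definition H10 :: "(real^'n) set \<Rightarrow> (real^'n \<Rightarrow> complex) \<Rightarrow> bool" where
  "H10 G u \<longleftrightarrow> H1 G u \<and> (\<forall>e>0. \<exists>\<phi>. test_fun G \<phi> \<and> H1_norm G (\<lambda>x. u x - \<phi> x) < e)"

text \<open>
  C is a Nirenberg constant for the exponent p on the ball of radius R.  The left-hand side of
  the inequality includes the assertion that v is in Lp, since a non-convergent integral
  has the value 0.
\<close>

definition nirenberg_constant :: "'n::finite itself \<Rightarrow> real \<Rightarrow> real \<Rightarrow> real \<Rightarrow> bool" where
  "nirenberg_constant _ R p C \<longleftrightarrow> 0 < C \<and>
     (let d = real CARD('n); \<Omega> = ball (0 :: real^'n) R in
      \<forall>v. H1 \<Omega> v \<longrightarrow> in_Lp p \<Omega> v \<and>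
        Lp_norm p \<Omega> v \<le> C * H1_norm \<Omega> v powr (d/2 - d/p) * Lp_norm 2 \<Omega> v powr (1 - d/2 + d/p))"

definition nirenberg_max :: "'n::finite itself \<Rightarrow> real \<Rightarrow> real \<Rightarrow> real \<Rightarrow> real" where
  "nirenberg_max _ \<sigma>\<^sub>0 C4 C6 =
     (let d = real CARD('n) in
      max ((1 + \<sigma>\<^sub>0\<^sup>2) powr (d/8) * C4) ((1 + \<sigma>\<^sub>0\<^sup>2) powr (d/6) * C6))"

section \<open>The PML operator\<close>

definition pml_sigma :: "real \<Rightarrow> real \<Rightarrow> real \<Rightarrow> real" where
  "pml_sigma R \<sigma>\<^sub>0 r = (if r \<le> R then 0 else \<sigma>\<^sub>0)"

definition pml_delta :: "real \<Rightarrow> real \<Rightarrow> real \<Rightarrow> real" where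
  "pml_delta R \<sigma>\<^sub>0 r = (if r \<le> R then 0 else \<sigma>\<^sub>0 * (r - R) / r)"

definition pml_alpha :: "real \<Rightarrow> real \<Rightarrow> real \<Rightarrow> complex" where
  "pml_alpha R \<sigma>\<^sub>0 r = 1 + \<i> * of_real (pml_sigma R \<sigma>\<^sub>0 r)"

definition pml_beta :: "real \<Rightarrow> real \<Rightarrow> real \<Rightarrow> complex" where
  "pml_beta R \<sigma>\<^sub>0 r = 1 + \<i> * of_real (pml_delta R \<sigma>\<^sub>0 r)"

text \<open>
  Only meaningful for d = 2 (first branch) and d = 3 (second branch).  The angle vartheta is the
  polar angle for d = 2 and the angle with the third axis for d = 3.
\<close>

definition pml_Lambda :: "real \<Rightarrow> real \<Rightarrow> real^'n::{finite,comm_ring_1} \<Rightarrow> complex^'n::{finite,comm_ring_1}^'n::{finite,comm_ring_1}" where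
  "pml_Lambda R \<sigma>\<^sub>0 x =
     (let \<alpha> = pml_alpha R \<sigma>\<^sub>0 (norm x); \<beta> = pml_beta R \<sigma>\<^sub>0 (norm x) in
      if CARD('n) = 2 then
        vector [vector [\<beta> / \<alpha>, 0],
                vector [0, \<alpha> / \<beta>]]
      else
        vector [vector [\<beta>\<^sup>2 / \<alpha>, 0, 0],
                vector [0, \<alpha>, 0],
                vector [0, 0, \<alpha>]])"

definition pml_H :: "real^'n::{finite,comm_ring_1} \<Rightarrow> complex^'n::{finite,comm_ring_1}^'n::{finite,comm_ring_1}" where
  "pml_H x =
     (if CARD('n) = 2 then
        (let \<theta> = complex_of_real (Arg (Complex (x $ 1) (x $ 2))) in
         vector [vector [cos \<theta>, - sin \<theta>],
                 vector [sin \<theta>, cos \<theta>]])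
      else
        (let \<theta> = complex_of_real (arccos (x $ 3 / norm x));
             \<phi> = complex_of_real (Arg (Complex (x $ 1) (x $ 2))) in
         vector [vector [sin \<theta> * cos \<phi>, cos \<theta> * cos \<phi>, - sin \<phi>],
                 vector [sin \<theta> * sin \<phi>, cos \<theta> * sin \<phi>, cos \<phi>],
                 vector [cos \<theta>, - sin \<theta>, 0]]))"

definition pml_A :: "real \<Rightarrow> real \<Rightarrow> real^'n::{finite,comm_ring_1} \<Rightarrow> complex^'n::{finite,comm_ring_1}^'n::{finite,comm_ring_1}" where
  "pml_A R \<sigma>\<^sub>0 x = pml_H x ** pml_Lambda R \<sigma>\<^sub>0 x ** transpose (pml_H x)"

definition pml_B :: "real \<Rightarrow> real \<Rightarrow> real^'n::{finite,comm_ring_1} \<Rightarrow> complex" where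
  "pml_B R \<sigma>\<^sub>0 x = pml_alpha R \<sigma>\<^sub>0 (norm x) * pml_beta R \<sigma>\<^sub>0 (norm x) ^ (CARD('n) - 1)"

text \<open>Here and below, Rh is the radius of the truncated domain ball 0 Rh.\<close>

definition pml_form :: "real \<Rightarrow> real \<Rightarrow> real \<Rightarrow> real \<Rightarrow>
    (real^'n::{finite,comm_ring_1} \<Rightarrow> complex) \<Rightarrow> (real^'n::{finite,comm_ring_1} \<Rightarrow> complex) \<Rightarrow> complex" where
  "pml_form R Rh \<sigma>\<^sub>0 k u v =
     (let D = ball 0 Rh in
      (LINT x|lebesgue_on D. (\<Sum>i\<in>UNIV. (pml_A R \<sigma>\<^sub>0 x *v wgrad D u x) $ i * cnj (wgrad D v x $ i)))
      - of_real (k\<^sup>2) * inner_L2 D (\<lambda>x. pml_B R \<sigma>\<^sub>0 x * u x) v)"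

definition energy_norm :: "real \<Rightarrow> real \<Rightarrow> real \<Rightarrow> real \<Rightarrow>
    (real^'n::{finite,comm_ring_1} \<Rightarrow> complex) \<Rightarrow> real" where
  "energy_norm R Rh \<sigma>\<^sub>0 k v =
     sqrt (Re (pml_form R Rh \<sigma>\<^sub>0 k v v) + 2 * k\<^sup>2 * (Lp_norm 2 (ball 0 Rh) v)\<^sup>2)"

definition pml_solution :: "real \<Rightarrow> real \<Rightarrow> real \<Rightarrow> real \<Rightarrow>
    (real^'n::{finite,comm_ring_1} \<Rightarrow> complex) \<Rightarrow> (real^'n::{finite,comm_ring_1} \<Rightarrow> complex) \<Rightarrow> bool" where
  "pml_solution R Rh \<sigma>\<^sub>0 k g w \<longleftrightarrow> H10 (ball 0 Rh) w \<and>
     (\<forall>v. H10 (ball 0 Rh) v \<longrightarrow> pml_form R Rh \<sigma>\<^sub>0 k w v = inner_L2 (ball 0 Rh) g v)"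

section \<open>The nonlinear problem, its linearization and Newton's iteration\<close>

text \<open>In the equations below the terms with the Kerr constant stand on the right-hand side.\<close>

definition kerr_solution :: "real \<Rightarrow> real \<Rightarrow> real \<Rightarrow> real \<Rightarrow> real \<Rightarrow> (real^'n::{finite,comm_ring_1}) set \<Rightarrow>
    (real^'n::{finite,comm_ring_1} \<Rightarrow> complex) \<Rightarrow> (real^'n::{finite,comm_ring_1} \<Rightarrow> complex) \<Rightarrow> (real^'n::{finite,comm_ring_1} \<Rightarrow> complex) \<Rightarrow> bool" where
  "kerr_solution R Rh \<sigma>\<^sub>0 k \<epsilon> \<Omega>\<^sub>0 uinc f u \<longleftrightarrow>
     pml_solution R Rh \<sigma>\<^sub>0 k
       (\<lambda>x. f x + of_real (k\<^sup>2 * \<epsilon> * indicat_real \<Omega>\<^sub>0 x * (cmod (u x + uinc x))\<^sup>2) * (u x + uinc x)) u"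

text \<open>w solves the problem linearized at the total field U (scattered plus incident).\<close>

definition linearized_solution :: "real \<Rightarrow> real \<Rightarrow> real \<Rightarrow> real \<Rightarrow> real \<Rightarrow> (real^'n::{finite,comm_ring_1}) set \<Rightarrow>
    (real^'n::{finite,comm_ring_1} \<Rightarrow> complex) \<Rightarrow> (real^'n::{finite,comm_ring_1} \<Rightarrow> complex) \<Rightarrow> (real^'n::{finite,comm_ring_1} \<Rightarrow> complex) \<Rightarrow> bool" where
  "linearized_solution R Rh \<sigma>\<^sub>0 k \<epsilon> \<Omega>\<^sub>0 U g w \<longleftrightarrow>
     pml_solution R Rh \<sigma>\<^sub>0 k
       (\<lambda>x. g x + of_real (k\<^sup>2 * \<epsilon> * indicat_real \<Omega>\<^sub>0 x) *
              (2 * of_real ((cmod (U x))\<^sup>2) * w x + (U x)\<^sup>2 * cnj (w x))) w"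

definition newton_sequence :: "real \<Rightarrow> real \<Rightarrow> real \<Rightarrow> real \<Rightarrow> real \<Rightarrow> (real^'n::{finite,comm_ring_1}) set \<Rightarrow>
    (real^'n::{finite,comm_ring_1} \<Rightarrow> complex) \<Rightarrow> (real^'n::{finite,comm_ring_1} \<Rightarrow> complex) \<Rightarrow> (real^'n::{finite,comm_ring_1} \<Rightarrow> complex) \<Rightarrow>
    (nat \<Rightarrow> real^'n::{finite,comm_ring_1} \<Rightarrow> complex) \<Rightarrow> bool" where
  "newton_sequence R Rh \<sigma>\<^sub>0 k \<epsilon> \<Omega>\<^sub>0 uinc f u0 u \<longleftrightarrow> u 0 = u0 \<and>
     (\<forall>l. linearized_solution R Rh \<sigma>\<^sub>0 k \<epsilon> \<Omega>\<^sub>0 (\<lambda>x. u l x + uinc x)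
        (\<lambda>x. f x - of_real (k\<^sup>2 * \<epsilon> * indicat_real \<Omega>\<^sub>0 x) *
               (2 * of_real ((cmod (u l x + uinc x))\<^sup>2) * u l x - (u l x + uinc x)\<^sup>2 * cnj (uinc x)))
        (u (Suc l)))"

text \<open>
  M stands for the essential supremum norm of the total field on the Kerr medium, Cs for
  the stability constant, CN for the maximal Nirenberg constant, d for the dimension.
  In ereal, inverse 0 = \<infinity>, inverse \<infinity> = 0 and 0 * \<infinity> = 0.
\<close>

definition newton_N :: "nat \<Rightarrow> real \<Rightarrow> real \<Rightarrow> real \<Rightarrow> real \<Rightarrow> ereal \<Rightarrow> ereal" where
  "newton_N d k \<epsilon> Cs CN M = ereal (15 * Cs * CN\<^sup>2 * k powr (real d / 2) * \<epsilon>) * M"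

definition newton_theta :: "nat \<Rightarrow> real \<Rightarrow> real \<Rightarrow> real \<Rightarrow> real \<Rightarrow> ereal \<Rightarrow> ereal" where
  "newton_theta d k \<epsilon> Cs CN M =
     min (inverse (newton_N d k \<epsilon> Cs CN M)) (ereal (inverse CN * k powr (1 - real d / 2)) * M)"

end

theory Submission
  imports Defs
begin

text \<open>
  Let \<open>U\<close> be the exact total field, \<open>U + e\<close> the total field of the current Newton iterate and
  \<open>e'\<close> the error of the next one.  Since the nonlinearity \<open>F(V) = |V|\<^sup>2 V\<close> is a cubic real
  polynomial, \<open>F(U + e) - F(U) - F'(U + e) e\<close> is a sum of terms \<open>U e e\<close> and \<open>e e e\<close>, and
  \<open>F'(U + e) w - F'(U) w\<close> is a sum of terms \<open>U e w\<close> and \<open>e e w\<close> (up to conjugations).  Therefore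
  \<open>e'\<close> solves the problem linearized at the exact solution with the right-hand side
  \<open>residual e + perturbation e e'\<close>, and only the assumed stability at the exact solution is used:
  the energy norm of \<open>e'\<close> is at most \<open>C*\<close> times the norm of that right-hand side.

  The terms with a factor \<open>U\<close> are bounded by the essential supremum of \<open>U\<close> and two factors in
  \<open>L\<^sup>4\<close>, the others by three factors in \<open>L\<^sup>6\<close>; the Nirenberg inequalities turn these norms into
  energy norms, with the powers of the wave number in \<open>K4\<close> and \<open>K6\<close>.  The second entry of the
  minimum that defines \<open>\<theta>*\<close> makes the terms without \<open>U\<close> at most as large as the others.  With
  \<open>\<nu> = N* |||e||| \<le> 1\<close> this gives \<open>|||e'||| \<le> 1/3 \<nu> |||e||| + 3/5 \<nu> |||e'|||\<close>, hence
  \<open>|||e'||| \<le> 5/6 N* |||e|||\<^sup>2\<close>.  So the generic constant is 1, the errors decrease geometrically,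
  and the iterates never leave the ball of radius \<open>\<theta>*\<close> (\<open>finite_field_bounds\<close>,
  \<open>contraction_factor\<close>, \<open>newton_step_error\<close>).

  The same factor \<open>3/5\<close> shows that a Newton step has a unique solution: moving the perturbation to
  the right-hand side turns the step into a fixed point equation in \<open>L\<^sup>2\<close> with a contraction
  (\<open>newton_step_unique\<close>, \<open>newton_step_exists\<close>).  If the essential supremum of \<open>U\<close> is
  infinite, the radius \<open>\<theta>*\<close> is 0 and \<open>e\<close> vanishes almost everywhere, so that \<open>\<nu> = 0\<close> serves.

  The functional analysis underneath is built from the definitions.  The gradient of a function in
  \<open>H\<^sup>1\<close> is a choice among its weak gradients, so that linearity of the form rests on their
  uniqueness almost everywhere, that is, on the fundamental lemma of the calculus of variations
  (\<open>integral_test_fun_zero_imp_AE_zero\<close>, \<open>weak_gradient_AE_unique\<close>).  That differences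
  stay in \<open>H\<^sub>0\<^sup>1\<close> needs test functions to be in \<open>H\<^sup>1\<close>, i.e. integration by parts (\<open>H10_diff\<close>).
  The energy norm controls the \<open>H\<^sup>1\<close>-norm on the inner ball because the real part of the PML matrix
  is nonnegative and is the identity there (\<open>energy_lower_bound\<close>).
\<close>

section \<open>Test functions approximating the indicator of a box\<close>

text \<open>
  A recursive predicate, because closure under products then goes by induction on the order of
  differentiability, and no Leibniz formula for iterated derivatives is needed.
\<close>

primrec diff_times :: "nat \<Rightarrow> (real \<Rightarrow> real) \<Rightarrow> bool" where
  "diff_times 0 f \<longleftrightarrow> True"
| "diff_times (Suc n) f \<longleftrightarrow> (\<exists>f'. (\<forall>x. (f has_real_derivative f' x) (at x)) \<and> diff_times n f')"

lemma diff_times_SucI: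
  "(\<And>x. (f has_real_derivative f' x) (at x)) \<Longrightarrow> diff_times n f' \<Longrightarrow> diff_times (Suc n) f"
  by auto

lemma diff_times_Suc_imp: "diff_times (Suc n) f \<Longrightarrow> diff_times n f"
proof (induction n arbitrary: f)
  case (Suc n)
  then obtain f' where f': "\<And>x. (f has_real_derivative f' x) (at x)" "diff_times (Suc n) f'"
    by (metis diff_times.simps(2))
  with Suc.IH[of f'] show ?case by (intro diff_times_SucI) auto
qed simp

lemma diff_times_add: "diff_times n f \<Longrightarrow> diff_times n g \<Longrightarrow> diff_times n (\<lambda>x. f x + g x)"
proof (induction n arbitrary: f g)
  case (Suc n)
  then obtain f' g' where "\<And>x. (f has_real_derivative f' x) (at x)" "diff_times n f'"
    "\<And>x. (g has_real_derivative g' x) (at x)" "diff_times n g'"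
    by (metis diff_times.simps(2))
  with Suc.IH[of f' g'] show ?case
    by (intro diff_times_SucI[where f'="\<lambda>x. f' x + g' x"]) (auto intro!: derivative_eq_intros)
qed simp

lemma diff_times_mult: "diff_times n f \<Longrightarrow> diff_times n g \<Longrightarrow> diff_times n (\<lambda>x. f x * g x)"
proof (induction n arbitrary: f g)
  case (Suc n)
  obtain f' g' where *: "\<And>x. (f has_real_derivative f' x) (at x)" "diff_times n f'"
    "\<And>x. (g has_real_derivative g' x) (at x)" "diff_times n g'"
    using Suc.prems by (metis diff_times.simps(2))
  have "diff_times n (\<lambda>x. f' x * g x + g' x * f x)"
    using * Suc.IH Suc.prems diff_times_Suc_imp by (intro diff_times_add) blast+
  with * show ?case
    by (intro diff_times_SucI[where f'="\<lambda>x. f' x * g x + g' x * f x"] DERIV_mult)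
qed simp

lemma diff_times_const: "diff_times n (\<lambda>x. c)"
proof (induction n arbitrary: c)
  case (Suc n) then show ?case by (intro diff_times_SucI[where f'="\<lambda>x. 0"]) auto
qed simp

lemma diff_times_affine: "diff_times n f \<Longrightarrow> diff_times n (\<lambda>x. f (c * x + d))"
proof (induction n arbitrary: f)
  case (Suc n)
  obtain f' where f': "\<And>x. (f has_real_derivative f' x) (at x)" "diff_times n f'"
    using Suc.prems by (metis diff_times.simps(2))
  have "((\<lambda>x. f (c * x + d)) has_real_derivative f' (c * x + d) * c) (at x)" for x
    by (rule DERIV_chain2[OF f'(1)]) (auto intro!: derivative_eq_intros)
  moreover have "diff_times n (\<lambda>x. f' (c * x + d) * c)"
    by (intro diff_times_mult diff_times_const Suc.IH f')
  ultimately show ?case by (rule diff_times_SucI)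
qed simp

text \<open>
  The witnesses for the single orders fit together to one sequence of derivatives because a
  derivative is unique.
\<close>

lemma smooth_derivatives:
  assumes "\<And>n. diff_times n f"
  obtains D :: "nat \<Rightarrow> real \<Rightarrow> real"
  where "D 0 = f" "\<And>n x. (D n has_real_derivative D (Suc n) x) (at x)"
proof -
  have *: "\<exists>f'. (\<forall>n. diff_times n f') \<and> (\<forall>x. (g has_real_derivative f' x) (at x))"
    if g: "\<And>n. diff_times n g" for g
  proof -
    obtain f' where f': "\<And>x. (g has_real_derivative f' x) (at x)"
      using g[of 1] by auto
    have "diff_times n f'" for n
    proof -
      obtain h where h: "\<And>x. (g has_real_derivative h x) (at x)" "diff_times n h"
        using g[of "Suc n"] by auto
      have "h = f'" using h f' DERIV_unique by blast
      with h show ?thesis by simp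
    qed
    with f' show ?thesis by blast
  qed
  have "\<exists>D. \<forall>n. (\<forall>m. diff_times m (D n)) \<and> (n = 0 \<longrightarrow> D n = f) \<and>
      (\<forall>x. (D n has_real_derivative D (Suc n) x) (at x))"
    using dependent_nat_choice[where P="\<lambda>n g. (\<forall>m. diff_times m g) \<and> (n = 0 \<longrightarrow> g = f)"
        and Q="\<lambda>n g g'. \<forall>x. (g has_real_derivative g' x) (at x)"] assms *
    by (metis nat.distinct(1))
  then show ?thesis using that by blast
qed

text \<open>
  The span of these functions is closed under differentiation, and each of them is flat at 0.
\<close>

definition smooth_ramp :: "nat \<Rightarrow> real \<Rightarrow> real" where
  "smooth_ramp k t = (if t > 0 then (1 / t) ^ k * exp (- (1 / t)) else 0)"

lemma smooth_ramp_tendsto_0: "(smooth_ramp k \<longlongrightarrow> 0) (at 0)"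
proof -
  have "((\<lambda>t. smooth_ramp k t) \<longlongrightarrow> 0) (at_right 0)"
  proof -
    have "((\<lambda>t::real. (inverse t) ^ k / exp (inverse t)) \<longlongrightarrow> 0) (at_right 0)"
      by (rule filterlim_compose[OF tendsto_power_div_exp_0 filterlim_inverse_at_top_right])
    moreover have "\<forall>\<^sub>F t in at_right 0. inverse t ^ k / exp (inverse t) = smooth_ramp k t"
      using eventually_at_right_less[of 0]
      by eventually_elim (auto simp: smooth_ramp_def exp_minus field_simps)
    ultimately show ?thesis by (rule Lim_transform_eventually)
  qed
  moreover have "((\<lambda>t. smooth_ramp k t) \<longlongrightarrow> 0) (at_left 0)"
  proof (rule Lim_transform_eventually[OF tendsto_const])
    show "\<forall>\<^sub>F t in at_left 0. 0 = smooth_ramp k t"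
      by (auto simp: smooth_ramp_def eventually_at_filter)
  qed
  ultimately show ?thesis by (simp add: filterlim_at_split)
qed

lemma smooth_ramp_has_derivative:
  "(smooth_ramp k has_real_derivative (smooth_ramp (k + 2) t - real k * smooth_ramp (k + 1) t)) (at t)"
proof (cases t "0::real" rule: linorder_cases)
  case less
  have "((\<lambda>t. 0) has_real_derivative 0) (at t)" by simp
  moreover have "\<forall>\<^sub>F s in nhds t. smooth_ramp k s = 0"
    using less eventually_nhds_in_open[of "{..<0}" t]
    by (auto simp: smooth_ramp_def elim!: eventually_mono)
  ultimately show ?thesis using less DERIV_cong_ev[of t t "smooth_ramp k" "\<lambda>_. 0"]
    by (simp add: smooth_ramp_def)
next
  case equal
  have "((\<lambda>y. (smooth_ramp k y - smooth_ramp k 0) / (y - 0)) \<longlongrightarrow> 0) (at 0)"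
  proof (rule Lim_transform_eventually[OF smooth_ramp_tendsto_0[of "Suc k"]])
    show "\<forall>\<^sub>F y in at 0. smooth_ramp (Suc k) y = (smooth_ramp k y - smooth_ramp k 0) / (y - 0)"
      by (auto simp: eventually_at_filter smooth_ramp_def)
  qed
  then show ?thesis
    using equal by (simp add: has_field_derivative_iff smooth_ramp_def)
next
  case greater
  have *: "((\<lambda>t. (1 / t) ^ k * exp (- (1 / t))) has_real_derivative
      (1 / t) ^ (k + 2) * exp (- (1 / t)) - real k * ((1 / t) ^ (k + 1) * exp (- (1 / t)))) (at t)"
  proof -
    have u: "((\<lambda>t. 1 / t) has_real_derivative - ((1 / t)\<^sup>2)) (at t)"
      using greater by (auto intro!: derivative_eq_intros simp: power2_eq_square)
    have v: "((\<lambda>t. exp (- (1 / t))) has_real_derivative exp (- (1 / t)) * (1 / t)\<^sup>2) (at t)"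
      using DERIV_chain2[OF DERIV_exp DERIV_minus[OF u]] by simp
    define y where "y = 1 / t"
    have "((\<lambda>t. (1 / t) ^ k * exp (- (1 / t))) has_real_derivative
        real k * (- (y\<^sup>2) * y ^ (k - Suc 0)) * exp (- y) + exp (- y) * y\<^sup>2 * y ^ k) (at t)"
      using DERIV_mult[OF DERIV_power[OF u, of k] v] by (simp add: y_def)
    moreover have "real k * (- (y\<^sup>2) * y ^ (k - Suc 0)) * exp (- y) + exp (- y) * y\<^sup>2 * y ^ k
        = y ^ (k + 2) * exp (- y) - real k * (y ^ (k + 1) * exp (- y))"
      by (cases k) (simp_all add: algebra_simps power2_eq_square)
    ultimately show ?thesis by (simp add: y_def)
  qed
  have "\<forall>\<^sub>F s in nhds t. smooth_ramp k s = (1 / s) ^ k * exp (- (1 / s))"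
    using greater eventually_nhds_in_open[of "{0<..}" t]
    by (auto simp: smooth_ramp_def elim!: eventually_mono)
  with * show ?thesis
    using greater DERIV_cong_ev[of t t "smooth_ramp k" "\<lambda>t. (1 / t) ^ k * exp (- (1 / t))"]
    by (simp add: smooth_ramp_def)
qed

lemma diff_times_smooth_ramp: "diff_times n (smooth_ramp k)"
proof (induction n arbitrary: k)
  case (Suc n)
  have "diff_times n (\<lambda>t. smooth_ramp (k + 2) t + (- real k) * smooth_ramp (k + 1) t)"
    by (intro diff_times_add diff_times_mult diff_times_const Suc.IH)
  then show ?case using smooth_ramp_has_derivative[of k]
    by (intro diff_times_SucI[where f'="\<lambda>t. smooth_ramp (k + 2) t + (- real k) * smooth_ramp (k + 1) t"])
       auto
qed simp

text \<open>
  The factor \<open>Suc m\<close> steepens both flanks: as \<open>exp (- 1 / (m t))\<close> tends to 1 for every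
  positive \<open>t\<close>, the bumps tend to the indicator of the open interval without leaving it.
\<close>

definition interval_bump :: "real \<Rightarrow> real \<Rightarrow> nat \<Rightarrow> real \<Rightarrow> real" where
  "interval_bump a b m t = smooth_ramp 0 (real (Suc m) * (t - a)) * smooth_ramp 0 (real (Suc m) * (b - t))"

lemma diff_times_interval_bump: "diff_times n (interval_bump a b m)"
proof -
  have "diff_times n (\<lambda>t. smooth_ramp 0 (real (Suc m) * t + - (real (Suc m) * a))
      * smooth_ramp 0 ((- real (Suc m)) * t + real (Suc m) * b))"
    by (intro diff_times_mult diff_times_affine diff_times_smooth_ramp)
  also have "(\<lambda>t. smooth_ramp 0 (real (Suc m) * t + - (real (Suc m) * a))
      * smooth_ramp 0 ((- real (Suc m)) * t + real (Suc m) * b)) = interval_bump a b m"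
    by (auto simp: interval_bump_def algebra_simps)
  finally show ?thesis .
qed

lemma smooth_ramp_bounds: "0 \<le> smooth_ramp 0 t" "smooth_ramp 0 t \<le> 1"
  by (auto simp: smooth_ramp_def)

lemma interval_bump_bounds: "0 \<le> interval_bump a b m t" "interval_bump a b m t \<le> 1"
  unfolding interval_bump_def using smooth_ramp_bounds
  by (auto intro!: mult_nonneg_nonneg mult_le_one)

lemma interval_bump_eq_0: "t \<le> a \<or> b \<le> t \<Longrightarrow> interval_bump a b m t = 0"
  by (auto simp: interval_bump_def smooth_ramp_def zero_less_mult_iff)

lemma smooth_ramp_dilated: 
  assumes "s > 0" shows "(\<lambda>m. smooth_ramp 0 (real (Suc m) * s)) \<longlonglongrightarrow> 1"
proof -
  have "(\<lambda>m. exp (- (inverse (real (Suc m)) * inverse s))) \<longlonglongrightarrow> exp (- (0 * inverse s))"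
    by (intro tendsto_intros LIMSEQ_inverse_real_of_nat)
  then show ?thesis using assms
    by (simp add: smooth_ramp_def zero_less_mult_iff inverse_eq_divide cong: if_cong)
qed

lemma interval_bump_tendsto:
  "(\<lambda>m. interval_bump a b m t) \<longlonglongrightarrow> (if a < t \<and> t < b then 1 else 0)"
proof (cases "a < t \<and> t < b")
  case True
  then show ?thesis unfolding interval_bump_def
    using tendsto_mult[OF smooth_ramp_dilated[of "t - a"] smooth_ramp_dilated[of "b - t"]] by simp
next
  case False
  then show ?thesis by (auto simp: interval_bump_eq_0 not_less)
qed

definition box_bump :: "real^'n \<Rightarrow> real^'n \<Rightarrow> nat \<Rightarrow> real^'n \<Rightarrow> complex" where
  "box_bump a b m x = of_real (\<Prod>i\<in>UNIV. interval_bump (a $ i) (b $ i) m (x $ i))"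

text \<open>
  A product of functions of one coordinate each: the iterated partial derivative along a list of
  directions differentiates the factor of every coordinate as often as this coordinate occurs in
  the list.
\<close>

lemma smooth_fun_box_bump: "smooth_fun (box_bump a b m :: real^'n \<Rightarrow> complex)"
proof -
  have "\<forall>i::'n. \<exists>D. D 0 = interval_bump (a $ i) (b $ i) m \<and>
      (\<forall>n x. (D n has_real_derivative D (Suc n) x) (at x))"
    using smooth_derivatives[OF diff_times_interval_bump] by metis
  then obtain D where D0: "\<And>i::'n. D i 0 = interval_bump (a $ i) (b $ i) m"
    and D: "\<And>i n x. (D i n has_real_derivative D i (Suc n) x) (at x)"
    by metis
  define F :: "'n list \<Rightarrow> real^'n \<Rightarrow> complex"
    where "F js x = of_real (\<Prod>i\<in>UNIV. D i (count_list js i) (x $ i))" for js x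
  have "(F js has_derivative (\<lambda>h. \<Sum>i\<in>UNIV. (h $ i) *\<^sub>R F (i # js) x)) (at x)" for js x
  proof -
    have comp: "((\<lambda>x. D i (count_list js i) (x $ i)) has_derivative
        (\<lambda>h. h $ i * D i (Suc (count_list js i)) (x $ i))) (at x)" for i
    proof -
      have "(D i (count_list js i) has_derivative (\<lambda>h. h * D i (Suc (count_list js i)) (x $ i))) (at (x $ i))"
        using D[of i "count_list js i" "x $ i"]
        by (simp add: has_field_derivative_def mult_commute_abs)
      then show ?thesis
        using has_derivative_compose[of "\<lambda>x. x $ i" "\<lambda>h. h $ i" x UNIV]
        by (auto intro!: bounded_linear_imp_has_derivative bounded_linear_vec_nth)
    qed
    have "((\<lambda>x. \<Prod>i\<in>UNIV. D i (count_list js i) (x $ i)) has_derivative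
        (\<lambda>h. \<Sum>i\<in>UNIV. (h $ i * D i (Suc (count_list js i)) (x $ i)) *
              (\<Prod>j\<in>UNIV - {i}. D j (count_list js j) (x $ j)))) (at x)"
      by (rule has_derivative_prod) (rule comp)
    then have "((\<lambda>x. complex_of_real (\<Prod>i\<in>UNIV. D i (count_list js i) (x $ i))) has_derivative
        (\<lambda>h. complex_of_real (\<Sum>i\<in>UNIV. (h $ i * D i (Suc (count_list js i)) (x $ i)) *
              (\<Prod>j\<in>UNIV - {i}. D j (count_list js j) (x $ j))))) (at x)"
      by (rule has_derivative_of_real)
    moreover have "complex_of_real (\<Sum>i\<in>UNIV. (h $ i * D i (Suc (count_list js i)) (x $ i)) *
              (\<Prod>j\<in>UNIV - {i}. D j (count_list js j) (x $ j)))
        = (\<Sum>i\<in>UNIV. (h $ i) *\<^sub>R F (i # js) x)" for h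
    proof -
      have "(\<Prod>j\<in>UNIV. D j (count_list (i # js) j) (x $ j)) =
          D i (Suc (count_list js i)) (x $ i) * (\<Prod>j\<in>UNIV - {i}. D j (count_list js j) (x $ j))" for i
        by (subst prod.remove[of UNIV i]) (auto intro!: prod.cong)
      then show ?thesis
        by (simp add: F_def scaleR_conv_of_real mult.assoc)
    qed
    ultimately show ?thesis unfolding F_def by simp
  qed
  moreover have "F [] = box_bump a b m"
    by (auto simp: F_def box_bump_def D0)
  ultimately show ?thesis unfolding smooth_fun_def by blast
qed

lemma box_bump_eq_0: "x \<notin> box a b \<Longrightarrow> box_bump a b m x = 0"
  by (auto simp: box_bump_def mem_box_cart not_less intro!: interval_bump_eq_0)

lemma norm_box_bump_le: "cmod (box_bump a b m x) \<le> 1"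
  unfolding box_bump_def using interval_bump_bounds
  by (simp add: prod_nonneg prod_le_1 del: of_real_prod)

lemma box_bump_tendsto: "(\<lambda>m. box_bump a b m x) \<longlonglongrightarrow> indicator (box a b) x"
proof -
  have "(\<lambda>m. box_bump a b m x) \<longlonglongrightarrow>
      of_real (\<Prod>i\<in>UNIV. (if a $ i < x $ i \<and> x $ i < b $ i then 1 else 0))"
    unfolding box_bump_def by (intro tendsto_of_real tendsto_prod interval_bump_tendsto)
  also have "(\<Prod>i\<in>UNIV. (if a $ i < x $ i \<and> x $ i < b $ i then 1 else 0)) = (indicator (box a b) x :: real)"
    by (auto simp: indicator_def mem_box_cart)
  also have "complex_of_real (indicator (box a b) x) = indicator (box a b) x"
    by (simp add: indicator_def)
  finally show ?thesis .
qed

lemma test_fun_box_bump: "cbox a b \<subseteq> G \<Longrightarrow> test_fun G (box_bump a b m)"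
proof -
  assume G: "cbox a b \<subseteq> G"
  have "closure {x. box_bump a b m x \<noteq> 0} \<subseteq> cbox a b"
    using box_bump_eq_0[of _ a b m] box_subset_cbox[of a b]
    by (intro closure_minimal) auto
  moreover from this have "compact (closure {x. box_bump a b m x \<noteq> 0})"
    using compact_Int_closed[OF compact_cbox closed_closure] by (metis inf.absorb_iff2)
  ultimately show ?thesis using G smooth_fun_box_bump[of a b m]
    by (auto simp: test_fun_def)
qed

section \<open>The fundamental lemma of the calculus of variations\<close>

text \<open>
  The boxes are stable under intersection and generate the Borel sets, so the integral vanishes
  over every Borel set by Dynkin's theorem, in particular over the sets where a Borel version
  of \<open>h\<close> is positive or negative.
\<close>

lemma integral_boxes_zero_imp_AE_zero:
  fixes h :: "'a::euclidean_space \<Rightarrow> real"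
  assumes h: "integrable lebesgue h"
    and zero: "\<And>a b. (LINT x:box a b|lebesgue. h x) = 0"
  shows "AE x in lebesgue. h x = 0"
proof -
  have setint: "set_integrable lebesgue A h" if "A \<in> sets lebesgue" for A
    unfolding set_integrable_def using integrable_mult_indicator[OF that h] .
  have UNIV0: "(LINT x:UNIV|lebesgue. h x) = 0"
  proof -
    let ?A = "\<lambda>n::nat. box (- (real n *\<^sub>R One)) (real n *\<^sub>R One) :: 'a set"
    have "incseq ?A"
      by (intro incseq_SucI subset_box_imp) (auto simp: inner_diff_left)
    moreover have "(\<Union>n. ?A n) = UNIV" by (rule UN_box_eq_UNIV)
    ultimately have "(\<lambda>n. LINT x:?A n|lebesgue. h x) \<longlonglongrightarrow> (LINT x:UNIV|lebesgue. h x)"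
      using set_integral_cont_up[of ?A lebesgue h] setint by simp
    then show ?thesis unfolding zero by (simp add: LIMSEQ_const_iff)
  qed
  have borel0: "(LINT x:A|lebesgue. h x) = 0" if "A \<in> sets borel" for A
  proof -
    let ?E = "range (\<lambda>(a, b). box a b :: 'a set)"
    have stable: "Int_stable ?E"
      by (auto simp: Int_stable_def box_Int_box)
    have gen: "A \<in> sigma_sets UNIV ?E"
      using that by (subst (asm) borel_eq_box) simp
    have "?E \<subseteq> Pow UNIV" by simp
    from stable this gen show ?thesis
    proof (induction rule: sigma_sets_induct_disjoint)
      case (basic A)
      then show ?case using zero by auto
    next
      case empty
      then show ?case by (simp add: set_lebesgue_integral_def)
    next
      case (compl A)
      then have "A \<in> sets borel" by (subst borel_eq_box) simp
      then have A: "A \<in> sets lebesgue" by auto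
      have "(LINT x:UNIV|lebesgue. h x) = (LINT x:A|lebesgue. h x) + (LINT x:UNIV - A|lebesgue. h x)"
        using A set_integral_Un[of A "UNIV - A" lebesgue h] setint[of A] setint[of "UNIV - A"]
          sets.compl_sets[OF A] by (auto simp: Un_Diff_cancel)
      then show ?case using UNIV0 compl by simp
    next
      case (union A)
      then have "A i \<in> sets borel" for i by (subst borel_eq_box) auto
      then have A: "A i \<in> sets lebesgue" for i by auto
      have "(LINT x:(\<Union>i. A i)|lebesgue. h x) = (\<Sum>i. (LINT x:(A i)|lebesgue. h x))"
        using A union(1) setint by (intro lebesgue_integral_countable_add) (auto simp: disjoint_family_on_def)
      then show ?case using union by simp
    qed
  qed
  obtain h' where h': "h' \<in> borel_measurable lborel" "AE x in lborel. h x = h' x"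
    using completion_ex_borel_measurable_real[of h lborel] borel_measurable_integrable[OF h] by blast
  have AEh: "AE x in lebesgue. h x = h' x" using AE_completion h'(2) by blast
  have h'm: "h' \<in> borel_measurable borel" using h'(1) by simp
  have sets: "{x. h' x > 0} \<in> sets borel" "{x. h' x < 0} \<in> sets borel"
    using h'm by measurable
  have "AE x in lebesgue. indicator {x. h' x > 0} x * h x = 0"
  proof -
    have "integrable lebesgue (\<lambda>x. indicator {x. h' x > 0} x * h x)"
      using setint[of "{x. h' x > 0}"] sets by (auto simp: set_integrable_def)
    moreover have "AE x in lebesgue. 0 \<le> indicator {x. h' x > 0} x * h x"
      using AEh by eventually_elim (auto simp: indicator_def)
    moreover have "(LINT x|lebesgue. indicator {x. h' x > 0} x * h x) = 0"
      using borel0[OF sets(1)] by (simp add: set_lebesgue_integral_def)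
    ultimately show ?thesis using integral_nonneg_eq_0_iff_AE by blast
  qed
  moreover have "AE x in lebesgue. - (indicator {x. h' x < 0} x * h x) = 0"
  proof -
    have "integrable lebesgue (\<lambda>x. - (indicator {x. h' x < 0} x * h x))"
      using setint[of "{x. h' x < 0}"] sets by (auto simp: set_integrable_def)
    moreover have "AE x in lebesgue. 0 \<le> - (indicator {x. h' x < 0} x * h x)"
      using AEh by eventually_elim (auto simp: indicator_def)
    moreover have "(LINT x|lebesgue. - (indicator {x. h' x < 0} x * h x)) = 0"
      using borel0[OF sets(2)] by (simp add: set_lebesgue_integral_def)
    ultimately show ?thesis using integral_nonneg_eq_0_iff_AE by blast
  qed
  ultimately show ?thesis using AEh
    by eventually_elim (auto simp: indicator_def split: if_splits)
qed

lemma integral_boxes_zero_imp_AE_zero_complex: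
  fixes h :: "'a::euclidean_space \<Rightarrow> complex"
  assumes h: "integrable lebesgue h"
    and zero: "\<And>a b. (LINT x:box a b|lebesgue. h x) = 0"
  shows "AE x in lebesgue. h x = 0"
proof -
  have int: "integrable lebesgue (\<lambda>x. indicator (box a b) x *\<^sub>R h x)" for a b
    using integrable_mult_indicator[of "box a b", OF _ h] by simp
  have "(LINT x:box a b|lebesgue. Re (h x)) = 0" "(LINT x:box a b|lebesgue. Im (h x)) = 0" for a b
    using zero[of a b] integral_Re[OF int[of a b]] integral_Im[OF int[of a b]]
    by (simp_all add: set_lebesgue_integral_def)
  then have "AE x in lebesgue. Re (h x) = 0" "AE x in lebesgue. Im (h x) = 0"
    using h by (auto intro!: integral_boxes_zero_imp_AE_zero)
  then show ?thesis by eventually_elim (simp add: complex_eq_iff)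
qed

lemma smooth_fun_continuous:
  assumes "smooth_fun \<phi>" shows "continuous_on UNIV \<phi>"
proof -
  obtain D where D: "D [] = \<phi>"
    "\<And>is x. (D is has_derivative (\<lambda>h. \<Sum>i\<in>UNIV. (h $ i) *\<^sub>R D (i # is) x)) (at x)"
    using assms unfolding smooth_fun_def by blast
  have "(\<phi> has_derivative (\<lambda>h. \<Sum>i\<in>UNIV. (h $ i) *\<^sub>R D [i] x)) (at x)" for x
    using D(2)[of "[]" x] D(1) by simp
  then show ?thesis
    by (intro continuous_at_imp_continuous_on ballI) (rule has_derivative_continuous)
qed

text \<open>
  Bumps tend to the indicator of a box whose closure lies in \<open>G\<close>, so the integral over such a box
  vanishes by dominated convergence.  The previous lemma needs all boxes; it is applied to \<open>g\<close>
  cut off outside one box, and countably many of these cover \<open>G\<close>.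
\<close>

lemma integral_test_fun_zero_imp_AE_zero:
  fixes g :: "real^'n \<Rightarrow> complex"
  assumes G: "open G" and g: "integrable (lebesgue_on G) g"
    and zero: "\<And>\<phi>. test_fun G \<phi> \<Longrightarrow> (LINT x|lebesgue_on G. g x * \<phi> x) = 0"
  shows "AE x in lebesgue_on G. g x = 0"
proof -
  have Gs: "G \<inter> space lebesgue \<in> sets lebesgue" using G by auto
  define h where "h x = indicator G x *\<^sub>R g x" for x
  have h: "integrable lebesgue h"
    using integrable_restrict_space[OF Gs, THEN iffD1, OF g] unfolding h_def[abs_def] .
  have box0: "(LINT x:box a b|lebesgue. h x) = 0" if ab: "cbox a b \<subseteq> G" for a b
  proof -
    have "(\<lambda>m. LINT x|lebesgue. h x * box_bump a b m x) \<longlonglongrightarrow>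
        (LINT x|lebesgue. h x * indicator (box a b) x)"
    proof (rule integral_dominated_convergence[where w="\<lambda>x. cmod (h x)"])
      have "continuous_on UNIV (box_bump a b m)" for m
        by (intro smooth_fun_continuous smooth_fun_box_bump)
      then have "box_bump a b m \<in> borel_measurable lborel" for m
        using borel_measurable_continuous_onI[of "box_bump a b m"] by simp
      then have "box_bump a b m \<in> borel_measurable lebesgue" for m
        by (rule measurable_completion)
      then show "(\<lambda>x. h x * box_bump a b m x) \<in> borel_measurable lebesgue" for m
        using h by auto
      show "(\<lambda>x. h x * indicator (box a b) x) \<in> borel_measurable lebesgue"
        using h by (intro borel_measurable_times borel_measurable_indicator) auto
      show "AE x in lebesgue. (\<lambda>m. h x * box_bump a b m x) \<longlonglongrightarrow> h x * indicator (box a b) x"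
        by (intro AE_I2 tendsto_intros box_bump_tendsto)
      show "AE x in lebesgue. cmod (h x * box_bump a b m x) \<le> cmod (h x)" for m
        using norm_box_bump_le[of a b m] by (auto simp: norm_mult mult_left_le)
    qed (use h in auto)
    moreover have "(LINT x|lebesgue. h x * box_bump a b m x) = 0" for m
      using zero[OF test_fun_box_bump[OF ab, of m]]
      by (subst (asm) integral_restrict_space[OF Gs]) (simp add: h_def)
    ultimately have "(LINT x|lebesgue. h x * indicator (box a b) x) = 0"
      by (simp add: LIMSEQ_const_iff)
    moreover have "h x * indicator (box a b) x = indicator (box a b) x *\<^sub>R h x" for x
      by (simp add: indicator_def)
    ultimately show ?thesis
      by (simp add: set_lebesgue_integral_def)
  qed
  have loc: "AE x in lebesgue. x \<in> cbox a b \<longrightarrow> g x = 0" if ab: "cbox a b \<subseteq> G" for a b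
  proof -
    let ?h = "\<lambda>x. indicator (box a b) x *\<^sub>R h x"
    have "AE x in lebesgue. ?h x = 0"
    proof (rule integral_boxes_zero_imp_AE_zero_complex)
      show "integrable lebesgue ?h" using integrable_mult_indicator[OF _ h] by simp
      fix c d :: "real^'n"
      obtain p q where pq: "box c d \<inter> box a b = box p q" "box p q = {} \<or> cbox p q \<subseteq> cbox a b"
      proof -
        have *: "box c d \<inter> box a b = box (\<Sum>i\<in>Basis. max (c\<bullet>i) (a\<bullet>i) *\<^sub>R i) (\<Sum>i\<in>Basis. min (d\<bullet>i) (b\<bullet>i) *\<^sub>R i)"
          by (rule box_Int_box)
        have "cbox (\<Sum>i\<in>Basis. max (c\<bullet>i) (a\<bullet>i) *\<^sub>R i) (\<Sum>i\<in>Basis. min (d\<bullet>i) (b\<bullet>i) *\<^sub>R i) \<subseteq> cbox a b"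
          by (intro subset_box_imp(1)) auto
        with * that show ?thesis by blast
      qed
      have "(LINT x:box c d|lebesgue. ?h x) = (LINT x:box p q|lebesgue. h x)"
        unfolding set_lebesgue_integral_def pq(1)[symmetric]
        by (simp add: indicator_inter_arith)
      also have "\<dots> = 0"
        using pq(2) box0[of p q] ab by (auto simp: set_lebesgue_integral_def)
      finally show "(LINT x:box c d|lebesgue. ?h x) = 0" .
    qed
    moreover have "AE x in lebesgue. x \<notin> cbox a b - box a b"
      using negligible_frontier_interval[of a b] by (intro AE_not_in) (simp add: negligible_iff_null_sets)
    ultimately show ?thesis
      by eventually_elim (use ab box_subset_cbox in \<open>auto simp: h_def indicator_def split: if_splits\<close>)
  qed
  obtain \<D> where \<D>: "countable \<D>" "\<And>X. X \<in> \<D> \<Longrightarrow> X \<subseteq> G \<and> (\<exists>a b. X = cbox a b)" "\<Union>\<D> = G"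
    using open_countable_Union_open_cbox[OF G] by (metis PowD subsetD)
  have "AE x in lebesgue. \<forall>X\<in>\<D>. x \<in> X \<longrightarrow> g x = 0"
  proof (subst AE_ball_countable[OF \<D>(1)], rule ballI)
    fix X assume "X \<in> \<D>"
    with \<D>(2) obtain a b where "X = cbox a b" "X \<subseteq> G" by metis
    with loc show "AE x in lebesgue. x \<in> X \<longrightarrow> g x = 0" by simp
  qed
  then have "AE x in lebesgue. x \<in> G \<longrightarrow> g x = 0"
    by eventually_elim (use \<D>(3) in auto)
  then show ?thesis using G by (subst AE_restrict_space_iff) auto
qed

section \<open>Square-integrable functions\<close>

lemma in_L2_iff:
  "in_Lp 2 G v \<longleftrightarrow> v \<in> borel_measurable (lebesgue_on G) \<and> integrable (lebesgue_on G) (\<lambda>x. (cmod (v x))\<^sup>2)"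
  by (simp add: in_Lp_def)

lemma L2_norm_squared: "(Lp_norm 2 G v)\<^sup>2 = (LINT x|lebesgue_on G. (cmod (v x))\<^sup>2)"
  by (simp add: Lp_norm_def powr_half_sqrt)

lemma L2_norm_nonneg: "0 \<le> Lp_norm 2 G v"
  by (simp add: Lp_norm_def)

lemma L2_norm_eq_sqrt: "Lp_norm 2 G v = sqrt (LINT x|lebesgue_on G. (cmod (v x))\<^sup>2)"
  by (simp add: Lp_norm_def powr_half_sqrt)

lemma in_L2_measurable: "in_Lp 2 G v \<Longrightarrow> v \<in> borel_measurable (lebesgue_on G)"
  by (simp add: in_Lp_def)

lemma in_L2_bound:
  assumes v: "v \<in> borel_measurable (lebesgue_on G)" and w: "integrable (lebesgue_on G) w"
    and le: "\<And>x. (cmod (v x))\<^sup>2 \<le> w x"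
  shows "in_Lp 2 G v"
  unfolding in_L2_iff
proof (intro conjI v Bochner_Integration.integrable_bound[OF w])
  show "(\<lambda>x. (cmod (v x))\<^sup>2) \<in> borel_measurable (lebesgue_on G)" using v by measurable
  show "AE x in lebesgue_on G. norm ((cmod (v x))\<^sup>2) \<le> norm (w x)"
    using le by (intro AE_I2) (simp add: order_trans[OF _ abs_ge_self])
qed

lemma norm_add_squared_le: "(norm (a + b))\<^sup>2 \<le> 2 * (norm a)\<^sup>2 + 2 * (norm (b::'a::real_normed_vector))\<^sup>2"
proof -
  have "(norm (a + b))\<^sup>2 \<le> (norm a + norm b)\<^sup>2"
    by (intro power_mono norm_triangle_ineq) simp
  also have "\<dots> \<le> 2 * (norm a)\<^sup>2 + 2 * (norm b)\<^sup>2"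
    using zero_le_power2[of "norm a - norm b"] by (simp add: power2_sum power2_diff)
  finally show ?thesis .
qed

lemma norm_diff_squared_le: "(norm (a - b))\<^sup>2 \<le> 2 * (norm a)\<^sup>2 + 2 * (norm (b::'a::real_normed_vector))\<^sup>2"
  using norm_add_squared_le[of a "- b"] by simp

lemma in_L2_add: 
  assumes "in_Lp 2 G u" "in_Lp 2 G v" shows "in_Lp 2 G (\<lambda>x. u x + v x)"
  using assms unfolding in_L2_iff
  by (intro in_L2_bound[unfolded in_L2_iff, OF _ _ norm_add_squared_le]) auto

lemma in_L2_diff:
  assumes "in_Lp 2 G u" "in_Lp 2 G v" shows "in_Lp 2 G (\<lambda>x. u x - v x)"
  using assms unfolding in_L2_iff
  by (intro in_L2_bound[unfolded in_L2_iff, OF _ _ norm_diff_squared_le]) auto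

lemma in_L2_mult_bounded:
  assumes "in_Lp 2 G u" "b \<in> borel_measurable (lebesgue_on G)" "\<And>x. cmod (b x) \<le> C"
  shows "in_Lp 2 G (\<lambda>x. b x * u x)"
proof (rule in_L2_bound[where w="\<lambda>x. C\<^sup>2 * (cmod (u x))\<^sup>2"])
  show "(cmod (b x * u x))\<^sup>2 \<le> C\<^sup>2 * (cmod (u x))\<^sup>2" for x
    using assms(3)[of x] by (auto simp: norm_mult power_mult_distrib intro!: mult_right_mono power_mono)
qed (use assms in \<open>auto simp: in_L2_iff\<close>)

lemma in_L2_cmult: "in_Lp 2 G u \<Longrightarrow> in_Lp 2 G (\<lambda>x. c * u x)"
  by (rule in_L2_mult_bounded[where C="cmod c"]) auto

lemma in_L2_zero: "in_Lp 2 G (\<lambda>x. 0)"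
  by (simp add: in_L2_iff)

lemma in_L2_sum: "finite J \<Longrightarrow> (\<And>j. in_Lp 2 G (f j)) \<Longrightarrow> in_Lp 2 G (\<lambda>x. \<Sum>j\<in>J. f j x)"
  by (induction J rule: finite_induct) (auto simp: in_L2_zero in_L2_add)

lemma in_L2_product_integrable:
  assumes "in_Lp 2 G u" "in_Lp 2 G v"
  shows "integrable (lebesgue_on G) (\<lambda>x. u x * v x)"
proof (rule Bochner_Integration.integrable_bound[where f="\<lambda>x. (cmod (u x))\<^sup>2 + (cmod (v x))\<^sup>2"])
  show "AE x in lebesgue_on G. norm (u x * v x) \<le> norm ((cmod (u x))\<^sup>2 + (cmod (v x))\<^sup>2)"
  proof (intro AE_I2)
    fix x
    have "2 * (cmod (u x) * cmod (v x)) \<le> (cmod (u x))\<^sup>2 + (cmod (v x))\<^sup>2"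
      using zero_le_power2[of "cmod (u x) - cmod (v x)"] by (simp add: power2_diff)
    moreover have "0 \<le> cmod (u x) * cmod (v x)" by simp
    ultimately have "cmod (u x) * cmod (v x) \<le> (cmod (u x))\<^sup>2 + (cmod (v x))\<^sup>2"
      by linarith
    then show "norm (u x * v x) \<le> norm ((cmod (u x))\<^sup>2 + (cmod (v x))\<^sup>2)"
      by (simp add: norm_mult)
  qed
qed (use assms in \<open>auto simp: in_L2_iff\<close>)

lemma cnj_measurable:
  assumes "X \<in> borel_measurable M" shows "(\<lambda>x. cnj (X x)) \<in> borel_measurable M"
  using measurable_compose[OF assms borel_measurable_continuous_onI[OF continuous_on_cnj[OF continuous_on_id]]]
  by simp

lemma in_L2_cnj: "in_Lp 2 G v \<Longrightarrow> in_Lp 2 G (\<lambda>x. cnj (v x))"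
  by (simp add: in_L2_iff cnj_measurable)

lemma in_L2_subset:
  assumes "in_Lp 2 G v" "H \<subseteq> G" "G \<in> sets lebesgue" "H \<in> sets lebesgue"
  shows "in_Lp 2 H v"
proof -
  have eq: "lebesgue_on H = restrict_space (lebesgue_on G) H"
    using assms by (simp add: restrict_restrict_space inf.absorb2)
  have H: "H \<inter> space (lebesgue_on G) \<in> sets (lebesgue_on G)"
    using assms by (auto simp: sets_restrict_space space_restrict_space)
  have "integrable (lebesgue_on G) (\<lambda>x. indicator H x *\<^sub>R (cmod (v x))\<^sup>2)"
    using assms H by (intro integrable_mult_indicator) (auto simp: in_L2_iff sets_restrict_space)
  then show ?thesis using assms unfolding in_L2_iff eq
    by (auto simp: integrable_restrict_space[OF H] intro: measurable_restrict_space1)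
qed

lemma L2_norm_cong_AE:
  assumes "u \<in> borel_measurable (lebesgue_on G)" "v \<in> borel_measurable (lebesgue_on G)"
    and "AE x in lebesgue_on G. u x = v x"
  shows "Lp_norm 2 G u = Lp_norm 2 G v"
proof -
  have "(LINT x|lebesgue_on G. (cmod (u x))\<^sup>2) = (LINT x|lebesgue_on G. (cmod (v x))\<^sup>2)"
    using assms(3) by (intro integral_cong_AE) (use assms(1,2) in auto)
  then show ?thesis by (simp add: L2_norm_eq_sqrt)
qed

lemma L2_norm_zero_AE:
  assumes "in_Lp 2 G u" "Lp_norm 2 G u = 0"
  shows "AE x in lebesgue_on G. u x = 0"
  using assms integral_nonneg_eq_0_iff_AE[of "lebesgue_on G" "\<lambda>x. (cmod (u x))\<^sup>2"]
  by (auto simp: in_L2_iff L2_norm_eq_sqrt)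

lemma in_L2_integrable:
  assumes G: "G \<in> lmeasurable" and u: "in_Lp 2 G u"
  shows "integrable (lebesgue_on G) u"
proof -
  have "in_Lp 2 G (\<lambda>x. 1)"
    using G finite_measure.integrable_const[OF finite_measure_lebesgue_on[OF G], of 1]
    by (simp add: in_L2_iff)
  from in_L2_product_integrable[OF u this] show ?thesis by simp
qed

lemma bounded_in_L2:
  assumes "G \<in> lmeasurable" "f \<in> borel_measurable (lebesgue_on G)" "\<exists>K. \<forall>x. cmod (f x) \<le> K"
  shows "in_Lp 2 G f"
proof -
  obtain K where K: "\<And>x. cmod (f x) \<le> K" using assms(3) by blast
  show ?thesis
  proof (rule in_L2_bound[where w="\<lambda>x. K\<^sup>2"])
    show "integrable (lebesgue_on G) (\<lambda>x. K\<^sup>2)"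
      using finite_measure.integrable_const[OF finite_measure_lebesgue_on[OF assms(1)]] .
  qed (use assms(2) K in \<open>auto intro: power_mono\<close>)
qed

section \<open>Weak gradients\<close>

lemma smooth_fun_pderiv:
  assumes "smooth_fun \<phi>"
  shows "(\<phi> has_derivative (\<lambda>h. \<Sum>i\<in>UNIV. (h $ i) *\<^sub>R pderiv_at i \<phi> x)) (at x)"
    "continuous_on UNIV (pderiv_at i \<phi>)"
proof -
  obtain D where D0: "D [] = \<phi>"
    and D: "\<And>is x. (D is has_derivative (\<lambda>h. \<Sum>i\<in>UNIV. (h $ i) *\<^sub>R D (i # is) x)) (at x)"
    using assms unfolding smooth_fun_def by blast
  have der: "(\<phi> has_derivative (\<lambda>h. \<Sum>i\<in>UNIV. (h $ i) *\<^sub>R D [i] x)) (at x)" for x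
    using D[of "[]" x] by (simp add: D0)
  have pd: "pderiv_at i \<phi> = D [i]" for i
  proof
    fix x
    have "frechet_derivative \<phi> (at x) = (\<lambda>h. \<Sum>i\<in>UNIV. (h $ i) *\<^sub>R D [i] x)"
      using frechet_derivative_at[OF der] by simp
    then show "pderiv_at i \<phi> x = D [i] x"
      by (simp add: pderiv_at_def axis_def if_distrib[of "\<lambda>r. r *\<^sub>R _"] cong: if_cong)
  qed
  show "(\<phi> has_derivative (\<lambda>h. \<Sum>i\<in>UNIV. (h $ i) *\<^sub>R pderiv_at i \<phi> x)) (at x)"
    using der pd by simp
  show "continuous_on UNIV (pderiv_at i \<phi>)"
    unfolding pd using has_derivative_continuous[OF D] by (simp add: continuous_at_imp_continuous_on)
qed

lemma test_fun_bounded: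
  assumes "test_fun G \<phi>"
  shows "\<phi> \<in> borel_measurable (lebesgue_on G)" "\<exists>C. \<forall>x. cmod (\<phi> x) \<le> C"
    "pderiv_at i \<phi> \<in> borel_measurable (lebesgue_on G)" "\<exists>C. \<forall>x. cmod (pderiv_at i \<phi> x) \<le> C"
    "x \<notin> G \<Longrightarrow> \<phi> x = 0" "x \<notin> G \<Longrightarrow> pderiv_at i \<phi> x = 0"
proof -
  let ?K = "closure {x. \<phi> x \<noteq> 0}"
  have K: "compact ?K" "?K \<subseteq> G" using assms by (auto simp: test_fun_def)
  have sm: "smooth_fun \<phi>" using assms by (simp add: test_fun_def)
  have off: "\<phi> x = 0" if "x \<notin> ?K" for x using that closure_subset[of "{x. \<phi> x \<noteq> 0}"] by auto
  have offd: "pderiv_at i \<phi> x = 0" if "x \<notin> ?K" for x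
  proof -
    have "(\<phi> has_derivative (\<lambda>h. 0)) (at x)"
    proof (rule has_derivative_transform_within_open)
      show "((\<lambda>x. 0) has_derivative (\<lambda>h. 0)) (at x)" by simp
      show "open (- ?K)" using closed_closure by (rule open_Compl)
      show "x \<in> - ?K" using that by simp
      show "\<And>y. y \<in> - ?K \<Longrightarrow> 0 = \<phi> y" by (rule off[symmetric]) simp
    qed
    from frechet_derivative_at[OF this] show ?thesis by (metis pderiv_at_def)
  qed
  have bdd: "\<exists>C. \<forall>x. cmod (f x) \<le> C" if f: "continuous_on UNIV f" "\<And>x. x \<notin> ?K \<Longrightarrow> f x = 0" for f
  proof -
    have "bounded (f ` ?K)"
      using K f by (intro compact_imp_bounded compact_continuous_image) (auto intro: continuous_on_subset)
    then obtain C where C: "\<And>x. x \<in> ?K \<Longrightarrow> cmod (f x) \<le> C" by (auto simp: bounded_iff)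
    show ?thesis
    proof (intro exI[of _ "max C 0"] allI)
      fix x show "cmod (f x) \<le> max C 0" using C[of x] f(2)[of x] by (cases "x \<in> ?K") auto
    qed
  qed
  have meas: "f \<in> borel_measurable (lebesgue_on G)" if "continuous_on UNIV f" for f :: "real^'a \<Rightarrow> complex"
    using borel_measurable_continuous_onI[OF that] 
    by (intro measurable_restrict_space1 measurable_completion) simp
  show "\<phi> \<in> borel_measurable (lebesgue_on G)" "\<exists>C. \<forall>x. cmod (\<phi> x) \<le> C"
    using meas bdd smooth_fun_continuous[OF sm] off by blast+
  show "pderiv_at i \<phi> \<in> borel_measurable (lebesgue_on G)" "\<exists>C. \<forall>x. cmod (pderiv_at i \<phi> x) \<le> C"
    using meas bdd smooth_fun_pderiv(2)[OF sm] offd by blast+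
  show "\<phi> x = 0" if "x \<notin> G" using that K(2) off[of x] by blast
  show "pderiv_at i \<phi> x = 0" if "x \<notin> G" using that K(2) offd[of x] by blast
qed

lemma integrable_mult_test_fun:
  assumes G: "G \<in> lmeasurable" and u: "in_Lp 2 G u" and \<phi>: "test_fun G \<phi>"
  shows "integrable (lebesgue_on G) (\<lambda>x. u x * \<phi> x)"
    "integrable (lebesgue_on G) (\<lambda>x. u x * pderiv_at i \<phi> x)"
proof -
  obtain C where "\<And>x. cmod (\<phi> x) \<le> C" using test_fun_bounded(2)[OF \<phi>] by blast
  from in_L2_mult_bounded[OF u test_fun_bounded(1)[OF \<phi>] this]
  show "integrable (lebesgue_on G) (\<lambda>x. u x * \<phi> x)"
    using in_L2_integrable[OF G] by (simp add: mult.commute)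
  obtain C where "\<And>x. cmod (pderiv_at i \<phi> x) \<le> C" using test_fun_bounded(4)[OF \<phi>] by blast
  from in_L2_mult_bounded[OF u test_fun_bounded(3)[OF \<phi>] this]
  show "integrable (lebesgue_on G) (\<lambda>x. u x * pderiv_at i \<phi> x)"
    using in_L2_integrable[OF G] by (simp add: mult.commute)
qed

text \<open>
  The constant \<open>wgrad\<close> picks an arbitrary weak gradient; this lemma is what makes
  statements about it possible, always up to null sets.
\<close>

lemma weak_gradient_AE_unique:
  assumes G: "open G" "bounded G" and u: "in_Lp 2 G u" "in_Lp 2 G u'"
    and g: "is_weak_gradient G u g" "is_weak_gradient G u' g'"
    and eq: "AE x in lebesgue_on G. u x = u' x"
  shows "AE x in lebesgue_on G. g x = g' x"
proof -
  have Gm: "G \<in> lmeasurable" using G by (simp add: lmeasurable_open)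
  have "AE x in lebesgue_on G. g x $ i - g' x $ i = 0" for i
  proof (rule integral_test_fun_zero_imp_AE_zero[OF G(1)])
    have L2: "in_Lp 2 G (\<lambda>x. g x $ i)" "in_Lp 2 G (\<lambda>x. g' x $ i)"
      using g by (auto simp: is_weak_gradient_def)
    show "integrable (lebesgue_on G) (\<lambda>x. g x $ i - g' x $ i)"
      by (intro in_L2_integrable[OF Gm] in_L2_diff L2)
    fix \<phi> :: "real^'a \<Rightarrow> complex" assume \<phi>: "test_fun G \<phi>"
    have "(LINT x|lebesgue_on G. u x * pderiv_at i \<phi> x) = (LINT x|lebesgue_on G. u' x * pderiv_at i \<phi> x)"
      using eq by (intro integral_cong_AE borel_measurable_times in_L2_measurable u test_fun_bounded[OF \<phi>]) auto
    then have "(LINT x|lebesgue_on G. g x $ i * \<phi> x) = (LINT x|lebesgue_on G. g' x $ i * \<phi> x)"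
      using g \<phi> by (auto simp: is_weak_gradient_def)
    then show "(LINT x|lebesgue_on G. (g x $ i - g' x $ i) * \<phi> x) = 0"
      using integrable_mult_test_fun(1)[OF Gm L2(1) \<phi>] integrable_mult_test_fun(1)[OF Gm L2(2) \<phi>]
      by (simp add: left_diff_distrib)
  qed
  then have "AE x in lebesgue_on G. \<forall>i. g x $ i - g' x $ i = 0"
    by (subst AE_all_countable) auto
  then show ?thesis by eventually_elim (simp add: vec_eq_iff)
qed

lemma weak_gradient_diff:
  assumes G: "open G" "bounded G" and u: "in_Lp 2 G u" "in_Lp 2 G v"
    and g: "is_weak_gradient G u g" "is_weak_gradient G v h"
  shows "is_weak_gradient G (\<lambda>x. u x - v x) (\<lambda>x. g x - h x)"
  unfolding is_weak_gradient_def
proof (intro conjI allI impI)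
  have Gm: "G \<in> lmeasurable" using G by (simp add: lmeasurable_open)
  have L2: "in_Lp 2 G (\<lambda>x. g x $ i)" "in_Lp 2 G (\<lambda>x. h x $ i)" for i
    using g by (auto simp: is_weak_gradient_def)
  then show "in_Lp 2 G (\<lambda>x. (g x - h x) $ i)" for i
    using in_L2_diff[OF L2[of i]] by simp
  fix \<phi> i assume \<phi>: "test_fun G \<phi>"
  note int = integrable_mult_test_fun[OF Gm _ \<phi>]
  have "(LINT x|lebesgue_on G. (u x - v x) * pderiv_at i \<phi> x)
      = (LINT x|lebesgue_on G. u x * pderiv_at i \<phi> x) - (LINT x|lebesgue_on G. v x * pderiv_at i \<phi> x)"
    using int(2)[OF u(1)] int(2)[OF u(2)] by (simp add: left_diff_distrib)
  also have "\<dots> = - ((LINT x|lebesgue_on G. g x $ i * \<phi> x) - (LINT x|lebesgue_on G. h x $ i * \<phi> x))"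
    using g \<phi> by (auto simp: is_weak_gradient_def)
  also have "(LINT x|lebesgue_on G. g x $ i * \<phi> x) - (LINT x|lebesgue_on G. h x $ i * \<phi> x)
      = (LINT x|lebesgue_on G. (g x - h x) $ i * \<phi> x)"
    using int(1)[OF L2(1)[of i]] int(1)[OF L2(2)[of i]] by (simp add: left_diff_distrib)
  finally show "(LINT x|lebesgue_on G. (u x - v x) * pderiv_at i \<phi> x)
      = - (LINT x|lebesgue_on G. (g x - h x) $ i * \<phi> x)" .
qed

lemma weak_gradient_subset:
  assumes H: "open H" "H \<subseteq> G" "open G" and g: "is_weak_gradient G u g"
  shows "is_weak_gradient H u g"
  unfolding is_weak_gradient_def
proof (intro conjI allI impI)
  have sets: "H \<inter> space lebesgue \<in> sets lebesgue" "G \<inter> space lebesgue \<in> sets lebesgue"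
    using H by auto
  show "in_Lp 2 H (\<lambda>x. g x $ i)" for i
    using g H sets by (intro in_L2_subset[of G _ H]) (auto simp: is_weak_gradient_def)
  fix \<phi> i assume \<phi>: "test_fun H \<phi>"
  then have "test_fun G \<phi>" using H by (auto simp: test_fun_def)
  then have eq: "(LINT x|lebesgue_on G. u x * pderiv_at i \<phi> x) = - (LINT x|lebesgue_on G. g x $ i * \<phi> x)"
    using g by (auto simp: is_weak_gradient_def)
  have ext: "(LINT x|lebesgue_on G. f x * \<psi> x) = (LINT x|lebesgue_on H. f x * \<psi> x)"
    if "\<And>x. x \<notin> H \<Longrightarrow> \<psi> x = 0" for f \<psi> :: "real^'a \<Rightarrow> complex"
    unfolding integral_restrict_space[OF sets(1)] integral_restrict_space[OF sets(2)]
    using H that by (intro Bochner_Integration.integral_cong) (auto simp: indicator_def)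
  show "(LINT x|lebesgue_on H. u x * pderiv_at i \<phi> x) = - (LINT x|lebesgue_on H. g x $ i * \<phi> x)"
    using eq ext[of "pderiv_at i \<phi>" u] ext[of \<phi> "\<lambda>x. g x $ i"] test_fun_bounded(5,6)[OF \<phi>] by simp
qed

lemma wgrad_is_weak_gradient:
  assumes "H1 G u" shows "is_weak_gradient G u (wgrad G u)"
proof -
  obtain g where "is_weak_gradient G u g" using assms by (auto simp: H1_def)
  then show ?thesis unfolding wgrad_def by (rule someI[of "is_weak_gradient G u"])
qed

lemma H1_in_L2: "H1 G u \<Longrightarrow> in_Lp 2 G u"
  by (simp add: H1_def)

lemma wgrad_in_L2: "H1 G u \<Longrightarrow> in_Lp 2 G (\<lambda>x. wgrad G u x $ i)"
  using wgrad_is_weak_gradient by (auto simp: is_weak_gradient_def)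

lemma H1_diff:
  assumes "open G" "bounded G" "H1 G u" "H1 G v"
  shows "H1 G (\<lambda>x. u x - v x)"
  using assms weak_gradient_diff[of G u v "wgrad G u" "wgrad G v"]
  by (auto simp: H1_in_L2 wgrad_is_weak_gradient in_L2_diff intro: H1_def[THEN iffD2])

lemma wgrad_diff:
  assumes "open G" "bounded G" "H1 G u" "H1 G v"
  shows "AE x in lebesgue_on G. wgrad G (\<lambda>x. u x - v x) x = wgrad G u x - wgrad G v x"
  using assms H1_diff[OF assms] weak_gradient_diff[of G u v "wgrad G u" "wgrad G v"]
  by (intro weak_gradient_AE_unique[of G "\<lambda>x. u x - v x" "\<lambda>x. u x - v x"])
     (auto simp: H1_in_L2 wgrad_is_weak_gradient in_L2_diff)

lemma H1_subset:
  assumes "open H" "H \<subseteq> G" "open G" "H1 G u"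
  shows "H1 H u"
  using assms weak_gradient_subset[OF assms(1-3) wgrad_is_weak_gradient[OF assms(4)]]
  by (auto simp: H1_def intro!: in_L2_subset[of G])

lemma wgrad_subset:
  assumes "open H" "H \<subseteq> G" "open G" "bounded G" "H1 G u"
  shows "AE x in lebesgue_on H. wgrad H u x = wgrad G u x"
  using assms H1_subset[OF assms(1-3,5)]
  by (intro weak_gradient_AE_unique[of H u u])
     (auto simp: H1_in_L2 wgrad_is_weak_gradient intro: bounded_subset weak_gradient_subset)

text \<open>
  Integration by parts in its simplest form: by translation invariance of Lebesgue measure all
  difference quotients of \<open>F\<close> have integral 0, and they tend dominatedly to the directional
  derivative.
\<close>

lemma integral_directional_derivative_zero:
  fixes F P :: "real^'n \<Rightarrow> complex"
  assumes der: "\<And>x. (F has_derivative F' x) (at x)" and P: "\<And>x. F' x e = P x"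
    and cont: "continuous_on UNIV P" and supp: "\<And>x. norm x \<ge> r \<Longrightarrow> F x = 0"
    and bound: "\<And>x. cmod (P x) \<le> C" and e: "norm e \<le> 1"
  shows "(LINT x|lborel. P x) = 0"
proof -
  define s where "s n = 1 / real (Suc n)" for n
  have s: "0 < s n" "s n \<le> 1" for n by (auto simp: s_def field_simps)
  define q where "q n x = (F (s n *\<^sub>R e + x) - F x) /\<^sub>R s n" for n x
  have contF: "continuous_on UNIV F"
    using has_derivative_continuous[OF der] by (simp add: continuous_at_imp_continuous_on)
  then have Fm: "F \<in> borel_measurable borel" by (rule borel_measurable_continuous_onI)
  have Pm: "P \<in> borel_measurable borel" using cont by (rule borel_measurable_continuous_onI)
  have ball: "integrable lborel (\<lambda>x. indicator (cball (0::real^'n) \<rho>) x * B)" for \<rho> B :: real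
    using emeasure_bounded_finite[of "cball (0::real^'n) \<rho>"] by (intro integrable_mult_left integrable_real_indicator) auto
  have Fint: "integrable lborel F"
  proof -
    have "bounded (F ` cball 0 r)"
      by (intro compact_imp_bounded compact_continuous_image continuous_on_subset[OF contF]) auto
    then obtain B where "\<forall>x\<in>cball 0 r. cmod (F x) \<le> B" by (auto simp: bounded_iff)
    then have B: "\<And>x. norm x \<le> r \<Longrightarrow> cmod (F x) \<le> B" by simp
    show ?thesis
    proof (rule Bochner_Integration.integrable_bound[OF ball[of r B]])
      show "AE x in lborel. norm (F x) \<le> norm (indicator (cball 0 r) x * B)"
      proof (intro AE_I2)
        fix x show "norm (F x) \<le> norm (indicator (cball 0 r) x * B)"
          using B[of x] supp[of x] by (cases "norm x \<le> r") (auto simp: indicator_def)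
      qed
    qed (use Fm in simp)
  qed
  have shift: "integrable lborel (\<lambda>x. F (c + x))" "(LINT x|lborel. F (c + x)) = (LINT x|lborel. F x)" for c
  proof -
    have "integrable (distr lborel borel ((+) c)) F"
      using Fint by (simp add: lborel_distr_plus)
    then show "integrable lborel (\<lambda>x. F (c + x))"
      using Fm by (simp add: integrable_distr_eq)
    have "(LINT x|distr lborel borel ((+) c). F x) = (LINT x|lborel. F (c + x))"
      using Fm by (intro integral_distr) auto
    then show "(LINT x|lborel. F (c + x)) = (LINT x|lborel. F x)"
      by (simp add: lborel_distr_plus)
  qed
  have q0: "(LINT x|lborel. q n x) = 0" for n
    unfolding q_def using shift[of "s n *\<^sub>R e"] Fint by simp
  have along: "((\<lambda>t. F (t *\<^sub>R e + x)) has_derivative (\<lambda>h. h *\<^sub>R P (t *\<^sub>R e + x))) (at t within S)" for t x S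
  proof -
    have lin: "linear (F' (t *\<^sub>R e + x))" using der has_derivative_linear by blast
    have "((\<lambda>t. t *\<^sub>R e + x) has_derivative (\<lambda>h. h *\<^sub>R e)) (at t within S)"
      by (auto intro!: derivative_eq_intros)
    from has_derivative_compose[OF this der]
    show ?thesis by (simp add: linear_cmul[OF lin] P)
  qed
  have C0: "0 \<le> C" using bound[of 0] norm_ge_zero order_trans by blast
  have q_le: "cmod (q n x) \<le> C" for n x
  proof -
    have "norm (F (s n *\<^sub>R e + x) - F (0 *\<^sub>R e + x)) \<le> C * norm (s n - 0)"
    proof (rule differentiable_bound[where S=UNIV and f'="\<lambda>t h. h *\<^sub>R P (t *\<^sub>R e + x)"])
      show "onorm (\<lambda>h. h *\<^sub>R P (t *\<^sub>R e + x)) \<le> C" for t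
        using bound C0 by (intro onorm_bound) (auto simp: mult.commute[of C] intro: mult_left_mono)
    qed (use along in auto)
    then have "cmod (F (s n *\<^sub>R e + x) - F x) / s n \<le> C"
      using s[of n] by (simp add: divide_le_eq)
    then show ?thesis using s[of n] by (simp add: q_def divide_inverse mult.commute)
  qed
  have q_supp: "q n x = 0" if "norm x > r + 1" for n x
  proof -
    have "norm (s n *\<^sub>R e) \<le> 1"
      using s[of n] e by (simp add: mult_le_one)
    then have "norm (s n *\<^sub>R e + x) \<ge> r"
      using norm_triangle_ineq4[of "s n *\<^sub>R e + x" "s n *\<^sub>R e"] that by simp
    then show ?thesis using that supp[of x] supp[of "s n *\<^sub>R e + x"] by (simp add: q_def)
  qed
  have "(\<lambda>n. LINT x|lborel. q n x) \<longlonglongrightarrow> (LINT x|lborel. P x)"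
  proof (rule integral_dominated_convergence[where w="\<lambda>x. indicator (cball 0 (r + 1)) x * C"])
    show "P \<in> borel_measurable lborel" using Pm by simp
    have [measurable]: "F \<in> borel_measurable borel" by fact
    show "q n \<in> borel_measurable lborel" for n unfolding q_def by measurable
    show "integrable lborel (\<lambda>x. indicator (cball (0::real^'n) (r + 1)) x * C)" by (rule ball)
    show "AE x in lborel. norm (q n x) \<le> indicator (cball 0 (r + 1)) x * C" for n
    proof (intro AE_I2)
      fix x show "norm (q n x) \<le> indicator (cball 0 (r + 1)) x * C"
        using q_le[of n x] q_supp[of x n] by (cases "norm x \<le> r + 1") (auto simp: indicator_def)
    qed
    show "AE x in lborel. (\<lambda>n. q n x) \<longlonglongrightarrow> P x"
    proof (intro AE_I2)
      fix x
      have lim: "((\<lambda>t. norm (F (t *\<^sub>R e + x) - F x - t *\<^sub>R P x) / norm t) \<longlongrightarrow> 0) (at 0)"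
        using along[of x 0 UNIV] by (simp add: has_derivative_at)
      have "((\<lambda>t. (F (t *\<^sub>R e + x) - F x) /\<^sub>R t - P x) \<longlongrightarrow> 0) (at 0)"
      proof (rule tendsto_norm_zero_cancel, rule Lim_transform_eventually[OF lim])
        have "norm (F (t *\<^sub>R e + x) - F x - t *\<^sub>R P x) / norm t = norm ((F (t *\<^sub>R e + x) - F x) /\<^sub>R t - P x)"
          if "t \<noteq> 0" for t :: real
        proof -
          have "(F (t *\<^sub>R e + x) - F x) /\<^sub>R t - P x = (F (t *\<^sub>R e + x) - F x - t *\<^sub>R P x) /\<^sub>R t"
            using that by (simp add: scaleR_diff_right)
          then show ?thesis by (simp add: divide_inverse mult.commute)
        qed
        then show "\<forall>\<^sub>F t in at 0. norm (F (t *\<^sub>R e + x) - F x - t *\<^sub>R P x) / norm t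
            = norm ((F (t *\<^sub>R e + x) - F x) /\<^sub>R t - P x)"
          by (simp add: eventually_at_filter)
      qed
      then have "((\<lambda>t. (F (t *\<^sub>R e + x) - F x) /\<^sub>R t) \<longlongrightarrow> P x) (at 0)"
        by (rule LIM_zero_cancel)
      moreover have "filterlim s (at 0) sequentially"
        using LIMSEQ_inverse_real_of_nat s(1)
        by (auto simp: filterlim_at s_def[abs_def] inverse_eq_divide)
      ultimately show "(\<lambda>n. q n x) \<longlonglongrightarrow> P x"
        unfolding q_def by (rule filterlim_compose)
    qed
  qed
  then show ?thesis by (simp add: q0 LIMSEQ_const_iff)
qed

lemma test_fun_support_bounded:
  assumes "test_fun G \<phi>" obtains r where "\<And>x. norm x \<ge> r \<Longrightarrow> \<phi> x = 0"
proof -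
  have "bounded {x. \<phi> x \<noteq> 0}"
    using assms by (auto simp: test_fun_def intro: bounded_subset[OF compact_imp_bounded closure_subset])
  then obtain B where "\<And>x. \<phi> x \<noteq> 0 \<Longrightarrow> norm x \<le> B" by (auto simp: bounded_iff)
  then show ?thesis using that[of "B + 1"] by fastforce
qed

lemma test_fun_integration_by_parts:
  assumes G: "open G" "bounded G" and \<phi>: "test_fun G \<phi>" and \<psi>: "test_fun G \<psi>"
  shows "(LINT x|lebesgue_on G. \<phi> x * pderiv_at i \<psi> x) = - (LINT x|lebesgue_on G. pderiv_at i \<phi> x * \<psi> x)"
proof -
  have sm: "smooth_fun \<phi>" "smooth_fun \<psi>" using \<phi> \<psi> by (auto simp: test_fun_def)
  have Gm: "G \<in> lmeasurable" using G by (simp add: lmeasurable_open)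
  let ?P = "\<lambda>x. \<phi> x * pderiv_at i \<psi> x + pderiv_at i \<phi> x * \<psi> x"
  obtain r where r: "\<And>x. norm x \<ge> r \<Longrightarrow> \<phi> x = 0" using test_fun_support_bounded[OF \<phi>] by metis
  obtain A where A: "\<And>x. cmod (\<phi> x) \<le> A" using test_fun_bounded(2)[OF \<phi>] by blast
  obtain A' where A': "\<And>x. cmod (pderiv_at i \<phi> x) \<le> A'" using test_fun_bounded(4)[OF \<phi>] by blast
  obtain B where B: "\<And>x. cmod (\<psi> x) \<le> B" using test_fun_bounded(2)[OF \<psi>] by blast
  obtain B' where B': "\<And>x. cmod (pderiv_at i \<psi> x) \<le> B'" using test_fun_bounded(4)[OF \<psi>] by blast
  have cont: "continuous_on UNIV ?P"
    by (intro continuous_intros smooth_fun_continuous smooth_fun_pderiv sm)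
  have "(LINT x|lborel. ?P x) = 0"
  proof (rule integral_directional_derivative_zero[where F="\<lambda>x. \<phi> x * \<psi> x" and e="axis i 1" and r=r
        and F'="\<lambda>x h. \<phi> x * (\<Sum>i\<in>UNIV. (h $ i) *\<^sub>R pderiv_at i \<psi> x) +
                       (\<Sum>i\<in>UNIV. (h $ i) *\<^sub>R pderiv_at i \<phi> x) * \<psi> x"])
    show "((\<lambda>x. \<phi> x * \<psi> x) has_derivative
        (\<lambda>h. \<phi> x * (\<Sum>i\<in>UNIV. (h $ i) *\<^sub>R pderiv_at i \<psi> x) +
              (\<Sum>i\<in>UNIV. (h $ i) *\<^sub>R pderiv_at i \<phi> x) * \<psi> x)) (at x)" for x
      by (intro has_derivative_mult smooth_fun_pderiv sm)
    have "(\<Sum>j\<in>UNIV. (axis i 1 $ j) *\<^sub>R f j) = f i" for f :: "_ \<Rightarrow> complex"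
      by (simp add: axis_def if_distrib[of "\<lambda>r. r *\<^sub>R _"] cong: if_cong)
    then show "\<phi> x * (\<Sum>j\<in>UNIV. (axis i 1 $ j) *\<^sub>R pderiv_at j \<psi> x) +
              (\<Sum>j\<in>UNIV. (axis i 1 $ j) *\<^sub>R pderiv_at j \<phi> x) * \<psi> x = ?P x" for x
      by simp
    show "cmod (?P x) \<le> A * B' + A' * B" for x
    proof -
      have "cmod (\<phi> x * pderiv_at i \<psi> x) \<le> A * B'"
        unfolding norm_mult using A[of x] B'[of x] order_trans[OF norm_ge_zero A[of x]]
        by (intro mult_mono) auto
      moreover have "cmod (pderiv_at i \<phi> x * \<psi> x) \<le> A' * B"
        unfolding norm_mult using A'[of x] B[of x] order_trans[OF norm_ge_zero A'[of x]]
        by (intro mult_mono) auto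
      ultimately show ?thesis using norm_triangle_ineq order_trans add_mono by metis
    qed
  qed (use r cont in auto)
  then have "(LINT x|lebesgue. ?P x) = 0"
    using borel_measurable_continuous_onI[OF cont] by (simp add: integral_completion)
  moreover have "(LINT x|lebesgue. ?P x) = (LINT x|lebesgue_on G. ?P x)"
    using G test_fun_bounded(5)[OF \<phi>] test_fun_bounded(5)[OF \<psi>]
    by (subst integral_restrict_space) (auto intro!: Bochner_Integration.integral_cong simp: indicator_def)
  moreover have "in_Lp 2 G \<phi>" "in_Lp 2 G \<psi>"
    using bounded_in_L2[OF Gm] test_fun_bounded[OF \<phi>] test_fun_bounded[OF \<psi>] by auto
  ultimately show ?thesis
    using integrable_mult_test_fun(2)[OF Gm _ \<psi>, of \<phi> i] integrable_mult_test_fun(2)[OF Gm _ \<phi>, of \<psi> i]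
    by (simp add: mult.commute add_eq_0_iff2)
qed

text \<open>
  The definition of \<open>H10\<close> measures the distance to a test function with the \<open>H1\<close>-norm,
  which is meaningful only because test functions lie in \<open>H1\<close> themselves.
\<close>

lemma test_fun_H1:
  assumes G: "open G" "bounded G" and \<phi>: "test_fun G \<phi>"
  shows "H1 G \<phi>"
proof -
  have Gm: "G \<in> lmeasurable" using G by (simp add: lmeasurable_open)
  have "is_weak_gradient G \<phi> (\<lambda>x. \<chi> i. pderiv_at i \<phi> x)"
    using test_fun_integration_by_parts[OF G \<phi>] bounded_in_L2[OF Gm] test_fun_bounded[OF \<phi>]
    by (auto simp: is_weak_gradient_def)
  then show ?thesis using bounded_in_L2[OF Gm] test_fun_bounded[OF \<phi>] unfolding H1_def by blast
qed

lemma test_fun_diff: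
  assumes "test_fun G \<phi>" "test_fun G \<psi>" shows "test_fun G (\<lambda>x. \<phi> x - \<psi> x)"
proof -
  obtain D where D0: "D [] = \<phi>"
    and D: "\<And>is x. (D is has_derivative (\<lambda>h. \<Sum>i\<in>UNIV. (h $ i) *\<^sub>R D (i # is) x)) (at x)"
    using assms(1) unfolding test_fun_def smooth_fun_def by blast
  obtain E where E0: "E [] = \<psi>"
    and E: "\<And>is x. (E is has_derivative (\<lambda>h. \<Sum>i\<in>UNIV. (h $ i) *\<^sub>R E (i # is) x)) (at x)"
    using assms(2) unfolding test_fun_def smooth_fun_def by blast
  have "((\<lambda>x. D is x - E is x) has_derivative
      (\<lambda>h. \<Sum>i\<in>UNIV. (h $ i) *\<^sub>R (D (i # is) x - E (i # is) x))) (at x)" for "is" x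
    using has_derivative_diff[OF D E] by (simp add: scaleR_diff_right sum_subtractf)
  then have "smooth_fun (\<lambda>x. \<phi> x - \<psi> x)"
    unfolding smooth_fun_def using D0 E0 by (intro exI[of _ "\<lambda>is x. D is x - E is x"]) auto
  moreover have sub: "closure {x. \<phi> x - \<psi> x \<noteq> 0} \<subseteq> closure {x. \<phi> x \<noteq> 0} \<union> closure {x. \<psi> x \<noteq> 0}"
    unfolding closure_Un[symmetric] by (intro closure_mono) auto
  moreover have "compact (closure {x. \<phi> x \<noteq> 0} \<union> closure {x. \<psi> x \<noteq> 0})"
    using assms by (auto simp: test_fun_def)
  from compact_Int_closed[OF this closed_closure[of "{x. \<phi> x - \<psi> x \<noteq> 0}"]] sub
  have "compact (closure {x. \<phi> x - \<psi> x \<noteq> 0})" by (simp add: inf.absorb2)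
  ultimately show ?thesis using assms by (auto simp: test_fun_def)
qed

lemma H1_norm_squared:
  "(H1_norm G u)\<^sup>2 = (Lp_norm 2 G u)\<^sup>2 + (\<Sum>i\<in>UNIV. (Lp_norm 2 G (\<lambda>x. wgrad G u x $ i))\<^sup>2)"
  by (simp add: H1_norm_def sum_nonneg)

lemma L2_norm_diff_squared_le:
  assumes "in_Lp 2 G u" "in_Lp 2 G v"
  shows "(Lp_norm 2 G (\<lambda>x. u x - v x))\<^sup>2 \<le> 2 * (Lp_norm 2 G u)\<^sup>2 + 2 * (Lp_norm 2 G v)\<^sup>2"
proof -
  have "(LINT x|lebesgue_on G. (cmod (u x - v x))\<^sup>2)
      \<le> (LINT x|lebesgue_on G. 2 * (cmod (u x))\<^sup>2 + 2 * (cmod (v x))\<^sup>2)"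
    using assms in_L2_diff[OF assms]
    by (intro integral_mono norm_diff_squared_le) (auto simp: in_L2_iff)
  then show ?thesis using assms by (simp add: L2_norm_squared in_L2_iff)
qed

lemma H1_norm_diff_squared_le:
  assumes G: "open G" "bounded G" and "H1 G u" "H1 G v"
  shows "(H1_norm G (\<lambda>x. u x - v x))\<^sup>2 \<le> 2 * (H1_norm G u)\<^sup>2 + 2 * (H1_norm G v)\<^sup>2"
proof -
  have "(Lp_norm 2 G (\<lambda>x. wgrad G (\<lambda>x. u x - v x) x $ i))\<^sup>2
      \<le> 2 * (Lp_norm 2 G (\<lambda>x. wgrad G u x $ i))\<^sup>2 + 2 * (Lp_norm 2 G (\<lambda>x. wgrad G v x $ i))\<^sup>2" for i
  proof -
    have "AE x in lebesgue_on G. wgrad G (\<lambda>x. u x - v x) x $ i = wgrad G u x $ i - wgrad G v x $ i"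
      using wgrad_diff[OF assms] by eventually_elim simp
    then have "Lp_norm 2 G (\<lambda>x. wgrad G (\<lambda>x. u x - v x) x $ i)
        = Lp_norm 2 G (\<lambda>x. wgrad G u x $ i - wgrad G v x $ i)"
      using assms by (intro L2_norm_cong_AE in_L2_measurable wgrad_in_L2 in_L2_diff H1_diff)
    then show ?thesis using L2_norm_diff_squared_le[OF wgrad_in_L2[OF assms(3)] wgrad_in_L2[OF assms(4)]] by simp
  qed
  then have "(\<Sum>i\<in>UNIV. (Lp_norm 2 G (\<lambda>x. wgrad G (\<lambda>x. u x - v x) x $ i))\<^sup>2)
      \<le> (\<Sum>i\<in>UNIV. 2 * (Lp_norm 2 G (\<lambda>x. wgrad G u x $ i))\<^sup>2 + 2 * (Lp_norm 2 G (\<lambda>x. wgrad G v x $ i))\<^sup>2)"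
    by (intro sum_mono)
  with L2_norm_diff_squared_le[OF H1_in_L2[OF assms(3)] H1_in_L2[OF assms(4)]]
  show ?thesis by (simp add: H1_norm_squared sum.distrib sum_distrib_left)
qed

text \<open>
  The factor 2 lost in the squared triangle inequality is harmless: both functions are approximated
  with error \<open>e/2\<close>.
\<close>

lemma H10_diff:
  assumes G: "open G" "bounded G" and u: "H10 G u" and v: "H10 G v"
  shows "H10 G (\<lambda>x. u x - v x)"
  unfolding H10_def
proof (intro conjI allI impI)
  have H1: "H1 G u" "H1 G v" using u v by (auto simp: H10_def)
  then show "H1 G (\<lambda>x. u x - v x)" using G H1_diff by blast
  fix e :: real assume e: "e > 0"
  obtain \<phi> where \<phi>: "test_fun G \<phi>" "H1_norm G (\<lambda>x. u x - \<phi> x) < e / 2"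
    using u e unfolding H10_def by (meson half_gt_zero)
  obtain \<psi> where \<psi>: "test_fun G \<psi>" "H1_norm G (\<lambda>x. v x - \<psi> x) < e / 2"
    using v e unfolding H10_def by (meson half_gt_zero)
  have sq: "(H1_norm G w)\<^sup>2 < (e / 2)\<^sup>2" if "H1_norm G w < e / 2" for w
    using that by (intro power_strict_mono) (auto simp: H1_norm_def sum_nonneg)
  have "(H1_norm G (\<lambda>x. (u x - \<phi> x) - (v x - \<psi> x)))\<^sup>2
      \<le> 2 * (H1_norm G (\<lambda>x. u x - \<phi> x))\<^sup>2 + 2 * (H1_norm G (\<lambda>x. v x - \<psi> x))\<^sup>2"
    using G H1 test_fun_H1[OF G] \<phi> \<psi> by (intro H1_norm_diff_squared_le H1_diff) auto
  also have "\<dots> < e\<^sup>2"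
    using sq[OF \<phi>(2)] sq[OF \<psi>(2)] by (simp add: power_divide)
  finally have "H1_norm G (\<lambda>x. (u x - \<phi> x) - (v x - \<psi> x)) < e"
    using e power_less_imp_less_base less_imp_le by blast
  moreover have "(\<lambda>x. (u x - \<phi> x) - (v x - \<psi> x)) = (\<lambda>x. (u x - v x) - (\<phi> x - \<psi> x))"
    by auto
  ultimately show "\<exists>\<eta>. test_fun G \<eta> \<and> H1_norm G (\<lambda>x. (u x - v x) - \<eta> x) < e"
    using test_fun_diff[OF \<phi>(1) \<psi>(1)] by auto
qed

section \<open>Completeness of the square-integrable functions\<close>

text \<open>
  Inequalities between norms are proved below by dividing by the norms.  Enlarging these by \<open>\<eta>\<close>
  first, and passing to the limit with this lemma, avoids a separate treatment of the value 0.
\<close>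

lemma le_limit_at_right_0:
  fixes f :: "real \<Rightarrow> real"
  assumes "\<And>\<eta>. \<eta> > 0 \<Longrightarrow> I \<le> f \<eta>" "isCont f 0"
  shows "I \<le> f 0"
proof (rule tendsto_lowerbound)
  show "(f \<longlongrightarrow> f 0) (at_right 0)"
    using assms(2) by (simp add: isCont_def filterlim_at_split)
  show "\<forall>\<^sub>F \<eta> in at_right 0. I \<le> f \<eta>"
    using eventually_at_right_less[of 0] by eventually_elim (rule assms(1))
qed simp

text \<open>
  Minkowski's inequality: integrate \<open>(p + q)\<^sup>2 \<le> (1 + b/a) p\<^sup>2 + (1 + a/b) q\<^sup>2\<close> where \<open>a\<close>
  and \<open>b\<close> are the two norms.
\<close>

lemma L2_norm_add_le:
  assumes u: "in_Lp 2 G u" and v: "in_Lp 2 G v"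
  shows "Lp_norm 2 G (\<lambda>x. u x + v x) \<le> Lp_norm 2 G u + Lp_norm 2 G v"
proof -
  define a where "a = Lp_norm 2 G u" 
  define b where "b = Lp_norm 2 G v"
  have ab: "0 \<le> a" "0 \<le> b" by (auto simp: a_def b_def L2_norm_nonneg)
  have "Lp_norm 2 G (\<lambda>x. u x + v x) \<le> (a + \<eta>) + (b + \<eta>)" if \<eta>: "\<eta> > 0" for \<eta>
  proof -
    define a' where "a' = a + \<eta>"
    define b' where "b' = b + \<eta>"
    have pos: "0 < a'" "0 < b'" using ab \<eta> by (auto simp: a'_def b'_def)
    have pt: "(cmod (u x + v x))\<^sup>2 \<le> (1 + b' / a') * (cmod (u x))\<^sup>2 + (1 + a' / b') * (cmod (v x))\<^sup>2" for x
    proof -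
      let ?p = "cmod (u x)" and ?q = "cmod (v x)"
      have "0 \<le> (b' * ?p - a' * ?q)\<^sup>2 / (a' * b')" using pos by simp
      also have "\<dots> = b' / a' * ?p\<^sup>2 + a' / b' * ?q\<^sup>2 - 2 * ?p * ?q"
        using pos by (simp add: field_simps power2_eq_square)
      finally have "(?p + ?q)\<^sup>2 \<le> (1 + b' / a') * ?p\<^sup>2 + (1 + a' / b') * ?q\<^sup>2"
        by (simp add: power2_sum algebra_simps)
      moreover have "(cmod (u x + v x))\<^sup>2 \<le> (?p + ?q)\<^sup>2"
        by (intro power_mono norm_triangle_ineq) simp
      ultimately show ?thesis by linarith
    qed
    have "(Lp_norm 2 G (\<lambda>x. u x + v x))\<^sup>2
        \<le> (LINT x|lebesgue_on G. (1 + b' / a') * (cmod (u x))\<^sup>2 + (1 + a' / b') * (cmod (v x))\<^sup>2)"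
      unfolding L2_norm_squared using u v in_L2_add[OF u v] pt
      by (intro integral_mono) (auto simp: in_L2_iff)
    also have "\<dots> = (1 + b' / a') * a\<^sup>2 + (1 + a' / b') * b\<^sup>2"
      using u v by (simp add: a_def b_def L2_norm_squared in_L2_iff)
    also have "\<dots> \<le> (1 + b' / a') * a'\<^sup>2 + (1 + a' / b') * b'\<^sup>2"
      using ab pos \<eta> by (intro add_mono mult_left_mono power_mono) (auto simp: a'_def b'_def)
    also have "\<dots> = (a' + b')\<^sup>2"
      using pos by (simp add: power2_eq_square field_simps)
    finally show ?thesis
      using pos unfolding a'_def b'_def by - (rule power2_le_imp_le, simp_all)
  qed
  from le_limit_at_right_0[where f="\<lambda>\<eta>. (a + \<eta>) + (b + \<eta>)", OF this]
  show ?thesis by (simp add: a_def b_def)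
qed

lemma L2_norm_diff_le:
  assumes u: "in_Lp 2 G u" and v: "in_Lp 2 G v" and w: "in_Lp 2 G w"
  shows "Lp_norm 2 G (\<lambda>x. u x - w x) \<le> Lp_norm 2 G (\<lambda>x. u x - v x) + Lp_norm 2 G (\<lambda>x. v x - w x)"
  using L2_norm_add_le[OF in_L2_diff[OF u v] in_L2_diff[OF v w]] by simp

lemma L2_norm_diff_commute: "Lp_norm 2 G (\<lambda>x. u x - v x) = Lp_norm 2 G (\<lambda>x. v x - u x)"
  by (simp add: L2_norm_eq_sqrt norm_minus_commute)

text \<open>
  The case of the Riesz-Fischer theorem with geometrically decreasing steps.  Pointwise convergence
  almost everywhere comes from the sum of the squared steps with the weights \<open>1 / q ^ n\<close>, whose
  integral is finite; convergence in norm then follows from Fatou's lemma.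
\<close>

lemma L2_geometric_limit:
  fixes h :: "nat \<Rightarrow> real^'n \<Rightarrow> complex"
  assumes h: "\<And>n. in_Lp 2 G (h n)" and q: "0 < q" "q < 1"
    and step: "\<And>n. Lp_norm 2 G (\<lambda>x. h (Suc n) x - h n x) \<le> K * q ^ n"
  obtains H where "in_Lp 2 G H" "(\<lambda>n. Lp_norm 2 G (\<lambda>x. H x - h n x)) \<longlonglongrightarrow> 0"
proof -
  let ?M = "lebesgue_on G"
  have [measurable]: "h n \<in> borel_measurable ?M" for n using h by (rule in_L2_measurable)
  have K: "0 \<le> K" using order_trans[OF L2_norm_nonneg step[of 0]] by simp
  have tele: "Lp_norm 2 G (\<lambda>x. h (n + j) x - h n x) \<le> K * q ^ n / (1 - q)" for n j
  proof -
    have "Lp_norm 2 G (\<lambda>x. h (n + j) x - h n x) \<le> (\<Sum>i<j. K * q ^ (n + i))"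
    proof (induction j)
      case 0
      then show ?case by (simp add: L2_norm_eq_sqrt)
    next
      case (Suc j)
      have "Lp_norm 2 G (\<lambda>x. h (n + Suc j) x - h n x)
          \<le> Lp_norm 2 G (\<lambda>x. h (n + Suc j) x - h (n + j) x) + Lp_norm 2 G (\<lambda>x. h (n + j) x - h n x)"
        by (intro L2_norm_diff_le h)
      with Suc step[of "n + j"] show ?case by simp
    qed
    also have "\<dots> = K * q ^ n * (\<Sum>i<j. q ^ i)"
      by (simp add: power_add sum_distrib_left mult.assoc)
    also have "\<dots> \<le> K * q ^ n * (1 / (1 - q))"
    proof (rule mult_left_mono)
      have "(\<Sum>i<j. q ^ i) = (1 - q ^ j) / (1 - q)" using q by (simp add: sum_gp_strict)
      then show "(\<Sum>i<j. q ^ i) \<le> 1 / (1 - q)" using q by (simp add: divide_right_mono)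
    qed (use K q in simp)
    finally show ?thesis by simp
  qed
  have nn: "(\<integral>\<^sup>+x. ennreal ((cmod (f x))\<^sup>2) \<partial>?M) = ennreal ((Lp_norm 2 G f)\<^sup>2)" if "in_Lp 2 G f" for f
    using that by (simp add: L2_norm_squared nn_integral_eq_integral in_L2_iff)
  define w where "w n = 1 / q ^ n" for n
  have w: "0 < w n" for n using q by (simp add: w_def)
  define d where "d n x = cmod (h (Suc n) x - h n x)" for n x
  have "AE x in ?M. (\<Sum>n. ennreal (w n * (d n x)\<^sup>2)) \<noteq> \<infinity>"
  proof (rule nn_integral_PInf_AE)
    show "(\<lambda>x. \<Sum>n. ennreal (w n * (d n x)\<^sup>2)) \<in> borel_measurable ?M"
      unfolding d_def by measurable
    have "(\<integral>\<^sup>+x. (\<Sum>n. ennreal (w n * (d n x)\<^sup>2)) \<partial>?M) = (\<Sum>n. \<integral>\<^sup>+x. ennreal (w n * (d n x)\<^sup>2) \<partial>?M)"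
      unfolding d_def by (rule nn_integral_suminf) measurable
    also have "\<dots> \<le> (\<Sum>n. ennreal (K\<^sup>2 * q ^ n))"
    proof (rule suminf_le)
      fix n
      have "(\<integral>\<^sup>+x. ennreal (w n * (d n x)\<^sup>2) \<partial>?M) = (\<integral>\<^sup>+x. ennreal (w n) * ennreal ((d n x)\<^sup>2) \<partial>?M)"
        using w by (simp add: ennreal_mult less_imp_le)
      also have "\<dots> = ennreal (w n) * (\<integral>\<^sup>+x. ennreal ((d n x)\<^sup>2) \<partial>?M)"
        unfolding d_def by (rule nn_integral_cmult) measurable
      also have "\<dots> = ennreal (w n * (Lp_norm 2 G (\<lambda>x. h (Suc n) x - h n x))\<^sup>2)"
        unfolding d_def nn[OF in_L2_diff[OF h[of "Suc n"] h[of n]]] 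
        using w by (simp add: ennreal_mult less_imp_le)
      also have "\<dots> \<le> ennreal (w n * (K * q ^ n)\<^sup>2)"
        by (intro ennreal_leI mult_left_mono power_mono step L2_norm_nonneg less_imp_le[OF w])
      also have "w n * (K * q ^ n)\<^sup>2 = K\<^sup>2 * q ^ n"
        using q by (simp add: w_def power_mult_distrib power2_eq_square)
      finally show "(\<integral>\<^sup>+x. ennreal (w n * (d n x)\<^sup>2) \<partial>?M) \<le> ennreal (K\<^sup>2 * q ^ n)" .
    qed auto
    also have "\<dots> < \<infinity>"
      using q by (subst suminf_ennreal2) (auto intro!: summable_mult summable_geometric)
    finally show "(\<integral>\<^sup>+x. (\<Sum>n. ennreal (w n * (d n x)\<^sup>2)) \<partial>?M) \<noteq> \<infinity>" by simp
  qed
  then have conv: "AE x in ?M. convergent (\<lambda>n. h n x)"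
  proof eventually_elim
    fix x assume "(\<Sum>n. ennreal (w n * (d n x)\<^sup>2)) \<noteq> \<infinity>"
    then have "summable (\<lambda>n. w n * (d n x)\<^sup>2)"
      using w by (intro summable_suminf_not_top) (auto simp: less_imp_le)
    then have "summable (\<lambda>n. (w n * (d n x)\<^sup>2 + q ^ n) / 2)"
      using q by (intro summable_divide summable_add summable_geometric) auto
    then have "summable (\<lambda>n. h (Suc n) x - h n x)"
    proof (rule summable_comparison_test'[where N=0])
      fix n
      \<comment> \<open>The inequality of the means for \<open>d n x\<close>, split with the same weight that makes the squares summable.\<close>
      have "0 \<le> w n * (d n x - q ^ n)\<^sup>2" using w[of n] by simp
      also have "\<dots> = w n * (d n x)\<^sup>2 + q ^ n - 2 * d n x"
      proof -
        have "1 / c * (b - c)\<^sup>2 = 1 / c * b\<^sup>2 + c - 2 * b" if "c > 0" for b c :: real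
          using that by (simp add: field_simps power2_eq_square)
        from this[of "q ^ n"] q show ?thesis by (simp add: w_def)
      qed
      finally show "norm (h (Suc n) x - h n x) \<le> (w n * (d n x)\<^sup>2 + q ^ n) / 2"
        by (simp add: d_def)
    qed
    then show "convergent (\<lambda>n. h n x)"
      using convergent_add[OF convergent_const[of "h 0 x"], of "\<lambda>n. \<Sum>i<n. h (Suc i) x - h i x"]
      by (simp add: summable_iff_convergent sum_lessThan_telescope[of "\<lambda>n. h n x"] del: sum_subtractf)
  qed
  define H where "H x = lim (\<lambda>n. h n x)" for x
  have Hm[measurable]: "H \<in> borel_measurable ?M" unfolding H_def by measurable
  have lim: "AE x in ?M. (\<lambda>n. h n x) \<longlonglongrightarrow> H x"
    using conv by eventually_elim (simp add: H_def convergent_LIMSEQ_iff)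
  have dist: "(\<integral>\<^sup>+x. ennreal ((cmod (H x - h n x))\<^sup>2) \<partial>?M) \<le> ennreal ((K * q ^ n / (1 - q))\<^sup>2)" for n
  proof -
    have "(\<integral>\<^sup>+x. ennreal ((cmod (H x - h n x))\<^sup>2) \<partial>?M)
        = (\<integral>\<^sup>+x. liminf (\<lambda>j. ennreal ((cmod (h (n + j) x - h n x))\<^sup>2)) \<partial>?M)"
    proof (rule nn_integral_cong_AE, use lim in eventually_elim)
      fix x assume "(\<lambda>n. h n x) \<longlonglongrightarrow> H x"
      then have "(\<lambda>j. h (n + j) x) \<longlonglongrightarrow> H x" using LIMSEQ_ignore_initial_segment[of _ _ n] by (simp add: add.commute)
      then have "(\<lambda>j. ennreal ((cmod (h (n + j) x - h n x))\<^sup>2)) \<longlonglongrightarrow> ennreal ((cmod (H x - h n x))\<^sup>2)"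
        by (intro tendsto_intros)
      then show "ennreal ((cmod (H x - h n x))\<^sup>2) = liminf (\<lambda>j. ennreal ((cmod (h (n + j) x - h n x))\<^sup>2))"
        by (rule lim_imp_Liminf[OF sequentially_bot, symmetric])
    qed
    also have "\<dots> \<le> liminf (\<lambda>j. \<integral>\<^sup>+x. ennreal ((cmod (h (n + j) x - h n x))\<^sup>2) \<partial>?M)"
      by (rule nn_integral_liminf) measurable
    also have "\<dots> \<le> liminf (\<lambda>j. ennreal ((K * q ^ n / (1 - q))\<^sup>2))"
      using tele h L2_norm_nonneg
      by (intro Liminf_mono always_eventually allI) (auto simp: nn in_L2_diff intro!: ennreal_leI power_mono)
    also have "\<dots> = ennreal ((K * q ^ n / (1 - q))\<^sup>2)" by (simp add: Liminf_const)
    finally show ?thesis .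
  qed
  have diffL2: "in_Lp 2 G (\<lambda>x. H x - h n x)" for n
    unfolding in_L2_iff using dist[of n]
    by (auto intro!: integrableI_bounded intro: le_less_trans)
  show thesis
  proof
    show "in_Lp 2 G H" using in_L2_add[OF diffL2[of 0] h[of 0]] by simp
    have bound: "Lp_norm 2 G (\<lambda>x. H x - h n x) \<le> K * q ^ n / (1 - q)" for n
      using dist[of n] K q unfolding nn[OF diffL2] by (auto intro!: power2_le_imp_le[of "Lp_norm 2 G (\<lambda>x. H x - h n x)"])
    have "(\<lambda>n. K * q ^ n / (1 - q)) \<longlonglongrightarrow> K * 0 / (1 - q)"
      using q by (intro tendsto_intros LIMSEQ_realpow_zero) auto
    then show "(\<lambda>n. Lp_norm 2 G (\<lambda>x. H x - h n x)) \<longlonglongrightarrow> 0"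
      using bound
      by - (rule tendsto_sandwich[of "\<lambda>n. 0" _ _ "\<lambda>n. K * q ^ n / (1 - q)"], auto simp: L2_norm_nonneg)
  qed
qed

lemma L2_contraction_fixed_point:
  fixes T :: "(real^'n \<Rightarrow> complex) \<Rightarrow> real^'n \<Rightarrow> complex"
  assumes T: "\<And>h. in_Lp 2 G h \<Longrightarrow> in_Lp 2 G (T h)" and q: "0 < q" "q < 1"
    and contr: "\<And>h h'. in_Lp 2 G h \<Longrightarrow> in_Lp 2 G h' \<Longrightarrow>
      Lp_norm 2 G (\<lambda>x. T h x - T h' x) \<le> q * Lp_norm 2 G (\<lambda>x. h x - h' x)"
  obtains h where "in_Lp 2 G h" "AE x in lebesgue_on G. T h x = h x"
proof -
  define h where "h n = (T ^^ n) (\<lambda>x. 0)" for n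
  have h_Suc: "h (Suc n) = T (h n)" for n by (simp add: h_def)
  have h: "in_Lp 2 G (h n)" for n
    by (induction n) (simp_all add: h_def in_L2_zero T)
  have "Lp_norm 2 G (\<lambda>x. h (Suc n) x - h n x) \<le> Lp_norm 2 G (\<lambda>x. h 1 x - h 0 x) * q ^ n" for n
  proof (induction n)
    case (Suc n)
    have "Lp_norm 2 G (\<lambda>x. h (Suc (Suc n)) x - h (Suc n) x) \<le> q * Lp_norm 2 G (\<lambda>x. h (Suc n) x - h n x)"
      using contr[OF h[of "Suc n"] h[of n]] by (simp add: h_Suc)
    also have "\<dots> \<le> q * (Lp_norm 2 G (\<lambda>x. h 1 x - h 0 x) * q ^ n)"
      using q Suc by (intro mult_left_mono) auto
    finally show ?case by (simp add: mult_ac)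
  qed simp
  from L2_geometric_limit[OF h q this] obtain H where H: "in_Lp 2 G H"
    and lim: "(\<lambda>n. Lp_norm 2 G (\<lambda>x. H x - h n x)) \<longlonglongrightarrow> 0" by metis
  have "Lp_norm 2 G (\<lambda>x. T H x - H x)
      \<le> q * Lp_norm 2 G (\<lambda>x. H x - h n x) + Lp_norm 2 G (\<lambda>x. H x - h (Suc n) x)" for n
    using L2_norm_diff_le[OF T[OF H] h[of "Suc n"] H] contr[OF H h, of n]
      L2_norm_diff_commute[of G H "h (Suc n)"] by (simp add: h_Suc)
  moreover have "(\<lambda>n. q * Lp_norm 2 G (\<lambda>x. H x - h n x) + Lp_norm 2 G (\<lambda>x. H x - h (Suc n) x)) \<longlonglongrightarrow> q * 0 + 0"
    by (intro tendsto_intros lim LIMSEQ_Suc[OF lim])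
  ultimately have "Lp_norm 2 G (\<lambda>x. T H x - H x) \<le> q * 0 + 0"
    by (intro LIMSEQ_le_const[where X="\<lambda>n. q * Lp_norm 2 G (\<lambda>x. H x - h n x) + Lp_norm 2 G (\<lambda>x. H x - h (Suc n) x)"]) auto
  then have "Lp_norm 2 G (\<lambda>x. T H x - H x) = 0"
    using L2_norm_nonneg[of G "\<lambda>x. T H x - H x"] by simp
  from L2_norm_zero_AE[OF in_L2_diff[OF T[OF H] H] this] that[OF H] show thesis by simp
qed

section \<open>Products of functions in the spaces with exponents four and six\<close>

lemma Lp_norm_le_imp_integral_le:
  assumes "in_Lp (numeral n) G v" "Lp_norm (numeral n) G v \<le> X"
  shows "integrable (lebesgue_on G) (\<lambda>x. cmod (v x) ^ numeral n)"
    "(LINT x|lebesgue_on G. cmod (v x) ^ numeral n) \<le> X ^ numeral n"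
proof -
  show "integrable (lebesgue_on G) (\<lambda>x. cmod (v x) ^ numeral n)" using assms(1) by (simp add: in_Lp_def)
  define I where "I = (LINT x|lebesgue_on G. cmod (v x) ^ numeral n)"
  have "I = (I powr (1 / numeral n)) ^ numeral n"
    unfolding powr_numeral[OF powr_ge_zero, symmetric] powr_powr by (simp add: I_def)
  also have "I powr (1 / numeral n) = Lp_norm (numeral n) G v" by (simp add: Lp_norm_def I_def)
  also have "\<dots> ^ numeral n \<le> X ^ numeral n"
    using assms(2) by (rule power_mono) (simp add: Lp_norm_def)
  finally show "(LINT x|lebesgue_on G. cmod (v x) ^ numeral n) \<le> X ^ numeral n" by (simp add: I_def)
qed

text \<open>
  The Cauchy-Schwarz inequality for squares, by the inequality of the means after scaling.
\<close>

lemma integral_product_exponent_4: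
  fixes f g :: "'a \<Rightarrow> real"
  assumes f: "f \<in> borel_measurable M" "\<And>x. 0 \<le> f x" "integrable M (\<lambda>x. f x ^ 4)" "(LINT x|M. f x ^ 4) \<le> A ^ 4" "0 \<le> A"
    and g: "g \<in> borel_measurable M" "\<And>x. 0 \<le> g x" "integrable M (\<lambda>x. g x ^ 4)" "(LINT x|M. g x ^ 4) \<le> B ^ 4" "0 \<le> B"
  shows "integrable M (\<lambda>x. (f x * g x)\<^sup>2)" "(LINT x|M. (f x * g x)\<^sup>2) \<le> (A * B)\<^sup>2"
proof -
  have pt: "(s * t)\<^sup>2 \<le> (a * b)\<^sup>2 / 2 * (s ^ 4 / a ^ 4 + t ^ 4 / b ^ 4)" if "0 < a" "0 < b" for a b s t :: real
  proof -
    have "0 \<le> ((s / a)\<^sup>2 - (t / b)\<^sup>2)\<^sup>2 * (a * b)\<^sup>2 / 2" by simp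
    also have "\<dots> = (a * b)\<^sup>2 / 2 * (s ^ 4 / a ^ 4 + t ^ 4 / b ^ 4) - (s * t)\<^sup>2"
      using that by (simp add: power2_eq_square power4_eq_xxxx field_simps)
    finally show ?thesis by simp
  qed
  show int: "integrable M (\<lambda>x. (f x * g x)\<^sup>2)"
  proof (rule Bochner_Integration.integrable_bound[where f="\<lambda>x. f x ^ 4 + g x ^ 4"])
    show "AE x in M. norm ((f x * g x)\<^sup>2) \<le> norm (f x ^ 4 + g x ^ 4)"
    proof (intro AE_I2)
      fix x
      have "0 \<le> (f x * g x)\<^sup>2" by simp
      moreover have "2 * (f x * g x)\<^sup>2 \<le> f x ^ 4 + g x ^ 4" using pt[of 1 1 "f x" "g x"] by simp
      ultimately have "(f x * g x)\<^sup>2 \<le> f x ^ 4 + g x ^ 4" by linarith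
      then show "norm ((f x * g x)\<^sup>2) \<le> norm (f x ^ 4 + g x ^ 4)" by simp
    qed
  qed (use f g in auto)
  have "(LINT x|M. (f x * g x)\<^sup>2) \<le> ((A + \<eta>) * (B + \<eta>))\<^sup>2" if "\<eta> > 0" for \<eta>
  proof -
    let ?a = "A + \<eta>" and ?b = "B + \<eta>"
    have pos: "0 < ?a" "0 < ?b" using f(5) g(5) that by auto
    have le: "(LINT x|M. f x ^ 4) \<le> ?a ^ 4" "(LINT x|M. g x ^ 4) \<le> ?b ^ 4"
      using f(4,5) g(4,5) that power_mono[of A ?a 4] power_mono[of B ?b 4] by linarith+
    have "(LINT x|M. (f x * g x)\<^sup>2) \<le> (LINT x|M. (?a * ?b)\<^sup>2 / 2 * (f x ^ 4 / ?a ^ 4 + g x ^ 4 / ?b ^ 4))"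
      using int f(3) g(3) pt[OF pos] by (intro integral_mono) auto
    also have "\<dots> = (?a * ?b)\<^sup>2 / 2 * ((LINT x|M. f x ^ 4) / ?a ^ 4 + (LINT x|M. g x ^ 4) / ?b ^ 4)"
      using f(3) g(3) by simp
    also have "\<dots> \<le> (?a * ?b)\<^sup>2 / 2 * (1 + 1)"
      using le pos by (intro mult_left_mono add_mono) (auto simp: divide_le_eq_1)
    finally show ?thesis by simp
  qed
  from le_limit_at_right_0[where f="\<lambda>\<eta>. ((A + \<eta>) * (B + \<eta>))\<^sup>2", OF this]
  show "(LINT x|M. (f x * g x)\<^sup>2) \<le> (A * B)\<^sup>2" by simp
qed

text \<open>
  Hoelder's inequality with exponents \<open>3/2\<close> and \<open>3\<close>, from
  \<open>s\<^sup>2 t \<le> (2 s\<^sup>3 + t\<^sup>3) / 3\<close> after scaling.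
\<close>

lemma integral_product_exponent_6:
  fixes f g :: "'a \<Rightarrow> real"
  assumes f: "f \<in> borel_measurable M" "\<And>x. 0 \<le> f x" "integrable M (\<lambda>x. f x ^ 6)" "(LINT x|M. f x ^ 6) \<le> A ^ 6" "0 \<le> A"
    and g: "g \<in> borel_measurable M" "\<And>x. 0 \<le> g x" "integrable M (\<lambda>x. g x ^ 6)" "(LINT x|M. g x ^ 6) \<le> B ^ 6" "0 \<le> B"
  shows "integrable M (\<lambda>x. ((f x)\<^sup>2 * g x)\<^sup>2)" "(LINT x|M. ((f x)\<^sup>2 * g x)\<^sup>2) \<le> (A\<^sup>2 * B)\<^sup>2"
proof -
  have amgm: "s\<^sup>2 * t \<le> (2 * s ^ 3 + t ^ 3) / 3" if "0 \<le> s" "0 \<le> t" for s t :: real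
  proof -
    have "0 \<le> (s - t)\<^sup>2 * (2 * s + t)" using that by simp
    also have "\<dots> = 2 * s ^ 3 + t ^ 3 - 3 * (s\<^sup>2 * t)"
      by (simp add: power2_eq_square power3_eq_cube algebra_simps)
    finally show ?thesis by simp
  qed
  have pt: "(s\<^sup>2 * t)\<^sup>2 \<le> (a\<^sup>2 * b)\<^sup>2 / 3 * (2 * s ^ 6 / a ^ 6 + t ^ 6 / b ^ 6)" if "0 < a" "0 < b" for a b s t :: real
  proof -
    have "((s / a)\<^sup>2)\<^sup>2 * (t / b)\<^sup>2 \<le> (2 * ((s / a)\<^sup>2) ^ 3 + ((t / b)\<^sup>2) ^ 3) / 3"
      by (rule amgm) auto
    then have "(a\<^sup>2 * b)\<^sup>2 * (((s / a)\<^sup>2)\<^sup>2 * (t / b)\<^sup>2)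
        \<le> (a\<^sup>2 * b)\<^sup>2 * ((2 * ((s / a)\<^sup>2) ^ 3 + ((t / b)\<^sup>2) ^ 3) / 3)"
      by (rule mult_left_mono) simp
    moreover have "(a\<^sup>2 * b)\<^sup>2 * (((s / a)\<^sup>2)\<^sup>2 * (t / b)\<^sup>2) = (s\<^sup>2 * t)\<^sup>2"
      using that by (simp add: power_divide power_mult_distrib)
    moreover have "(a\<^sup>2 * b)\<^sup>2 * ((2 * ((s / a)\<^sup>2) ^ 3 + ((t / b)\<^sup>2) ^ 3) / 3)
        = (a\<^sup>2 * b)\<^sup>2 / 3 * (2 * s ^ 6 / a ^ 6 + t ^ 6 / b ^ 6)"
      by (simp add: power_divide flip: power_mult)
    ultimately show ?thesis by linarith
  qed
  show int: "integrable M (\<lambda>x. ((f x)\<^sup>2 * g x)\<^sup>2)"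
  proof (rule Bochner_Integration.integrable_bound[where f="\<lambda>x. 1 / 3 * (2 * f x ^ 6 + g x ^ 6)"])
    show "AE x in M. norm (((f x)\<^sup>2 * g x)\<^sup>2) \<le> norm (1 / 3 * (2 * f x ^ 6 + g x ^ 6))"
    proof (intro AE_I2)
      fix x show "norm (((f x)\<^sup>2 * g x)\<^sup>2) \<le> norm (1 / 3 * (2 * f x ^ 6 + g x ^ 6))"
        using pt[of 1 1 "f x" "g x"] f(2)[of x] g(2)[of x] by simp
    qed
  qed (use f g in auto)
  have "(LINT x|M. ((f x)\<^sup>2 * g x)\<^sup>2) \<le> ((A + \<eta>)\<^sup>2 * (B + \<eta>))\<^sup>2" if "\<eta> > 0" for \<eta>
  proof -
    let ?a = "A + \<eta>" and ?b = "B + \<eta>"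
    have pos: "0 < ?a" "0 < ?b" using f(5) g(5) that by auto
    have le: "(LINT x|M. f x ^ 6) \<le> ?a ^ 6" "(LINT x|M. g x ^ 6) \<le> ?b ^ 6"
      using f(4,5) g(4,5) that power_mono[of A ?a 6] power_mono[of B ?b 6] by linarith+
    have "(LINT x|M. ((f x)\<^sup>2 * g x)\<^sup>2)
        \<le> (LINT x|M. (?a\<^sup>2 * ?b)\<^sup>2 / 3 * (2 * f x ^ 6 / ?a ^ 6 + g x ^ 6 / ?b ^ 6))"
      using int f(3) g(3) pt[OF pos] by (intro integral_mono) auto
    also have "\<dots> = (?a\<^sup>2 * ?b)\<^sup>2 / 3 * (2 * (LINT x|M. f x ^ 6) / ?a ^ 6 + (LINT x|M. g x ^ 6) / ?b ^ 6)"
      using f(3) g(3) by simp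
    also have "\<dots> \<le> (?a\<^sup>2 * ?b)\<^sup>2 / 3 * (2 + 1)"
      using le pos by (intro mult_left_mono add_mono) (auto simp: divide_le_eq)
    finally show ?thesis by simp
  qed
  from le_limit_at_right_0[where f="\<lambda>\<eta>. ((A + \<eta>)\<^sup>2 * (B + \<eta>))\<^sup>2", OF this]
  show "(LINT x|M. ((f x)\<^sup>2 * g x)\<^sup>2) \<le> (A\<^sup>2 * B)\<^sup>2" by simp
qed

section \<open>The coefficients of the PML operator\<close>

lemma coordinates_dim2:
  assumes "CARD('n::{finite,comm_ring_1}) = 2"
  shows "(2::'n) \<noteq> 1" "(UNIV::'n set) = {1, 2}"
proof -
  show ne: "(2::'n) \<noteq> 1"
    using one_neq_zero[where 'a='n] by (metis add_cancel_right_right one_add_one)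
  have "card {1, 2::'n} = CARD('n)" using assms ne by simp
  from card_subset_eq[OF finite subset_UNIV this] show "(UNIV::'n set) = {1, 2}" by simp
qed

text \<open>
  In a ring with three elements \<open>1 + 1\<close> cannot be 0, since \<open>x\<close> and \<open>x + 1\<close> would then be two further
  elements besides 0 and 1.
\<close>

lemma coordinates_dim3:
  assumes "CARD('n::{finite,comm_ring_1}) = 3"
  shows "(2::'n) \<noteq> 1" "(3::'n) \<noteq> 1" "(3::'n) \<noteq> 2" "(UNIV::'n set) = {1, 2, 3}"
proof -
  have three: "(3::'n) = 2 + 1" and two: "(2::'n) = 1 + 1" by simp_all
  show n21: "(2::'n) \<noteq> 1"
    using one_neq_zero[where 'a='n] two by (metis add_cancel_right_right)
  show n32: "(3::'n) \<noteq> 2"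
    using one_neq_zero[where 'a='n] three by (metis add_cancel_right_right)
  have "(2::'n) \<noteq> 0"
  proof
    assume z: "(2::'n) = 0"
    have "card {0, 1::'n} < CARD('n)" using assms by simp
    then obtain x :: 'n where x: "x \<notin> {0, 1}" by (metis UNIV_eq_I less_irrefl)
    have m1: "(1::'n) + 1 = 0" unfolding two[symmetric] by (rule z)
    have "x + 1 \<noteq> x" by simp
    moreover have "x + 1 \<noteq> 1" using x by simp
    moreover have "x + 1 \<noteq> 0"
    proof
      assume "x + 1 = 0"
      then have "x + (1 + 1) = 1" by (metis add.assoc add_0)
      with m1 x show False by simp
    qed
    ultimately obtain y where "y \<noteq> x" "y \<noteq> 1" "y \<noteq> 0" by blast
    then have "card {0, 1, x, y} = 4" using x by simp
    moreover have "card {0, 1, x, y} \<le> CARD('n)" by (intro card_mono) auto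
    ultimately show False using assms by simp
  qed
  then show n31: "(3::'n) \<noteq> 1"
    using three by (metis add_cancel_right_left)
  have "card {1, 2, 3::'n} = CARD('n)" using assms n21 n32 n31 by simp
  from card_subset_eq[OF finite subset_UNIV this] show "(UNIV::'n set) = {1, 2, 3}" by simp
qed

lemma vector_nth_dim2:
  assumes "CARD('n::{finite,comm_ring_1}) = 2"
  shows "(vector [a, b] :: 'a::zero^'n::{finite,comm_ring_1}) $ 1 = a" "(vector [a, b] :: 'a::zero^'n::{finite,comm_ring_1}) $ 2 = b"
  using coordinates_dim2[OF assms] by (simp_all add: vector_def)

lemma vector_nth_dim3:
  assumes "CARD('n::{finite,comm_ring_1}) = 3"
  shows "(vector [a, b, c] :: 'a::zero^'n::{finite,comm_ring_1}) $ 1 = a" "(vector [a, b, c] :: 'a::zero^'n::{finite,comm_ring_1}) $ 2 = b"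
    "(vector [a, b, c] :: 'a::zero^'n::{finite,comm_ring_1}) $ 3 = c"
  using coordinates_dim3[OF assms] by (simp_all add: vector_def)

lemma pml_H_entries:
  assumes "CARD('n::{finite,comm_ring_1}) = 2 \<or> CARD('n) = 3"
  shows "cnj (pml_H (x::real^'n::{finite,comm_ring_1}) $ i $ j) = pml_H x $ i $ j \<and> cmod (pml_H x $ i $ j) \<le> 1"
  using assms
proof
  assume d: "CARD('n) = 2"
  have "i \<in> {1, 2}" "j \<in> {1, 2}" using coordinates_dim2(2)[OF d] UNIV_I by blast+
  then show ?thesis using d
    by (auto simp: pml_H_def Let_def vector_nth_dim2 cos_of_real sin_of_real simp flip: of_real_minus)
next
  assume d: "CARD('n) = 3"
  have "i \<in> {1, 2, 3}" "j \<in> {1, 2, 3}" using coordinates_dim3(4)[OF d] UNIV_I by blast+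
  then show ?thesis using d
    by (auto simp: pml_H_def Let_def vector_nth_dim3 cos_of_real sin_of_real norm_mult abs_mult mult_le_one
        simp flip: of_real_minus)
qed

lemmas pml_H_real = pml_H_entries[THEN conjunct1]
  and pml_H_norm_le = pml_H_entries[THEN conjunct2]

lemma pml_H_orthogonal: 
  assumes "CARD('n::{finite,comm_ring_1}) = 2 \<or> CARD('n) = 3"
  shows "pml_H (x::real^'n::{finite,comm_ring_1}) ** transpose (pml_H x) = mat 1"
  using assms
proof
  assume d: "CARD('n) = 2"
  note U = coordinates_dim2[OF d]
  define c s where "c = cos (complex_of_real (Arg (Complex (x $ 1) (x $ 2))))"
    and "s = sin (complex_of_real (Arg (Complex (x $ 1) (x $ 2))))"
  have cs: "c * c + s * s = 1" unfolding c_def s_def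
    using sin_cos_squared_add3 by metis
  have H: "pml_H x = vector [vector [c, - s], vector [s, c]]"
    using d by (simp add: pml_H_def Let_def c_def s_def)
  have "(pml_H x ** transpose (pml_H x)) $ i $ j = mat 1 $ i $ j" for i j
  proof -
    have "i \<in> {1, 2}" "j \<in> {1, 2}" using U(2) UNIV_I by blast+
    then show ?thesis using U(1) cs
      by (auto simp: H matrix_matrix_mult_def transpose_def mat_def U(2) vector_nth_dim2[OF d] algebra_simps)
  qed
  then show ?thesis by (simp add: vec_eq_iff)
next
  assume d: "CARD('n) = 3"
  note U = coordinates_dim3[OF d]
  define c s where "c = cos (complex_of_real (arccos (x $ 3 / norm x)))"
    and "s = sin (complex_of_real (arccos (x $ 3 / norm x)))"
  define c' s' where "c' = cos (complex_of_real (Arg (Complex (x $ 1) (x $ 2))))"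
    and "s' = sin (complex_of_real (Arg (Complex (x $ 1) (x $ 2))))"
  have cs: "c * c = 1 - s * s" "c' * c' = 1 - s' * s'" unfolding c_def s_def c'_def s'_def
    using sin_cos_squared_add3 by (metis add_diff_cancel_right')+
  have H: "pml_H x = vector [vector [s * c', c * c', - s'], vector [s * s', c * s', c'], vector [c, - s, 0]]"
    using d by (simp add: pml_H_def Let_def c_def s_def c'_def s'_def)
  have E: "s * c' * (s * c') + c * c' * (c * c') + s' * s' = 1"
    "s * s' * (s * s') + c * s' * (c * s') + c' * c' = 1"
    "s * c' * (s * s') + c * c' * (c * s') - s' * c' = 0"
    using cs by algebra+
  have "(pml_H x ** transpose (pml_H x)) $ i $ j = mat 1 $ i $ j" for i j
  proof -
    have "i \<in> {1, 2, 3}" "j \<in> {1, 2, 3}" using U(4) UNIV_I by blast+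
    then show ?thesis using U(1-3) U(1-3)[symmetric] cs E
      by (auto simp: H matrix_matrix_mult_def transpose_def mat_def U(4) vector_nth_dim3[OF d] algebra_simps)
  qed
  then show ?thesis by (simp add: vec_eq_iff)
qed

lemma pml_sigma_delta:
  assumes "0 < \<sigma>\<^sub>0" "0 < R" "0 \<le> r"
  shows "0 \<le> pml_delta R \<sigma>\<^sub>0 r" "pml_delta R \<sigma>\<^sub>0 r \<le> pml_sigma R \<sigma>\<^sub>0 r" "pml_sigma R \<sigma>\<^sub>0 r \<le> \<sigma>\<^sub>0"
  using assms by (auto simp: pml_sigma_def pml_delta_def divide_simps)

lemma pml_alpha_norm:
  assumes "0 < \<sigma>\<^sub>0" "0 < R" "0 \<le> r"
  shows "1 \<le> cmod (pml_alpha R \<sigma>\<^sub>0 r)" "cmod (pml_alpha R \<sigma>\<^sub>0 r) \<le> 1 + \<sigma>\<^sub>0"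
proof -
  show "1 \<le> cmod (pml_alpha R \<sigma>\<^sub>0 r)"
    using complex_Re_le_cmod[of "pml_alpha R \<sigma>\<^sub>0 r"] by (simp add: pml_alpha_def)
  have "cmod (pml_alpha R \<sigma>\<^sub>0 r) \<le> cmod 1 + cmod (\<i> * of_real (pml_sigma R \<sigma>\<^sub>0 r))"
    unfolding pml_alpha_def by (rule norm_triangle_ineq)
  also have "\<dots> \<le> 1 + \<sigma>\<^sub>0"
    using pml_sigma_delta[OF assms] by (simp add: norm_mult)
  finally show "cmod (pml_alpha R \<sigma>\<^sub>0 r) \<le> 1 + \<sigma>\<^sub>0" .
qed

lemma pml_beta_norm:
  assumes "0 < \<sigma>\<^sub>0" "0 < R" "0 \<le> r"
  shows "1 \<le> cmod (pml_beta R \<sigma>\<^sub>0 r)" "cmod (pml_beta R \<sigma>\<^sub>0 r) \<le> 1 + \<sigma>\<^sub>0"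
proof -
  show "1 \<le> cmod (pml_beta R \<sigma>\<^sub>0 r)"
    using complex_Re_le_cmod[of "pml_beta R \<sigma>\<^sub>0 r"] by (simp add: pml_beta_def)
  have "cmod (pml_beta R \<sigma>\<^sub>0 r) \<le> cmod 1 + cmod (\<i> * of_real (pml_delta R \<sigma>\<^sub>0 r))"
    unfolding pml_beta_def by (rule norm_triangle_ineq)
  also have "\<dots> \<le> 1 + \<sigma>\<^sub>0"
    using pml_sigma_delta[OF assms] by (simp add: norm_mult)
  finally show "cmod (pml_beta R \<sigma>\<^sub>0 r) \<le> 1 + \<sigma>\<^sub>0" .
qed

lemma pml_Lambda_offdiag:
  assumes "CARD('n::{finite,comm_ring_1}) = 2 \<or> CARD('n) = 3" "i \<noteq> j"
  shows "pml_Lambda R \<sigma>\<^sub>0 (x::real^'n::{finite,comm_ring_1}) $ i $ j = 0"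
  using assms(1)
proof
  assume d: "CARD('n) = 2"
  have "i \<in> {1, 2}" "j \<in> {1, 2}" using coordinates_dim2(2)[OF d] UNIV_I by blast+
  then show ?thesis using d assms(2)
    by (auto simp: pml_Lambda_def Let_def vector_nth_dim2)
next
  assume d: "CARD('n) = 3"
  have "i \<in> {1, 2, 3}" "j \<in> {1, 2, 3}" using coordinates_dim3(4)[OF d] UNIV_I by blast+
  then show ?thesis using d assms(2)
    by (auto simp: pml_Lambda_def Let_def vector_nth_dim3)
qed

text \<open>
  Nonnegativity rests on \<open>0 \<le> \<delta> \<le> \<sigma>\<close>: up to the positive factor \<open>1 + \<sigma>\<^sup>2\<close>, the real part of
  \<open>\<beta>\<^sup>2 / \<alpha>\<close> is \<open>1 - \<delta>\<^sup>2 + 2 \<sigma> \<delta>\<close>.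
\<close>

lemma pml_Lambda_diag:
  assumes "CARD('n::{finite,comm_ring_1}) = 2 \<or> CARD('n) = 3" "0 < \<sigma>\<^sub>0" "0 < R"
  shows "0 \<le> Re (pml_Lambda R \<sigma>\<^sub>0 (x::real^'n::{finite,comm_ring_1}) $ i $ i)"
    "norm x \<le> R \<Longrightarrow> pml_Lambda R \<sigma>\<^sub>0 x $ i $ i = 1"
    "cmod (pml_Lambda R \<sigma>\<^sub>0 x $ i $ i) \<le> (1 + \<sigma>\<^sub>0)\<^sup>2"
proof -
  define a b where "a = pml_alpha R \<sigma>\<^sub>0 (norm x)" and "b = pml_beta R \<sigma>\<^sub>0 (norm x)"
  define s d where "s = pml_sigma R \<sigma>\<^sub>0 (norm x)" and "d = pml_delta R \<sigma>\<^sub>0 (norm x)"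
  have sd: "0 \<le> d" "d \<le> s" using pml_sigma_delta[of \<sigma>\<^sub>0 R "norm x"] assms by (auto simp: s_def d_def)
  have ab: "a = Complex 1 s" "b = Complex 1 d"
    by (auto simp: a_def b_def pml_alpha_def pml_beta_def s_def d_def complex_eq_iff)
  have n: "1 \<le> cmod a" "cmod a \<le> 1 + \<sigma>\<^sub>0" "1 \<le> cmod b" "cmod b \<le> 1 + \<sigma>\<^sub>0"
    using pml_alpha_norm[of \<sigma>\<^sub>0 R "norm x"] pml_beta_norm[of \<sigma>\<^sub>0 R "norm x"] assms by (auto simp: a_def b_def)
  have sq: "1 + \<sigma>\<^sub>0 \<le> (1 + \<sigma>\<^sub>0)\<^sup>2" using assms(2) by (simp add: power2_eq_square)
  have div: "cmod (p / q) \<le> B" if "1 \<le> cmod q" "cmod p \<le> B" for p q B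
  proof -
    have "cmod p \<le> cmod p * cmod q" using that(1) by (simp add: mult_le_cancel_left1)
    then have "cmod p / cmod q \<le> cmod p" using that(1) by (subst divide_le_eq) auto
    then show ?thesis using that by (simp add: norm_divide)
  qed
  have bb: "cmod (b\<^sup>2) \<le> (1 + \<sigma>\<^sub>0)\<^sup>2" using n by (auto simp: norm_power intro: power_mono)
  have inside: "a = 1 \<and> b = 1" if "norm x \<le> R"
    using that by (simp add: a_def b_def pml_alpha_def pml_beta_def pml_sigma_def pml_delta_def)
  have re: "0 \<le> Re (b / a)" "0 \<le> Re (a / b)" "0 \<le> Re (b\<^sup>2 / a)" "0 \<le> Re a"
  proof -
    show "0 \<le> Re (b / a)" "0 \<le> Re (a / b)" "0 \<le> Re a" using sd by (simp_all add: ab Re_divide)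
    have "d * d \<le> s * d" using sd by (intro mult_right_mono) auto
    moreover have "0 \<le> d * d" by simp
    ultimately have "0 \<le> 1 - d * d + 2 * (s * d)" by linarith
    then show "0 \<le> Re (b\<^sup>2 / a)" by (simp add: ab Re_divide power2_eq_square algebra_simps)
  qed
  consider "CARD('n) = 2" | "CARD('n) = 3" using assms(1) by blast
  then have "pml_Lambda R \<sigma>\<^sub>0 x $ i $ i \<in> {b / a, a / b, b\<^sup>2 / a, a}"
  proof cases
    case 1
    have "i \<in> {1, 2}" using coordinates_dim2(2)[OF 1] UNIV_I by blast
    then show ?thesis using 1 by (auto simp: pml_Lambda_def Let_def vector_nth_dim2 a_def b_def)
  next
    case 2
    have "i \<in> {1, 2, 3}" using coordinates_dim3(4)[OF 2] UNIV_I by blast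
    then show ?thesis using 2 by (auto simp: pml_Lambda_def Let_def vector_nth_dim3 a_def b_def)
  qed
  then consider "pml_Lambda R \<sigma>\<^sub>0 x $ i $ i = b / a" | "pml_Lambda R \<sigma>\<^sub>0 x $ i $ i = a / b"
    | "pml_Lambda R \<sigma>\<^sub>0 x $ i $ i = b\<^sup>2 / a" | "pml_Lambda R \<sigma>\<^sub>0 x $ i $ i = a" by blast
  note cases = this
  show "0 \<le> Re (pml_Lambda R \<sigma>\<^sub>0 x $ i $ i)"
    using cases by cases (use re in simp_all)
  show "pml_Lambda R \<sigma>\<^sub>0 x $ i $ i = 1" if "norm x \<le> R"
    using cases by cases (use inside[OF that] in simp_all)
  show "cmod (pml_Lambda R \<sigma>\<^sub>0 x $ i $ i) \<le> (1 + \<sigma>\<^sub>0)\<^sup>2"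
    using cases
  proof cases
    case 1 show ?thesis unfolding 1 by (rule div[OF n(1) order_trans[OF n(4) sq]])
  next
    case 2 show ?thesis unfolding 2 by (rule div[OF n(3) order_trans[OF n(2) sq]])
  next
    case 3 show ?thesis unfolding 3 by (rule div[OF n(1) bb])
  next
    case 4 show ?thesis unfolding 4 by (rule order_trans[OF n(2) sq])
  qed
qed

lemma hermitian_form_diagonal:
  fixes H \<Lambda> :: "complex^'n^'n" and \<xi> :: "complex^'n"
  assumes real: "\<And>i j. cnj (H $ i $ j) = H $ i $ j" and diag: "\<And>i j. i \<noteq> j \<Longrightarrow> \<Lambda> $ i $ j = 0"
  shows "(\<Sum>i\<in>UNIV. ((H ** \<Lambda> ** transpose H) *v \<xi>) $ i * cnj (\<xi> $ i))
      = (\<Sum>j\<in>UNIV. \<Lambda> $ j $ j * of_real ((cmod ((transpose H *v \<xi>) $ j))\<^sup>2))"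
proof -
  define \<eta> where "\<eta> = transpose H *v \<xi>"
  have \<Lambda>\<eta>: "(\<Lambda> *v \<eta>) $ j = \<Lambda> $ j $ j * \<eta> $ j" for j
  proof -
    have "(\<Lambda> *v \<eta>) $ j = (\<Sum>k\<in>UNIV. \<Lambda> $ j $ k * \<eta> $ k)" by (simp add: matrix_vector_mult_def)
    also have "\<dots> = (\<Sum>k\<in>{j}. \<Lambda> $ j $ k * \<eta> $ k)"
      using diag by (intro sum.mono_neutral_right) auto
    finally show ?thesis by simp
  qed
  have cn: "cnj (\<eta> $ j) = (\<Sum>i\<in>UNIV. H $ i $ j * cnj (\<xi> $ i))" for j
    using real by (simp add: \<eta>_def matrix_vector_mult_def transpose_def cnj_sum)
  have "(\<Sum>i\<in>UNIV. ((H ** \<Lambda> ** transpose H) *v \<xi>) $ i * cnj (\<xi> $ i))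
      = (\<Sum>i\<in>UNIV. (\<Sum>j\<in>UNIV. H $ i $ j * (\<Lambda> $ j $ j * \<eta> $ j)) * cnj (\<xi> $ i))"
  proof -
    have "(H ** \<Lambda> ** transpose H) *v \<xi> = H *v (\<Lambda> *v \<eta>)"
      by (simp only: matrix_vector_mul_assoc[symmetric] \<eta>_def)
    then show ?thesis by (simp only: matrix_vector_mult_def[of H] \<Lambda>\<eta> vec_lambda_beta)
  qed
  also have "\<dots> = (\<Sum>j\<in>UNIV. \<Lambda> $ j $ j * \<eta> $ j * (\<Sum>i\<in>UNIV. H $ i $ j * cnj (\<xi> $ i)))"
    unfolding sum_distrib_left sum_distrib_right by (subst sum.swap) (simp add: mult_ac)
  also have "\<dots> = (\<Sum>j\<in>UNIV. \<Lambda> $ j $ j * of_real ((cmod (\<eta> $ j))\<^sup>2))"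
    unfolding cn[symmetric] by (simp only: complex_norm_square mult.assoc)
  finally show ?thesis by (simp add: \<eta>_def)
qed

text \<open>
  The matrix \<open>H\<close> is real and orthogonal, so the form is diagonal in rotated coordinates.
\<close>

lemma pml_A_form:
  assumes dim: "CARD('n::{finite,comm_ring_1}) = 2 \<or> CARD('n) = 3" and "0 < \<sigma>\<^sub>0" "0 < R"
  shows "0 \<le> Re (\<Sum>i\<in>UNIV. (pml_A R \<sigma>\<^sub>0 (x::real^'n::{finite,comm_ring_1}) *v \<xi>) $ i * cnj (\<xi> $ i))"
    "norm x \<le> R \<Longrightarrow> Re (\<Sum>i\<in>UNIV. (pml_A R \<sigma>\<^sub>0 x *v \<xi>) $ i * cnj (\<xi> $ i)) = (\<Sum>i\<in>UNIV. (cmod (\<xi> $ i))\<^sup>2)"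
proof -
  have form: "(\<Sum>i\<in>UNIV. (pml_A R \<sigma>\<^sub>0 x *v \<xi>) $ i * cnj (\<xi> $ i))
      = (\<Sum>j\<in>UNIV. pml_Lambda R \<sigma>\<^sub>0 x $ j $ j * of_real ((cmod ((transpose (pml_H x) *v \<xi>) $ j))\<^sup>2))"
    unfolding pml_A_def by (intro hermitian_form_diagonal pml_H_real pml_Lambda_offdiag dim)
  show "0 \<le> Re (\<Sum>i\<in>UNIV. (pml_A R \<sigma>\<^sub>0 x *v \<xi>) $ i * cnj (\<xi> $ i))"
    unfolding form Re_sum using pml_Lambda_diag(1)[OF assms] by (intro sum_nonneg) simp
  assume "norm x \<le> R"
  then have "pml_Lambda R \<sigma>\<^sub>0 x = mat 1"
    using pml_Lambda_diag(2)[OF assms] pml_Lambda_offdiag[OF dim] by (simp add: vec_eq_iff mat_def)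
  then have "pml_A R \<sigma>\<^sub>0 x = mat 1"
    by (simp add: pml_A_def matrix_mul_rid pml_H_orthogonal[OF dim])
  then show "Re (\<Sum>i\<in>UNIV. (pml_A R \<sigma>\<^sub>0 x *v \<xi>) $ i * cnj (\<xi> $ i)) = (\<Sum>i\<in>UNIV. (cmod (\<xi> $ i))\<^sup>2)"
    by (simp add: matrix_vector_mul_lid complex_mult_cnj cmod_power2)
qed

lemma pml_A_bounded:
  assumes dim: "CARD('n::{finite,comm_ring_1}) = 2 \<or> CARD('n) = 3" and "0 < \<sigma>\<^sub>0" "0 < R"
  shows "\<exists>K. \<forall>(x::real^'n::{finite,comm_ring_1}) i j. cmod (pml_A R \<sigma>\<^sub>0 x $ i $ j) \<le> K"
proof -
  have L: "cmod (pml_Lambda R \<sigma>\<^sub>0 x $ i $ j) \<le> (1 + \<sigma>\<^sub>0)\<^sup>2" for x :: "real^'n::{finite,comm_ring_1}" and i j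
    using pml_Lambda_diag(3)[OF assms] pml_Lambda_offdiag[OF dim] by (cases "i = j") auto
  have "cmod (pml_A R \<sigma>\<^sub>0 x $ i $ j) \<le> (\<Sum>k\<in>(UNIV::'n set). \<Sum>l\<in>(UNIV::'n set). (1 + \<sigma>\<^sub>0)\<^sup>2)" for x :: "real^'n::{finite,comm_ring_1}" and i j
  proof -
    have "cmod (pml_A R \<sigma>\<^sub>0 x $ i $ j)
        = cmod (\<Sum>k\<in>UNIV. \<Sum>l\<in>UNIV. pml_H x $ i $ l * pml_Lambda R \<sigma>\<^sub>0 x $ l $ k * pml_H x $ j $ k)"
      by (simp add: pml_A_def matrix_matrix_mult_def transpose_def sum_distrib_right)
    also have "\<dots> \<le> (\<Sum>k\<in>(UNIV::'n set). \<Sum>l\<in>(UNIV::'n set). (1 + \<sigma>\<^sub>0)\<^sup>2)"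
    proof (intro order_trans[OF norm_sum] sum_mono)
      fix k l
      have "cmod (pml_H x $ i $ l) * cmod (pml_Lambda R \<sigma>\<^sub>0 x $ l $ k) * cmod (pml_H x $ j $ k) \<le> 1 * (1 + \<sigma>\<^sub>0)\<^sup>2 * 1"
        by (intro mult_mono pml_H_norm_le[OF dim] L) auto
      then show "cmod (pml_H x $ i $ l * pml_Lambda R \<sigma>\<^sub>0 x $ l $ k * pml_H x $ j $ k) \<le> (1 + \<sigma>\<^sub>0)\<^sup>2"
        by (simp add: norm_mult)
    qed
    finally show ?thesis .
  qed
  then show ?thesis by blast
qed

lemma pml_coefficients_measurable:
  "pml_alpha R \<sigma>\<^sub>0 \<in> borel_measurable borel" "pml_beta R \<sigma>\<^sub>0 \<in> borel_measurable borel"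
  unfolding pml_alpha_def[abs_def] pml_beta_def[abs_def] pml_sigma_def pml_delta_def by measurable

lemma cos_sin_Arg:
  "cos (Arg z) = (if z = 0 then 1 else Re z / cmod z)" "sin (Arg z) = (if z = 0 then 0 else Im z / cmod z)"
proof -
  have "Re (cis (Arg z)) = Re (sgn z)" "Im (cis (Arg z)) = Im (sgn z)" if "z \<noteq> 0"
    using cis_Arg[OF that] by simp_all
  then show "cos (Arg z) = (if z = 0 then 1 else Re z / cmod z)" "sin (Arg z) = (if z = 0 then 0 else Im z / cmod z)"
    by (auto simp: Arg_zero Re_sgn Im_sgn)
qed

text \<open>
  Although the angles are discontinuous functions of the position, their sines and cosines are
  algebraic expressions in the coordinates.
\<close>

lemma pml_H_measurable: 
  assumes "CARD('n::{finite,comm_ring_1}) = 2 \<or> CARD('n) = 3"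
  shows "(\<lambda>x::real^'n::{finite,comm_ring_1}. pml_H x $ i $ j) \<in> borel_measurable borel"
proof -
  have nth[measurable]: "(\<lambda>x::real^'n::{finite,comm_ring_1}. x $ i) \<in> borel_measurable borel" for i
    by (intro borel_measurable_continuous_onI continuous_intros)
  have [measurable]: "(\<lambda>x::real^'n::{finite,comm_ring_1}. cos (complex_of_real (Arg (Complex (x $ 1) (x $ 2))))) \<in> borel_measurable borel"
    "(\<lambda>x::real^'n::{finite,comm_ring_1}. sin (complex_of_real (Arg (Complex (x $ 1) (x $ 2))))) \<in> borel_measurable borel"
  proof -
    have *: "cos (complex_of_real (Arg (Complex (x $ 1) (x $ 2))))
          = of_real (if x $ 1 = 0 \<and> x $ 2 = 0 then 1 else x $ 1 / sqrt ((x $ 1)\<^sup>2 + (x $ 2)\<^sup>2))"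
        "sin (complex_of_real (Arg (Complex (x $ 1) (x $ 2))))
          = of_real (if x $ 1 = 0 \<and> x $ 2 = 0 then 0 else x $ 2 / sqrt ((x $ 1)\<^sup>2 + (x $ 2)\<^sup>2))"
      for x :: "real^'n::{finite,comm_ring_1}"
      by (auto simp: cos_of_real sin_of_real cos_sin_Arg complex_eq_iff complex_norm)
    show "(\<lambda>x::real^'n::{finite,comm_ring_1}. cos (complex_of_real (Arg (Complex (x $ 1) (x $ 2))))) \<in> borel_measurable borel"
      "(\<lambda>x::real^'n::{finite,comm_ring_1}. sin (complex_of_real (Arg (Complex (x $ 1) (x $ 2))))) \<in> borel_measurable borel"
      unfolding * by measurable
  qed
  have b: "\<bar>x $ 3 / norm x\<bar> \<le> 1" for x :: "real^'n::{finite,comm_ring_1}"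
    using component_le_norm_cart[of x 3] by (simp add: divide_le_eq_1)
  have "cos (arccos (x $ 3 / norm x)) = x $ 3 / norm x" "sin (arccos (x $ 3 / norm x)) = sqrt (1 - (x $ 3 / norm x)\<^sup>2)"
    for x :: "real^'n::{finite,comm_ring_1}"
    using b[of x] unfolding abs_le_iff by (auto intro!: cos_arccos sin_arccos)
  then have [measurable]: "(\<lambda>x::real^'n::{finite,comm_ring_1}. cos (complex_of_real (arccos (x $ 3 / norm x)))) \<in> borel_measurable borel"
    "(\<lambda>x::real^'n::{finite,comm_ring_1}. sin (complex_of_real (arccos (x $ 3 / norm x)))) \<in> borel_measurable borel"
    unfolding cos_of_real sin_of_real by (simp_all only:, measurable)
  from assms show ?thesis
  proof
    assume d: "CARD('n) = 2"
    have "i \<in> {1, 2}" "j \<in> {1, 2}" using coordinates_dim2(2)[OF d] UNIV_I by blast+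
    then show ?thesis using d
      by (auto simp: pml_H_def Let_def vector_nth_dim2)
  next
    assume d: "CARD('n) = 3"
    have "i \<in> {1, 2, 3}" "j \<in> {1, 2, 3}" using coordinates_dim3(4)[OF d] UNIV_I by blast+
    then show ?thesis using d
      by (auto simp: pml_H_def Let_def vector_nth_dim3)
  qed
qed

lemma pml_Lambda_measurable: 
  assumes "CARD('n::{finite,comm_ring_1}) = 2 \<or> CARD('n) = 3"
  shows "(\<lambda>x::real^'n::{finite,comm_ring_1}. pml_Lambda R \<sigma>\<^sub>0 x $ i $ j) \<in> borel_measurable borel"
  using assms
proof
  note [measurable] = pml_coefficients_measurable
  assume d: "CARD('n) = 2"
  have "i \<in> {1, 2}" "j \<in> {1, 2}" using coordinates_dim2(2)[OF d] UNIV_I by blast+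
  then show ?thesis using d
    by (auto simp: pml_Lambda_def Let_def vector_nth_dim2)
next
  note [measurable] = pml_coefficients_measurable
  assume d: "CARD('n) = 3"
  have "i \<in> {1, 2, 3}" "j \<in> {1, 2, 3}" using coordinates_dim3(4)[OF d] UNIV_I by blast+
  then show ?thesis using d
    by (auto simp: pml_Lambda_def Let_def vector_nth_dim3)
qed

lemma pml_A_measurable:
  assumes dim: "CARD('n::{finite,comm_ring_1}) = 2 \<or> CARD('n) = 3"
  shows "(\<lambda>x::real^'n::{finite,comm_ring_1}. pml_A R \<sigma>\<^sub>0 x $ i $ j) \<in> borel_measurable borel"
proof -
  note [measurable] = pml_H_measurable[OF dim] pml_Lambda_measurable[OF dim]
  show ?thesis unfolding pml_A_def matrix_matrix_mult_def transpose_def by simp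
qed

lemma pml_B_measurable: "pml_B R \<sigma>\<^sub>0 \<in> borel_measurable borel"
proof -
  note [measurable] = pml_coefficients_measurable
  show ?thesis unfolding pml_B_def[abs_def] by measurable
qed

lemma pml_B_bounded:
  assumes "0 < \<sigma>\<^sub>0" "0 < R"
  shows "\<exists>K. \<forall>x. cmod (pml_B R \<sigma>\<^sub>0 (x::real^'n::{finite,comm_ring_1})) \<le> K"
proof (intro exI allI)
  fix x :: "real^'n::{finite,comm_ring_1}"
  show "cmod (pml_B R \<sigma>\<^sub>0 x) \<le> (1 + \<sigma>\<^sub>0) * (1 + \<sigma>\<^sub>0) ^ (CARD('n) - 1)"
    unfolding pml_B_def norm_mult norm_power
    using assms pml_alpha_norm[OF assms, of "norm x"] pml_beta_norm[OF assms, of "norm x"]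
    by (intro mult_mono power_mono) auto
qed

lemma pml_B_Re_le:
  assumes dim: "CARD('n::{finite,comm_ring_1}) = 2 \<or> CARD('n) = 3" and "0 < \<sigma>\<^sub>0" "0 < R"
  shows "Re (pml_B R \<sigma>\<^sub>0 (x::real^'n::{finite,comm_ring_1})) \<le> 1"
proof -
  define s d where "s = pml_sigma R \<sigma>\<^sub>0 (norm x)" and "d = pml_delta R \<sigma>\<^sub>0 (norm x)"
  have sd: "0 \<le> d" "d \<le> s" using pml_sigma_delta[of \<sigma>\<^sub>0 R "norm x"] assms by (auto simp: s_def d_def)
  have ab: "pml_alpha R \<sigma>\<^sub>0 (norm x) = Complex 1 s" "pml_beta R \<sigma>\<^sub>0 (norm x) = Complex 1 d"
    by (auto simp: pml_alpha_def pml_beta_def s_def d_def complex_eq_iff)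
  have "0 \<le> s * d" "0 \<le> d * d" using sd by auto
  with dim show ?thesis
    by (auto simp: pml_B_def ab power2_eq_square algebra_simps)
qed

section \<open>The sesquilinear form and the energy norm\<close>

text \<open>
  The argument of type \<open>itself\<close> only fixes the index type of the coordinates.
\<close>

locale pml_domain =
  fixes dim_type :: "'n::{finite,comm_ring_1} itself" and R Rh \<sigma>\<^sub>0 k :: real
  assumes dim: "CARD('n) = 2 \<or> CARD('n) = 3"
    and R: "0 < R" "R < Rh" and \<sigma>\<^sub>0: "0 < \<sigma>\<^sub>0" and k: "1 < k"
begin

abbreviation D :: "(real^'n::{finite,comm_ring_1}) set" where "D \<equiv> ball 0 Rh"
abbreviation Om :: "(real^'n::{finite,comm_ring_1}) set" where "Om \<equiv> ball 0 R"
abbreviation solves :: "(real^'n::{finite,comm_ring_1} \<Rightarrow> complex) \<Rightarrow> (real^'n::{finite,comm_ring_1} \<Rightarrow> complex) \<Rightarrow> bool"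
  where "solves \<equiv> pml_solution R Rh \<sigma>\<^sub>0 k"
abbreviation En :: "(real^'n::{finite,comm_ring_1} \<Rightarrow> complex) \<Rightarrow> real" where "En \<equiv> energy_norm R Rh \<sigma>\<^sub>0 k"

lemma Om_subset_D: "Om \<subseteq> D"
  using R by auto

lemma A_gradient_in_L2:
  assumes u: "H1 D u"
  shows "in_Lp 2 D (\<lambda>x. (pml_A R \<sigma>\<^sub>0 x *v wgrad D u x) $ i)"
proof -
  obtain K where K: "\<And>(x::real^'n::{finite,comm_ring_1}) i j. cmod (pml_A R \<sigma>\<^sub>0 x $ i $ j) \<le> K"
    using pml_A_bounded[OF dim \<sigma>\<^sub>0 R(1)] by blast
  have m: "(\<lambda>x::real^'n::{finite,comm_ring_1}. pml_A R \<sigma>\<^sub>0 x $ i $ j) \<in> borel_measurable (lebesgue_on D)" for j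
    using pml_A_measurable[OF dim, of R \<sigma>\<^sub>0 i j] by (intro measurable_restrict_space1 measurable_completion) simp
  have "in_Lp 2 D (\<lambda>x. pml_A R \<sigma>\<^sub>0 x $ i $ j * wgrad D u x $ j)" for j
    by (rule in_L2_mult_bounded[OF wgrad_in_L2[OF u] m K])
  then show ?thesis unfolding matrix_vector_mult_def by (simp add: in_L2_sum)
qed

lemma gradient_term_integrable:
  assumes "H1 D u" "H1 D v"
  shows "integrable (lebesgue_on D) (\<lambda>x. \<Sum>i\<in>UNIV. (pml_A R \<sigma>\<^sub>0 x *v wgrad D u x) $ i * cnj (wgrad D v x $ i))"
  by (intro Bochner_Integration.integrable_sum in_L2_product_integrable A_gradient_in_L2 in_L2_cnj wgrad_in_L2 assms)

lemma B_mult_in_L2: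
  assumes "in_Lp 2 D u"
  shows "in_Lp 2 D (\<lambda>x. pml_B R \<sigma>\<^sub>0 x * u x)"
proof -
  obtain K where K: "\<And>x::real^'n::{finite,comm_ring_1}. cmod (pml_B R \<sigma>\<^sub>0 x) \<le> K"
    using pml_B_bounded[OF \<sigma>\<^sub>0 R(1)] by blast
  have m: "(pml_B R \<sigma>\<^sub>0 :: real^'n::{finite,comm_ring_1} \<Rightarrow> complex) \<in> borel_measurable (lebesgue_on D)"
    using pml_B_measurable[of R \<sigma>\<^sub>0] by (intro measurable_restrict_space1 measurable_completion) simp
  show ?thesis by (rule in_L2_mult_bounded[OF assms m K])
qed

lemma inner_L2_diff:
  assumes "in_Lp 2 D f" "in_Lp 2 D g" "in_Lp 2 D v"
  shows "inner_L2 D (\<lambda>x. f x - g x) v = inner_L2 D f v - inner_L2 D g v"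
  using in_L2_product_integrable[OF assms(1) in_L2_cnj[OF assms(3)]]
    in_L2_product_integrable[OF assms(2) in_L2_cnj[OF assms(3)]]
  by (simp add: inner_L2_def left_diff_distrib)

lemma pml_form_diff:
  assumes u: "H1 D u" "H1 D u'" and v: "H1 D v"
  shows "pml_form R Rh \<sigma>\<^sub>0 k (\<lambda>x. u x - u' x) v = pml_form R Rh \<sigma>\<^sub>0 k u v - pml_form R Rh \<sigma>\<^sub>0 k u' v"
proof -
  let ?q = "\<lambda>u x. \<Sum>i\<in>UNIV. (pml_A R \<sigma>\<^sub>0 x *v wgrad D u x) $ i * cnj (wgrad D v x $ i)"
  have d: "H1 D (\<lambda>x. u x - u' x)" using u by (intro H1_diff) auto
  have "(LINT x|lebesgue_on D. ?q (\<lambda>x. u x - u' x) x) = (LINT x|lebesgue_on D. ?q u x - ?q u' x)"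
  proof (rule integral_cong_AE)
    have "AE x in lebesgue_on D. wgrad D (\<lambda>x. u x - u' x) x = wgrad D u x - wgrad D u' x"
      using u by (intro wgrad_diff) auto
    then show "AE x in lebesgue_on D. ?q (\<lambda>x. u x - u' x) x = ?q u x - ?q u' x"
      by eventually_elim (simp add: matrix_vector_mult_diff_distrib left_diff_distrib sum_subtractf)
  qed (intro borel_measurable_integrable gradient_term_integrable Bochner_Integration.integrable_diff u v d)+
  also have "\<dots> = (LINT x|lebesgue_on D. ?q u x) - (LINT x|lebesgue_on D. ?q u' x)"
    by (intro Bochner_Integration.integral_diff gradient_term_integrable u v)
  finally have 1: "(LINT x|lebesgue_on D. ?q (\<lambda>x. u x - u' x) x) = \<dots>" .
  have 2: "inner_L2 D (\<lambda>x. pml_B R \<sigma>\<^sub>0 x * (u x - u' x)) v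
      = inner_L2 D (\<lambda>x. pml_B R \<sigma>\<^sub>0 x * u x) v - inner_L2 D (\<lambda>x. pml_B R \<sigma>\<^sub>0 x * u' x) v"
    unfolding right_diff_distrib by (intro inner_L2_diff B_mult_in_L2 H1_in_L2 u v)
  show ?thesis unfolding pml_form_def Let_def 1 2 by (simp add: right_diff_distrib)
qed

lemma pml_solution_diff:
  assumes "solves g w" "solves g' w'" "in_Lp 2 D g" "in_Lp 2 D g'"
  shows "solves (\<lambda>x. g x - g' x) (\<lambda>x. w x - w' x)"
  unfolding pml_solution_def
proof (intro conjI allI impI)
  have H: "H10 D w" "H10 D w'" using assms by (auto simp: pml_solution_def)
  then show "H10 D (\<lambda>x. w x - w' x)" by (intro H10_diff) auto
  fix v :: "real^'n::{finite,comm_ring_1} \<Rightarrow> complex" assume v: "H10 D v"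
  have "H1 D w" "H1 D w'" "H1 D v" using H v by (auto simp: H10_def)
  then have "pml_form R Rh \<sigma>\<^sub>0 k (\<lambda>x. w x - w' x) v
      = pml_form R Rh \<sigma>\<^sub>0 k w v - pml_form R Rh \<sigma>\<^sub>0 k w' v"
    by (rule pml_form_diff)
  also have "\<dots> = inner_L2 D g v - inner_L2 D g' v"
    using assms v by (simp add: pml_solution_def)
  also have "\<dots> = inner_L2 D (\<lambda>x. g x - g' x) v"
    using assms \<open>H1 D v\<close> by (intro inner_L2_diff[symmetric]) (simp_all add: H1_in_L2)
  finally show "pml_form R Rh \<sigma>\<^sub>0 k (\<lambda>x. w x - w' x) v = inner_L2 D (\<lambda>x. g x - g' x) v" .
qed

lemma pml_solution_cong_AE:
  assumes sol: "solves g w" and g: "in_Lp 2 D g" "in_Lp 2 D g'"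
    and eq: "AE x in lebesgue_on D. g x = g' x"
  shows "solves g' w"
proof -
  have "inner_L2 D g v = inner_L2 D g' v" if v: "H10 D v" for v
    unfolding inner_L2_def
  proof (rule integral_cong_AE)
    have "in_Lp 2 D v" using v by (simp add: H10_def H1_in_L2)
    then have "integrable (lebesgue_on D) (\<lambda>x. g x * cnj (v x))"
      "integrable (lebesgue_on D) (\<lambda>x. g' x * cnj (v x))"
      using g by (auto intro: in_L2_product_integrable in_L2_cnj)
    then show "(\<lambda>x. g x * cnj (v x)) \<in> borel_measurable (lebesgue_on D)"
      "(\<lambda>x. g' x * cnj (v x)) \<in> borel_measurable (lebesgue_on D)"
      by (auto intro: borel_measurable_integrable)
    show "AE x in lebesgue_on D. g x * cnj (v x) = g' x * cnj (v x)"
      using eq by eventually_elim simp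
  qed
  with sol show ?thesis unfolding pml_solution_def by simp
qed

lemma Om_measurable: "Om \<in> sets lebesgue" "D \<in> sets lebesgue"
    "Om \<inter> space (lebesgue_on D) \<in> sets (lebesgue_on D)"
  using Om_subset_D by (auto simp: sets_restrict_space)

lemma integral_D_Om:
  fixes h :: "real^'n::{finite,comm_ring_1} \<Rightarrow> real"
  shows "(LINT x|lebesgue_on D. indicat_real Om x * h x) = (LINT x|lebesgue_on Om. h x)"
    "integrable (lebesgue_on D) (\<lambda>x. indicat_real Om x * h x) \<longleftrightarrow> integrable (lebesgue_on Om) h"
proof -
  have eq: "lebesgue_on Om = restrict_space (lebesgue_on D) Om"
    using Om_subset_D by (simp add: restrict_restrict_space inf.absorb2)
  show "(LINT x|lebesgue_on D. indicat_real Om x * h x) = (LINT x|lebesgue_on Om. h x)"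
    unfolding eq integral_restrict_space[OF Om_measurable(3)] by simp
  show "integrable (lebesgue_on D) (\<lambda>x. indicat_real Om x * h x) \<longleftrightarrow> integrable (lebesgue_on Om) h"
    unfolding eq integrable_restrict_space[OF Om_measurable(3)] by simp
qed

text \<open>
  The real part of \<open>B\<close> is at most 1, so one of the two copies of \<open>k\<^sup>2\<close> times the squared norm that the
  energy norm adds is left over.
\<close>

lemma energy_lower_bound:
  assumes v: "H1 D v"
  shows "(\<Sum>i\<in>UNIV. (Lp_norm 2 Om (\<lambda>x. wgrad D v x $ i))\<^sup>2) + k\<^sup>2 * (Lp_norm 2 D v)\<^sup>2 \<le> (En v)\<^sup>2"
    "0 \<le> En v"
proof -
  let ?q = "\<lambda>x. \<Sum>i\<in>UNIV. (pml_A R \<sigma>\<^sub>0 x *v wgrad D v x) $ i * cnj (wgrad D v x $ i)"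
  have L2Om: "in_Lp 2 Om (\<lambda>x. wgrad D v x $ i)" for i
    by (rule in_L2_subset[OF wgrad_in_L2[OF v] Om_subset_D Om_measurable(2,1)])
  have "(\<Sum>i\<in>UNIV. (Lp_norm 2 Om (\<lambda>x. wgrad D v x $ i))\<^sup>2)
      = (LINT x|lebesgue_on Om. (\<Sum>i\<in>UNIV. (cmod (wgrad D v x $ i))\<^sup>2))"
    using L2Om unfolding L2_norm_squared by (subst Bochner_Integration.integral_sum) (auto simp: in_L2_iff)
  also have "\<dots> = (LINT x|lebesgue_on D. indicat_real Om x * (\<Sum>i\<in>UNIV. (cmod (wgrad D v x $ i))\<^sup>2))"
    by (rule integral_D_Om(1)[symmetric])
  also have "\<dots> \<le> (LINT x|lebesgue_on D. Re (?q x))"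
  proof (rule integral_mono)
    show "integrable (lebesgue_on D) (\<lambda>x. indicat_real Om x * (\<Sum>i\<in>UNIV. (cmod (wgrad D v x $ i))\<^sup>2))"
      unfolding integral_D_Om(2) using L2Om by (auto simp: in_L2_iff)
    show "integrable (lebesgue_on D) (\<lambda>x. Re (?q x))"
      by (intro integrable_Re gradient_term_integrable v)
    show "indicat_real Om x * (\<Sum>i\<in>UNIV. (cmod (wgrad D v x $ i))\<^sup>2) \<le> Re (?q x)" for x
      using pml_A_form[OF dim \<sigma>\<^sub>0 R(1), of x "wgrad D v x"] by (cases "x \<in> Om") auto
  qed
  also have "\<dots> = Re (LINT x|lebesgue_on D. ?q x)"
    by (rule integral_Re) (intro gradient_term_integrable v)
  finally have grad: "(\<Sum>i\<in>UNIV. (Lp_norm 2 Om (\<lambda>x. wgrad D v x $ i))\<^sup>2) \<le> Re (LINT x|lebesgue_on D. ?q x)" .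
  have Bint: "integrable (lebesgue_on D) (\<lambda>x. pml_B R \<sigma>\<^sub>0 x * v x * cnj (v x))"
    by (intro in_L2_product_integrable B_mult_in_L2 in_L2_cnj H1_in_L2 v)
  have "Re (inner_L2 D (\<lambda>x. pml_B R \<sigma>\<^sub>0 x * v x) v)
      = (LINT x|lebesgue_on D. Re (pml_B R \<sigma>\<^sub>0 x * v x * cnj (v x)))"
    unfolding inner_L2_def by (rule integral_Re[OF Bint, symmetric])
  also have "\<dots> \<le> (Lp_norm 2 D v)\<^sup>2"
    unfolding L2_norm_squared
  proof (rule integral_mono)
    show "integrable (lebesgue_on D) (\<lambda>x. Re (pml_B R \<sigma>\<^sub>0 x * v x * cnj (v x)))"
      by (intro integrable_Re Bint)
    show "integrable (lebesgue_on D) (\<lambda>x. (cmod (v x))\<^sup>2)" using H1_in_L2[OF v] by (simp add: in_L2_iff)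
    fix x
    have "Re (pml_B R \<sigma>\<^sub>0 x * v x * cnj (v x)) = Re (pml_B R \<sigma>\<^sub>0 x * of_real ((cmod (v x))\<^sup>2))"
      unfolding complex_norm_square by (simp only: mult.assoc)
    also have "\<dots> = Re (pml_B R \<sigma>\<^sub>0 x) * (cmod (v x))\<^sup>2" by simp
    also have "\<dots> \<le> 1 * (cmod (v x))\<^sup>2"
      by (intro mult_right_mono pml_B_Re_le dim \<sigma>\<^sub>0 R) simp
    finally show "Re (pml_B R \<sigma>\<^sub>0 x * v x * cnj (v x)) \<le> (cmod (v x))\<^sup>2" by simp
  qed
  finally have B: "k\<^sup>2 * Re (inner_L2 D (\<lambda>x. pml_B R \<sigma>\<^sub>0 x * v x) v) \<le> k\<^sup>2 * (Lp_norm 2 D v)\<^sup>2"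
    by (intro mult_left_mono) auto
  have form: "Re (pml_form R Rh \<sigma>\<^sub>0 k v v)
      = Re (LINT x|lebesgue_on D. ?q x) - k\<^sup>2 * Re (inner_L2 D (\<lambda>x. pml_B R \<sigma>\<^sub>0 x * v x) v)"
    by (simp add: pml_form_def Let_def)
  have sum0: "0 \<le> (\<Sum>i\<in>UNIV. (Lp_norm 2 Om (\<lambda>x. wgrad D v x $ i))\<^sup>2)" "0 \<le> k\<^sup>2 * (Lp_norm 2 D v)\<^sup>2"
    by (auto intro: sum_nonneg)
  have le: "(\<Sum>i\<in>UNIV. (Lp_norm 2 Om (\<lambda>x. wgrad D v x $ i))\<^sup>2) + k\<^sup>2 * (Lp_norm 2 D v)\<^sup>2
      \<le> Re (pml_form R Rh \<sigma>\<^sub>0 k v v) + 2 * k\<^sup>2 * (Lp_norm 2 D v)\<^sup>2"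
    unfolding form using grad B by linarith
  with sum0 have nn: "0 \<le> Re (pml_form R Rh \<sigma>\<^sub>0 k v v) + 2 * k\<^sup>2 * (Lp_norm 2 D v)\<^sup>2" by linarith
  show "0 \<le> En v" unfolding energy_norm_def using nn by simp
  show "(\<Sum>i\<in>UNIV. (Lp_norm 2 Om (\<lambda>x. wgrad D v x $ i))\<^sup>2) + k\<^sup>2 * (Lp_norm 2 D v)\<^sup>2 \<le> (En v)\<^sup>2"
    unfolding energy_norm_def using le nn by simp
qed

lemma energy_zero_AE:
  assumes v: "H1 D v" and "En v \<le> 0"
  shows "AE x in lebesgue_on D. v x = 0"
proof -
  have "En v = 0" using energy_lower_bound(2)[OF v] assms(2) by simp
  with energy_lower_bound(1)[OF v]
  have "(\<Sum>i\<in>UNIV. (Lp_norm 2 Om (\<lambda>x. wgrad D v x $ i))\<^sup>2) + k\<^sup>2 * (Lp_norm 2 D v)\<^sup>2 \<le> 0" by simp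
  moreover have "0 \<le> (\<Sum>i\<in>UNIV. (Lp_norm 2 Om (\<lambda>x. wgrad D v x $ i))\<^sup>2)" by (intro sum_nonneg) simp
  ultimately have "k\<^sup>2 * (Lp_norm 2 D v)\<^sup>2 \<le> 0" by linarith
  then have "Lp_norm 2 D v = 0" using k by (simp add: mult_le_0_iff)
  then show ?thesis by (rule L2_norm_zero_AE[OF H1_in_L2[OF v]])
qed

lemma H1_norm_Om_le_energy:
  assumes v: "H1 D v"
  shows "H1_norm Om v \<le> En v" "Lp_norm 2 Om v \<le> En v / k"
proof -
  have vOm: "H1 Om v" using H1_subset[OF _ Om_subset_D _ v] by simp
  have "(Lp_norm 2 Om v)\<^sup>2 = (LINT x|lebesgue_on D. indicat_real Om x * (cmod (v x))\<^sup>2)"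
    unfolding L2_norm_squared by (rule integral_D_Om(1)[symmetric])
  also have "\<dots> \<le> (Lp_norm 2 D v)\<^sup>2"
    unfolding L2_norm_squared
  proof (rule integral_mono)
    show "integrable (lebesgue_on D) (\<lambda>x. indicat_real Om x * (cmod (v x))\<^sup>2)"
      unfolding integral_D_Om(2) using H1_in_L2[OF vOm] by (simp add: in_L2_iff)
    show "integrable (lebesgue_on D) (\<lambda>x. (cmod (v x))\<^sup>2)" using H1_in_L2[OF v] by (simp add: in_L2_iff)
  qed (auto simp: indicator_def)
  finally have L2: "(Lp_norm 2 Om v)\<^sup>2 \<le> (Lp_norm 2 D v)\<^sup>2" .
  have g: "Lp_norm 2 Om (\<lambda>x. wgrad Om v x $ i) = Lp_norm 2 Om (\<lambda>x. wgrad D v x $ i)" for i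
  proof (rule L2_norm_cong_AE)
    have "AE x in lebesgue_on Om. wgrad Om v x = wgrad D v x"
      by (rule wgrad_subset[OF _ Om_subset_D _ _ v]) auto
    then show "AE x in lebesgue_on Om. wgrad Om v x $ i = wgrad D v x $ i" by eventually_elim simp
    show "(\<lambda>x. wgrad Om v x $ i) \<in> borel_measurable (lebesgue_on Om)"
      by (rule in_L2_measurable[OF wgrad_in_L2[OF vOm]])
    show "(\<lambda>x. wgrad D v x $ i) \<in> borel_measurable (lebesgue_on Om)"
      by (rule in_L2_measurable[OF in_L2_subset[OF wgrad_in_L2[OF v] Om_subset_D Om_measurable(2,1)]])
  qed
  have sum0: "0 \<le> (\<Sum>i\<in>UNIV. (Lp_norm 2 Om (\<lambda>x. wgrad D v x $ i))\<^sup>2)" by (intro sum_nonneg) simp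
  have kk: "(Lp_norm 2 D v)\<^sup>2 \<le> k\<^sup>2 * (Lp_norm 2 D v)\<^sup>2"
    using k by (simp add: mult_le_cancel_right1 one_le_power)
  note E = energy_lower_bound[OF v]
  have "(H1_norm Om v)\<^sup>2 \<le> (En v)\<^sup>2"
    unfolding H1_norm_squared g using L2 kk E(1) by linarith
  then show "H1_norm Om v \<le> En v" using E(2) by (rule power2_le_imp_le)
  have "k\<^sup>2 * (Lp_norm 2 Om v)\<^sup>2 \<le> k\<^sup>2 * (Lp_norm 2 D v)\<^sup>2" using L2 by (intro mult_left_mono) auto
  then have "(k * Lp_norm 2 Om v)\<^sup>2 \<le> (En v)\<^sup>2"
    unfolding power_mult_distrib using E(1) sum0 by linarith
  then have "k * Lp_norm 2 Om v \<le> En v" using E(2) by (rule power2_le_imp_le)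
  then show "Lp_norm 2 Om v \<le> En v / k" using k by (simp add: field_simps)
qed

text \<open>
  The powers of the \<open>H1\<close>-norm, bounded by the energy, and of the \<open>L2\<close>-norm, bounded by the energy divided
  by \<open>k\<close>, add up to 1.
\<close>

lemma nirenberg_energy:
  assumes C: "nirenberg_constant TYPE('n) R p C" and p: "4 \<le> p" "p \<le> 6" and v: "H1 D v"
  shows "in_Lp p Om v" "Lp_norm p Om v \<le> C * k powr (real CARD('n) / 2 - real CARD('n) / p - 1) * En v"
proof -
  define d where "d = real CARD('n)"
  define s where "s = d / 2 - d / p"
  have d: "d = 2 \<or> d = 3" using dim by (auto simp: d_def)
  have s: "0 \<le> s" "s \<le> 1"
    using d p by (auto simp: s_def field_simps)
  have vOm: "H1 Om v" using H1_subset[OF _ Om_subset_D _ v] by simp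
  have C0: "0 < C" and in_p: "in_Lp p Om v"
    and N: "Lp_norm p Om v \<le> C * H1_norm Om v powr s * Lp_norm 2 Om v powr (1 - s)"
    using C vOm unfolding nirenberg_constant_def Let_def by (auto simp: d_def s_def algebra_simps)
  show "in_Lp p Om v" by (rule in_p)
  note E = H1_norm_Om_le_energy[OF v] energy_lower_bound(2)[OF v]
  have "Lp_norm p Om v \<le> C * (En v powr s * (En v / k) powr (1 - s))"
  proof (rule order_trans[OF N], unfold mult.assoc, rule mult_left_mono)
    show "H1_norm Om v powr s * Lp_norm 2 Om v powr (1 - s) \<le> En v powr s * (En v / k) powr (1 - s)"
      using s E by (intro mult_mono powr_mono2) (auto simp: L2_norm_nonneg H1_norm_def sum_nonneg)
  qed (use C0 in simp)
  also have "En v powr s * (En v / k) powr (1 - s) = k powr (s - 1) * En v"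
  proof (cases "En v = 0")
    case False
    then have "(En v / k) powr (1 - s) = En v powr (1 - s) * k powr (s - 1)"
      using E(3) k by (simp add: powr_divide powr_minus_divide[symmetric] divide_powr_uminus)
    then show ?thesis using False E(3) by (simp add: powr_add[symmetric])
  qed simp
  finally show "Lp_norm p Om v \<le> C * k powr (real CARD('n) / 2 - real CARD('n) / p - 1) * En v"
    by (simp add: s_def d_def mult.assoc)
qed

end

section \<open>Estimates for the cubic nonlinearity\<close>

text \<open>
  The real derivative of the cubic \<open>V \<mapsto> |V|\<^sup>2 V\<close> in the direction \<open>w\<close>; it is additive, but not
  complex linear, in \<open>w\<close>.
\<close>

definition kerr_lin :: "complex \<Rightarrow> complex \<Rightarrow> complex" where
  "kerr_lin V w = 2 * (V * cnj V) * w + V\<^sup>2 * cnj w"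

lemma kerr_lin_diff: "kerr_lin V (w - w') = kerr_lin V w - kerr_lin V w'"
  by (simp add: kerr_lin_def algebra_simps)

text \<open>
  Here the incident wave is bounded and measurable on the whole domain.  The equations see only its
  values on the Kerr medium, so in the end it is replaced by 0 elsewhere.
\<close>

locale kerr_newton = pml_domain dim_type R Rh \<sigma>\<^sub>0 k
  for dim_type :: "'n::{finite,comm_ring_1} itself" and R Rh \<sigma>\<^sub>0 k +
  fixes \<Omega>\<^sub>0 :: "(real^'n::{finite,comm_ring_1}) set" and \<epsilon> Cs C4 C6 :: real
    and uinc f us :: "real^'n::{finite,comm_ring_1} \<Rightarrow> complex"
  assumes Omega0: "open \<Omega>\<^sub>0" "\<Omega>\<^sub>0 \<noteq> {}" "\<Omega>\<^sub>0 \<subseteq> ball 0 R"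
    and eps: "0 < \<epsilon>" and Cs: "0 < Cs"
    and C4: "nirenberg_constant TYPE('n) R 4 C4" and C6: "nirenberg_constant TYPE('n) R 6 C6"
    and uinc: "uinc \<in> borel_measurable (lebesgue_on (ball 0 Rh))" "bounded (range uinc)"
    and f: "in_Lp 2 (ball 0 Rh) f"
    and us: "kerr_solution R Rh \<sigma>\<^sub>0 k \<epsilon> \<Omega>\<^sub>0 uinc f us"
    and stab_ex: "\<And>g. in_Lp 2 (ball 0 Rh) g \<Longrightarrow>
      \<exists>w. linearized_solution R Rh \<sigma>\<^sub>0 k \<epsilon> \<Omega>\<^sub>0 (\<lambda>x. us x + uinc x) g w"
    and stab: "\<And>g w. in_Lp 2 (ball 0 Rh) g \<Longrightarrow>
      linearized_solution R Rh \<sigma>\<^sub>0 k \<epsilon> \<Omega>\<^sub>0 (\<lambda>x. us x + uinc x) g w \<Longrightarrow>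
      energy_norm R Rh \<sigma>\<^sub>0 k w \<le> Cs * Lp_norm 2 (ball 0 Rh) g"
begin

definition kerr_weight :: "real^'n::{finite,comm_ring_1} \<Rightarrow> complex" where
  "kerr_weight x = of_real (k\<^sup>2 * \<epsilon> * indicat_real \<Omega>\<^sub>0 x)"

abbreviation U :: "real^'n::{finite,comm_ring_1} \<Rightarrow> complex" where "U x \<equiv> us x + uinc x"

definition CN :: real where "CN = nirenberg_max TYPE('n) \<sigma>\<^sub>0 C4 C6"
definition K4 :: real where "K4 = CN * k powr (real CARD('n) / 4 - 1)"
definition K6 :: real where "K6 = CN * k powr (real CARD('n) / 3 - 1)"

lemma C_le_CN: "0 < C4" "0 < C6" "C4 \<le> CN" "C6 \<le> CN" "0 < CN"
proof -
  show pos: "0 < C4" "0 < C6" using C4 C6 by (auto simp: nirenberg_constant_def)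
  have "1 \<le> (1 + \<sigma>\<^sub>0\<^sup>2) powr (real CARD('n) / 8)" "1 \<le> (1 + \<sigma>\<^sub>0\<^sup>2) powr (real CARD('n) / 6)"
    by (intro ge_one_powr_ge_zero; simp)+
  then have "C4 \<le> (1 + \<sigma>\<^sub>0\<^sup>2) powr (real CARD('n) / 8) * C4" "C6 \<le> (1 + \<sigma>\<^sub>0\<^sup>2) powr (real CARD('n) / 6) * C6"
    using pos by (simp_all add: mult_le_cancel_right1)
  then show "C4 \<le> CN" "C6 \<le> CN"
    unfolding CN_def nirenberg_max_def Let_def by (simp_all add: le_max_iff_disj)
  with pos show "0 < CN" by linarith
qed

lemma K_nonneg: "0 \<le> K4" "0 \<le> K6"
  using C_le_CN by (simp_all add: K4_def K6_def)

lemma H1_fourth_power: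
  assumes v: "H1 D v"
  shows "integrable (lebesgue_on Om) (\<lambda>x. cmod (v x) ^ 4)"
    "(LINT x|lebesgue_on Om. cmod (v x) ^ 4) \<le> (K4 * En v) ^ 4"
proof -
  note N = nirenberg_energy[OF C4 _ _ v]
  have "Lp_norm 4 Om v \<le> C4 * k powr (real CARD('n) / 2 - real CARD('n) / 4 - 1) * En v" using N(2) by simp
  also have "real CARD('n) / 2 - real CARD('n) / 4 - 1 = real CARD('n) / 4 - 1" by simp
  also have "C4 * k powr (real CARD('n) / 4 - 1) * En v \<le> K4 * En v"
    unfolding K4_def using C_le_CN energy_lower_bound(2)[OF v] by (intro mult_right_mono) auto
  finally have "Lp_norm 4 Om v \<le> K4 * En v" .
  then show "integrable (lebesgue_on Om) (\<lambda>x. cmod (v x) ^ 4)"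
    "(LINT x|lebesgue_on Om. cmod (v x) ^ 4) \<le> (K4 * En v) ^ 4"
    using N(1) by (auto intro: Lp_norm_le_imp_integral_le)
qed

lemma H1_sixth_power:
  assumes v: "H1 D v"
  shows "integrable (lebesgue_on Om) (\<lambda>x. cmod (v x) ^ 6)"
    "(LINT x|lebesgue_on Om. cmod (v x) ^ 6) \<le> (K6 * En v) ^ 6"
proof -
  note N = nirenberg_energy[OF C6 _ _ v]
  have "Lp_norm 6 Om v \<le> C6 * k powr (real CARD('n) / 2 - real CARD('n) / 6 - 1) * En v" using N(2) by simp
  also have "real CARD('n) / 2 - real CARD('n) / 6 - 1 = real CARD('n) / 3 - 1" by simp
  also have "C6 * k powr (real CARD('n) / 3 - 1) * En v \<le> K6 * En v"
    unfolding K6_def using C_le_CN energy_lower_bound(2)[OF v] by (intro mult_right_mono) auto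
  finally have "Lp_norm 6 Om v \<le> K6 * En v" .
  then show "integrable (lebesgue_on Om) (\<lambda>x. cmod (v x) ^ 6)"
    "(LINT x|lebesgue_on Om. cmod (v x) ^ 6) \<le> (K6 * En v) ^ 6"
    using N(1) by (auto intro: Lp_norm_le_imp_integral_le)
qed

lemma measurable_D_Om:
  fixes X :: "real^'n::{finite,comm_ring_1} \<Rightarrow> complex"
  assumes "X \<in> borel_measurable (lebesgue_on D)" shows "X \<in> borel_measurable (lebesgue_on Om)"
proof -
  have "lebesgue_on Om = restrict_space (lebesgue_on D) Om"
    using Om_subset_D by (simp add: restrict_restrict_space inf.absorb2)
  then show ?thesis using assms by (simp add: measurable_restrict_space1)
qed

lemma H1_measurable: "H1 D v \<Longrightarrow> v \<in> borel_measurable (lebesgue_on D)"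
  by (rule in_L2_measurable[OF H1_in_L2])

lemma kerr_weight_measurable: "kerr_weight \<in> borel_measurable (lebesgue_on D)"
proof -
  have "indicat_real \<Omega>\<^sub>0 \<in> borel_measurable (lebesgue_on D)"
    using Omega0(1) by (intro measurable_restrict_space1 borel_measurable_indicator) auto
  then show ?thesis unfolding kerr_weight_def[abs_def] by measurable
qed

lemma kerr_weight_L2:
  assumes X: "X \<in> borel_measurable (lebesgue_on D)" and w: "integrable (lebesgue_on Om) w" "\<And>x. 0 \<le> w x"
    and le: "AE x in lebesgue_on D. x \<in> \<Omega>\<^sub>0 \<longrightarrow> (cmod (X x))\<^sup>2 \<le> w x"
  shows "in_Lp 2 D (\<lambda>x. kerr_weight x * X x)"
    "(Lp_norm 2 D (\<lambda>x. kerr_weight x * X x))\<^sup>2 \<le> (k\<^sup>2 * \<epsilon>)\<^sup>2 * (LINT x|lebesgue_on Om. w x)"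
proof -
  have m: "(\<lambda>x. kerr_weight x * X x) \<in> borel_measurable (lebesgue_on D)"
    using kerr_weight_measurable X by measurable
  have int: "integrable (lebesgue_on D) (\<lambda>x. (k\<^sup>2 * \<epsilon>)\<^sup>2 * (indicat_real Om x * w x))"
    using w(1) unfolding integral_D_Om(2)[symmetric] by (rule integrable_mult_right)
  have AE: "AE x in lebesgue_on D. (cmod (kerr_weight x * X x))\<^sup>2 \<le> (k\<^sup>2 * \<epsilon>)\<^sup>2 * (indicat_real Om x * w x)"
    using le
  proof eventually_elim
    fix x assume le: "x \<in> \<Omega>\<^sub>0 \<longrightarrow> (cmod (X x))\<^sup>2 \<le> w x"
    show "(cmod (kerr_weight x * X x))\<^sup>2 \<le> (k\<^sup>2 * \<epsilon>)\<^sup>2 * (indicat_real Om x * w x)"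
    proof (cases "x \<in> \<Omega>\<^sub>0")
      case True
      then have "x \<in> Om" using Omega0(3) by blast
      have "kerr_weight x = of_real (k\<^sup>2 * \<epsilon>)" using True by (simp add: kerr_weight_def)
      then have "cmod (kerr_weight x) = k\<^sup>2 * \<epsilon>" using eps by (simp only: norm_of_real) simp
      then have "(cmod (kerr_weight x * X x))\<^sup>2 = (k\<^sup>2 * \<epsilon>)\<^sup>2 * (cmod (X x))\<^sup>2"
        by (simp only: norm_mult power_mult_distrib)
      also have "\<dots> \<le> (k\<^sup>2 * \<epsilon>)\<^sup>2 * w x"
        using le True by (intro mult_left_mono) auto
      finally show ?thesis using \<open>x \<in> Om\<close> by simp
    qed (use w(2) in \<open>simp add: kerr_weight_def\<close>)
  qed
  show in_L2: "in_Lp 2 D (\<lambda>x. kerr_weight x * X x)"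
    unfolding in_L2_iff
  proof (intro conjI m Bochner_Integration.integrable_bound[OF int])
    show "(\<lambda>x. (cmod (kerr_weight x * X x))\<^sup>2) \<in> borel_measurable (lebesgue_on D)"
      using m by measurable
    show "AE x in lebesgue_on D. norm ((cmod (kerr_weight x * X x))\<^sup>2)
        \<le> norm ((k\<^sup>2 * \<epsilon>)\<^sup>2 * (indicat_real Om x * w x))"
      using AE by eventually_elim (simp add: order_trans[OF _ abs_ge_self])
  qed
  have "(Lp_norm 2 D (\<lambda>x. kerr_weight x * X x))\<^sup>2 \<le> (LINT x|lebesgue_on D. (k\<^sup>2 * \<epsilon>)\<^sup>2 * (indicat_real Om x * w x))"
    unfolding L2_norm_squared using in_L2 by (intro integral_mono_AE int AE) (simp add: in_L2_iff)
  also have "\<dots> = (k\<^sup>2 * \<epsilon>)\<^sup>2 * (LINT x|lebesgue_on Om. w x)"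
    unfolding integral_D_Om(1)[symmetric] by simp
  finally show "(Lp_norm 2 D (\<lambda>x. kerr_weight x * X x))\<^sup>2 \<le> (k\<^sup>2 * \<epsilon>)\<^sup>2 * (LINT x|lebesgue_on Om. w x)" .
qed

lemma kerr_weight_norm_le:
  assumes X: "X \<in> borel_measurable (lebesgue_on D)"
    and p: "integrable (lebesgue_on Om) (\<lambda>x. (p x)\<^sup>2)" "(LINT x|lebesgue_on Om. (p x)\<^sup>2) \<le> B\<^sup>2"
    and nonneg: "0 \<le> B" "0 \<le> c"
    and le: "AE x in lebesgue_on D. x \<in> \<Omega>\<^sub>0 \<longrightarrow> cmod (X x) \<le> c * p x"
  shows "Lp_norm 2 D (\<lambda>x. kerr_weight x * X x) \<le> k\<^sup>2 * \<epsilon> * (c * B)"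
proof -
  have "(Lp_norm 2 D (\<lambda>x. kerr_weight x * X x))\<^sup>2 \<le> (k\<^sup>2 * \<epsilon>)\<^sup>2 * (LINT x|lebesgue_on Om. c\<^sup>2 * (p x)\<^sup>2)"
  proof (rule kerr_weight_L2(2)[OF X])
    show "AE x in lebesgue_on D. x \<in> \<Omega>\<^sub>0 \<longrightarrow> (cmod (X x))\<^sup>2 \<le> c\<^sup>2 * (p x)\<^sup>2"
      using le unfolding power_mult_distrib[symmetric] by eventually_elim (auto intro: power_mono)
  qed (use p in auto)
  also have "\<dots> = (k\<^sup>2 * \<epsilon>)\<^sup>2 * (c\<^sup>2 * (LINT x|lebesgue_on Om. (p x)\<^sup>2))" by simp
  also have "\<dots> \<le> (k\<^sup>2 * \<epsilon>)\<^sup>2 * (c\<^sup>2 * B\<^sup>2)"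
    by (intro mult_left_mono p(2)) auto
  also have "\<dots> = (k\<^sup>2 * \<epsilon> * (c * B))\<^sup>2" by (simp only: power_mult_distrib)
  finally show ?thesis
    by (rule power2_le_imp_le) (use nonneg eps in auto)
qed

lemma H1_norm_measurable: "H1 D v \<Longrightarrow> (\<lambda>x. cmod (v x)) \<in> borel_measurable (lebesgue_on Om)"
  using measurable_D_Om[OF H1_measurable] by measurable

lemma cubic_bound_4:
  assumes X: "X \<in> borel_measurable (lebesgue_on D)" and e: "H1 D e" and w: "H1 D w" and c: "0 \<le> c"
    and le: "AE x in lebesgue_on D. x \<in> \<Omega>\<^sub>0 \<longrightarrow> cmod (X x) \<le> c * (cmod (e x) * cmod (w x))"
  shows "Lp_norm 2 D (\<lambda>x. kerr_weight x * X x) \<le> k\<^sup>2 * \<epsilon> * (c * (K4 * En e * (K4 * En w)))"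
proof -
  have E: "0 \<le> K4 * En e" "0 \<le> K4 * En w" using energy_lower_bound(2) e w K_nonneg by auto
  note P = integral_product_exponent_4[OF H1_norm_measurable[OF e] _ H1_fourth_power[OF e] _
      H1_norm_measurable[OF w] _ H1_fourth_power[OF w]]
  show ?thesis by (rule kerr_weight_norm_le[OF X P _ c le]) (use E in auto)
qed

lemma cubic_bound_6:
  assumes X: "X \<in> borel_measurable (lebesgue_on D)" and e: "H1 D e" and w: "H1 D w" and c: "0 \<le> c"
    and le: "\<And>x. cmod (X x) \<le> c * ((cmod (e x))\<^sup>2 * cmod (w x))"
  shows "Lp_norm 2 D (\<lambda>x. kerr_weight x * X x) \<le> k\<^sup>2 * \<epsilon> * (c * ((K6 * En e)\<^sup>2 * (K6 * En w)))"
proof -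
  have E: "0 \<le> K6 * En e" "0 \<le> K6 * En w" using energy_lower_bound(2) e w K_nonneg by auto
  note P = integral_product_exponent_6[OF H1_norm_measurable[OF e] _ H1_sixth_power[OF e] _
      H1_norm_measurable[OF w] _ H1_sixth_power[OF w]]
  show ?thesis by (rule kerr_weight_norm_le[OF X P _ c]) (use E le in auto)
qed

text \<open>
  Products of three functions of this class are square integrable on the Kerr medium.  It contains
  all total fields with scattered part in \<open>H1\<close>, which makes every integral in the weak formulations converge, even if the
  total fields are unbounded.
\<close>

definition sextic :: "(real^'n::{finite,comm_ring_1} \<Rightarrow> complex) \<Rightarrow> bool" where
  "sextic X \<longleftrightarrow> X \<in> borel_measurable (lebesgue_on D) \<and> integrable (lebesgue_on Om) (\<lambda>x. cmod (X x) ^ 6)"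

lemma sextic_measurable: "sextic X \<Longrightarrow> X \<in> borel_measurable (lebesgue_on D)"
  by (simp add: sextic_def)

lemma sextic_H1: "H1 D v \<Longrightarrow> sextic v"
  by (simp add: sextic_def H1_measurable H1_sixth_power)

lemma sextic_cnj: "sextic X \<Longrightarrow> sextic (\<lambda>x. cnj (X x))"
  by (simp add: sextic_def cnj_measurable)

lemma sextic_uinc: "sextic uinc"
proof -
  obtain B where B: "\<And>x. cmod (uinc x) \<le> B" using uinc(2) by (auto simp: bounded_iff)
  have "integrable (lebesgue_on Om) (\<lambda>x. cmod (uinc x) ^ 6)"
  proof (rule Bochner_Integration.integrable_bound[where f="\<lambda>x. B ^ 6"])
    show "integrable (lebesgue_on Om) (\<lambda>x. B ^ 6)"
      by (rule finite_measure.integrable_const[OF finite_measure_lebesgue_on]) simp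
    show "(\<lambda>x. cmod (uinc x) ^ 6) \<in> borel_measurable (lebesgue_on Om)"
      using measurable_D_Om[OF uinc(1)] by measurable
    show "AE x in lebesgue_on Om. norm (cmod (uinc x) ^ 6) \<le> norm (B ^ 6)"
    proof (intro AE_I2)
      fix x
      have "cmod (uinc x) ^ 6 \<le> B ^ 6" by (intro power_mono B) simp
      then show "norm (cmod (uinc x) ^ 6) \<le> norm (B ^ 6)" by simp
    qed
  qed
  then show ?thesis using uinc(1) by (simp add: sextic_def)
qed

lemma sextic_add:
  assumes "sextic X" "sextic Y" shows "sextic (\<lambda>x. X x + Y x)"
proof -
  have m: "X \<in> borel_measurable (lebesgue_on D)" "Y \<in> borel_measurable (lebesgue_on D)"
    using assms by (auto simp: sextic_def)
  have "integrable (lebesgue_on Om) (\<lambda>x. cmod (X x + Y x) ^ 6)"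
  proof (rule Bochner_Integration.integrable_bound[where f="\<lambda>x. 64 * (cmod (X x) ^ 6 + cmod (Y x) ^ 6)"])
    show "integrable (lebesgue_on Om) (\<lambda>x. 64 * (cmod (X x) ^ 6 + cmod (Y x) ^ 6))"
      using assms by (simp add: sextic_def)
    show "(\<lambda>x. cmod (X x + Y x) ^ 6) \<in> borel_measurable (lebesgue_on Om)"
      using m[THEN measurable_D_Om] by measurable
    show "AE x in lebesgue_on Om. norm (cmod (X x + Y x) ^ 6) \<le> norm (64 * (cmod (X x) ^ 6 + cmod (Y x) ^ 6))"
    proof (intro AE_I2)
      fix x
      let ?m = "max (cmod (X x)) (cmod (Y x))"
      have "cmod (X x + Y x) \<le> 2 * ?m"
        using norm_triangle_ineq[of "X x" "Y x"] by linarith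
      then have "cmod (X x + Y x) ^ 6 \<le> (2 * ?m) ^ 6" by (intro power_mono) auto
      also have "\<dots> = 64 * ?m ^ 6" by (simp add: power_mult_distrib)
      also have "\<dots> \<le> 64 * (cmod (X x) ^ 6 + cmod (Y x) ^ 6)"
        by (intro mult_left_mono) (auto simp: max_def)
      finally show "norm (cmod (X x + Y x) ^ 6) \<le> norm (64 * (cmod (X x) ^ 6 + cmod (Y x) ^ 6))" by simp
    qed
  qed
  moreover have "(\<lambda>x. X x + Y x) \<in> borel_measurable (lebesgue_on D)" using m by measurable
  ultimately show ?thesis by (simp add: sextic_def)
qed

lemma in_L2_triple_product:
  assumes "sextic X" "sextic Y" "sextic Z"
  shows "in_Lp 2 D (\<lambda>x. kerr_weight x * (X x * Y x * Z x))"
proof (rule kerr_weight_L2(1))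
  show "(\<lambda>x. X x * Y x * Z x) \<in> borel_measurable (lebesgue_on D)"
    using assms[THEN sextic_measurable] by measurable
  show "integrable (lebesgue_on Om) (\<lambda>x. cmod (X x) ^ 6 + cmod (Y x) ^ 6 + cmod (Z x) ^ 6)"
    using assms by (simp add: sextic_def)
  show "AE x in lebesgue_on D. x \<in> \<Omega>\<^sub>0 \<longrightarrow>
      (cmod (X x * Y x * Z x))\<^sup>2 \<le> cmod (X x) ^ 6 + cmod (Y x) ^ 6 + cmod (Z x) ^ 6"
  proof (intro AE_I2 impI)
    fix x
    let ?m = "max (cmod (X x)) (max (cmod (Y x)) (cmod (Z x)))"
    have "cmod (X x * Y x * Z x) \<le> ?m * ?m * ?m"
      unfolding norm_mult by (intro mult_mono) (auto simp: le_max_iff_disj)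
    then have "(cmod (X x * Y x * Z x))\<^sup>2 \<le> (?m * ?m * ?m)\<^sup>2" by (intro power_mono) auto
    also have "\<dots> = ?m ^ 6" by (simp add: power_mult_distrib flip: power_add)
    also have "\<dots> \<le> cmod (X x) ^ 6 + cmod (Y x) ^ 6 + cmod (Z x) ^ 6" by (auto simp: max_def)
    finally show "(cmod (X x * Y x * Z x))\<^sup>2 \<le> cmod (X x) ^ 6 + cmod (Y x) ^ 6 + cmod (Z x) ^ 6" .
  qed
qed auto

lemma kerr_lin_in_L2:
  assumes V: "sextic V" and w: "sextic w"
  shows "in_Lp 2 D (\<lambda>x. kerr_weight x * kerr_lin (V x) (w x))"
proof -
  have "in_Lp 2 D (\<lambda>x. kerr_weight x * (V x * cnj (V x) * w x) + kerr_weight x * (V x * cnj (V x) * w x)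
      + kerr_weight x * (V x * V x * cnj (w x)))"
    by (intro in_L2_add in_L2_triple_product V sextic_cnj w)
  also have "(\<lambda>x. kerr_weight x * (V x * cnj (V x) * w x) + kerr_weight x * (V x * cnj (V x) * w x)
      + kerr_weight x * (V x * V x * cnj (w x))) = (\<lambda>x. kerr_weight x * kerr_lin (V x) (w x))"
    by (simp add: kerr_lin_def power2_eq_square algebra_simps fun_eq_iff)
  finally show ?thesis .
qed

lemma us_H10: "H10 D us"
  using us by (simp add: kerr_solution_def pml_solution_def)

lemma H10_H1: "H10 D v \<Longrightarrow> H1 D v"
  by (simp add: H10_def)

lemma sextic_total: "H1 D v \<Longrightarrow> sextic (\<lambda>x. v x + uinc x)"
  by (intro sextic_add sextic_H1 sextic_uinc)

text \<open>
  The difference between the linearizations at the total field of the iterate with error \<open>e\<close> and at the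
  exact one.
\<close>

definition perturbation where
  "perturbation e w x = kerr_weight x * kerr_lin (U x + e x) (w x) - kerr_weight x * kerr_lin (U x) (w x)"

text \<open>
  With \<open>V = U + e\<close>, this is the Kerr weight times \<open>|V|\<^sup>2 V - |U|\<^sup>2 U - kerr_lin V e\<close>, written
  in terms of \<open>U\<close> and \<open>e\<close>.
\<close>

definition residual where
  "residual e x = kerr_weight x * (- (2 * U x * (e x * cnj (e x)) + (e x)\<^sup>2 * cnj (U x)) - 2 * e x * (e x * cnj (e x)))"

lemma sextic_U: "sextic U"
  by (rule sextic_total[OF H10_H1[OF us_H10]])

lemma perturbation_in_L2:
  assumes "H1 D e" "H1 D w" shows "in_Lp 2 D (perturbation e w)"
  unfolding perturbation_def[abs_def]
  by (intro in_L2_diff kerr_lin_in_L2 sextic_add sextic_H1 sextic_uinc H10_H1[OF us_H10] assms)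

lemma residual_split:
  "residual e x = kerr_weight x * (- (2 * U x * (e x * cnj (e x)) + (e x)\<^sup>2 * cnj (U x)))
     + kerr_weight x * (- (2 * e x * (e x * cnj (e x))))"
  by (simp add: residual_def algebra_simps)

lemma residual_parts_in_L2:
  assumes "H1 D e"
  shows "in_Lp 2 D (\<lambda>x. kerr_weight x * (- (2 * U x * (e x * cnj (e x)) + (e x)\<^sup>2 * cnj (U x))))"
    "in_Lp 2 D (\<lambda>x. kerr_weight x * (- (2 * e x * (e x * cnj (e x)))))"
proof -
  note e = sextic_H1[OF assms]
  have "in_Lp 2 D (\<lambda>x. (- 2) * (kerr_weight x * (U x * e x * cnj (e x))) + (- 1) * (kerr_weight x * (e x * e x * cnj (U x))))"
    by (intro in_L2_add in_L2_cmult in_L2_triple_product sextic_cnj sextic_U e)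
  also have "(\<lambda>x. (- 2) * (kerr_weight x * (U x * e x * cnj (e x))) + (- 1) * (kerr_weight x * (e x * e x * cnj (U x))))
      = (\<lambda>x. kerr_weight x * (- (2 * U x * (e x * cnj (e x)) + (e x)\<^sup>2 * cnj (U x))))"
    by (simp add: power2_eq_square algebra_simps fun_eq_iff)
  finally show "in_Lp 2 D (\<lambda>x. kerr_weight x * (- (2 * U x * (e x * cnj (e x)) + (e x)\<^sup>2 * cnj (U x))))" .
  have "in_Lp 2 D (\<lambda>x. (- 2) * (kerr_weight x * (e x * e x * cnj (e x))))"
    by (intro in_L2_cmult in_L2_triple_product sextic_cnj e)
  also have "(\<lambda>x. (- 2) * (kerr_weight x * (e x * e x * cnj (e x)))) = (\<lambda>x. kerr_weight x * (- (2 * e x * (e x * cnj (e x)))))"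
    by (simp add: algebra_simps fun_eq_iff)
  finally show "in_Lp 2 D (\<lambda>x. kerr_weight x * (- (2 * e x * (e x * cnj (e x)))))" .
qed

lemma residual_in_L2: "H1 D e \<Longrightarrow> in_Lp 2 D (residual e)"
  unfolding residual_split[abs_def] by (intro in_L2_add residual_parts_in_L2)

lemma perturbation_diff:
  "perturbation e (\<lambda>x. w x - w' x) x = perturbation e w x - perturbation e w' x"
  by (simp add: perturbation_def kerr_lin_diff algebra_simps)

end

context kerr_newton
begin

section \<open>Newton's iteration\<close>

definition M :: ereal where "M = Linf_norm \<Omega>\<^sub>0 U"

abbreviation Nstar :: ereal where "Nstar \<equiv> newton_N CARD('n) k \<epsilon> Cs CN M"
abbreviation thetastar :: ereal where "thetastar \<equiv> newton_theta CARD('n) k \<epsilon> Cs CN M"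

lemma AE_field_le_M: "AE x in lebesgue. x \<in> \<Omega>\<^sub>0 \<longrightarrow> ereal (cmod (U x)) \<le> M"
proof -
  have "AE x in lebesgue_on \<Omega>\<^sub>0. ereal (cmod (U x)) \<le> M"
    unfolding M_def Linf_norm_def by (rule esssup_AE)
  then show ?thesis using Omega0(1) by (subst (asm) AE_restrict_space_iff) auto
qed

text \<open>
  On a null set the essential supremum would be \<open>- \<infinity>\<close>; a nonempty open set is not one.
\<close>

lemma M_nonneg: "0 \<le> M"
proof (rule ccontr)
  assume "\<not> 0 \<le> M"
  then have "M < 0" by simp
  from AE_field_le_M have "AE x in lebesgue. x \<notin> \<Omega>\<^sub>0"
  proof eventually_elim
    fix x assume "x \<in> \<Omega>\<^sub>0 \<longrightarrow> ereal (cmod (U x)) \<le> M"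
    moreover have "0 \<le> ereal (cmod (U x))" by simp
    ultimately show "x \<notin> \<Omega>\<^sub>0" using \<open>M < 0\<close> by (metis order_trans not_less)
  qed
  then have "\<Omega>\<^sub>0 \<in> null_sets lebesgue" using Omega0(1) by (subst (asm) AE_iff_null_sets[symmetric]) auto
  then show False using open_not_negligible[OF Omega0(1,2)] by (simp add: negligible_iff_null_sets)
qed

lemma AE_zero_L2_norm: 
  assumes "h \<in> borel_measurable (lebesgue_on D)" "AE x in lebesgue_on D. h x = 0"
  shows "Lp_norm 2 D h = 0"
  using L2_norm_cong_AE[OF assms(1) _ assms(2)] by (simp add: L2_norm_eq_sqrt)

text \<open>
  The coefficients 9 and 5 are 6 + 3 and 3 + 2, from the terms with and without a factor \<open>U\<close>.  The
  assumption on \<open>e\<close> trades one factor \<open>e\<close> of the terms without \<open>U\<close>, estimated with exponent 6, for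
  the bound \<open>m\<close> of \<open>U\<close> and the powers of \<open>k\<close> of exponent 4.
\<close>

lemma finite_field_bounds:
  assumes m: "M = ereal m" and e: "H1 D e" and small: "En e \<le> inverse CN * k powr (1 - real CARD('n) / 2) * m"
  shows "H1 D w \<Longrightarrow> Lp_norm 2 D (perturbation e w)
      \<le> 9 * \<epsilon> * CN\<^sup>2 * k powr (real CARD('n) / 2) * m * En e * En w"
    "Lp_norm 2 D (residual e) \<le> 5 * \<epsilon> * CN\<^sup>2 * k powr (real CARD('n) / 2) * m * (En e)\<^sup>2"
proof -
  define d where "d = real CARD('n)"
  define S where "S = CN\<^sup>2 * k powr (d / 2)"
  have m0: "0 \<le> m" using M_nonneg m by simp
  have E: "0 \<le> En e" using energy_lower_bound(2)[OF e] .
  have fld: "AE x in lebesgue_on D. x \<in> \<Omega>\<^sub>0 \<longrightarrow> cmod (U x) \<le> m"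
    using AE_field_le_M unfolding m by (subst AE_restrict_space_iff) (auto elim: eventually_mono)
  have kk: "k\<^sup>2 = k powr 2" using k by simp
  have S4: "k\<^sup>2 * K4\<^sup>2 = S"
  proof -
    have "(k powr (d / 4 - 1))\<^sup>2 = k powr (d / 2 - 2)"
      by (simp add: power2_eq_square powr_add[symmetric])
    then have "k\<^sup>2 * K4\<^sup>2 = CN\<^sup>2 * (k powr 2 * k powr (d / 2 - 2))"
      unfolding K4_def kk by (simp add: power_mult_distrib d_def)
    also have "k powr 2 * k powr (d / 2 - 2) = k powr (d / 2)" unfolding powr_add[symmetric] by simp
    finally show ?thesis by (simp add: S_def)
  qed
  have S6: "k\<^sup>2 * (K6 ^ 3 * En e) \<le> S * m"
  proof -
    have "k\<^sup>2 * K6 ^ 3 * En e \<le> k\<^sup>2 * K6 ^ 3 * (inverse CN * k powr (1 - d / 2) * m)"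
      using small K_nonneg by (intro mult_left_mono) (auto simp: d_def)
    also have "(k powr (d / 3 - 1)) ^ 3 = k powr (d - 3)"
      by (simp add: power3_eq_cube powr_add[symmetric])
    then have "k\<^sup>2 * K6 ^ 3 * (inverse CN * k powr (1 - d / 2) * m)
        = CN ^ 3 * inverse CN * (k powr 2 * k powr (d - 3) * k powr (1 - d / 2)) * m"
      unfolding K6_def kk by (simp add: power_mult_distrib d_def)
    also have "k powr 2 * k powr (d - 3) * k powr (1 - d / 2) = k powr (d / 2)"
      unfolding powr_add[symmetric] by simp
    also have "CN ^ 3 * inverse CN = CN\<^sup>2"
      using C_le_CN(5) by (simp add: power3_eq_cube power2_eq_square)
    finally show ?thesis by (simp add: S_def mult.assoc)
  qed
  have mUe: "U \<in> borel_measurable (lebesgue_on D)" "e \<in> borel_measurable (lebesgue_on D)"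
    using sextic_measurable[OF sextic_U] H1_measurable[OF e] by auto
  note mc = cnj_measurable[OF mUe(1)] cnj_measurable[OF mUe(2)]
  have S6': "k\<^sup>2 * \<epsilon> * (c * ((K6 * En e)\<^sup>2 * (K6 * t))) \<le> c * \<epsilon> * S * m * En e * t" if "0 \<le> c" "0 \<le> t" for c t
  proof -
    have "k\<^sup>2 * \<epsilon> * (c * ((K6 * En e)\<^sup>2 * (K6 * t))) = (c * \<epsilon> * En e * t) * (k\<^sup>2 * (K6 ^ 3 * En e))"
      by (simp add: power2_eq_square power3_eq_cube mult_ac)
    also have "\<dots> \<le> (c * \<epsilon> * En e * t) * (S * m)"
      using that eps E by (intro mult_left_mono S6) auto
    finally show ?thesis by (simp add: mult_ac)
  qed
  have S4': "k\<^sup>2 * \<epsilon> * (c * m * (K4 * En e * (K4 * t))) = c * \<epsilon> * S * m * En e * t" for c t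
    unfolding S4[symmetric] by (simp add: power2_eq_square mult_ac)
  show "Lp_norm 2 D (perturbation e w) \<le> 9 * \<epsilon> * CN\<^sup>2 * k powr (real CARD('n) / 2) * m * En e * En w"
    if w: "H1 D w"
  proof -
    have Ew: "0 \<le> En w" using energy_lower_bound(2)[OF w] .
    define X where "X x = 2 * (U x * cnj (e x) + cnj (U x) * e x) * w x + 2 * U x * e x * cnj (w x)" for x
    define Y where "Y x = 2 * (e x * cnj (e x)) * w x + (e x)\<^sup>2 * cnj (w x)" for x
    have split: "perturbation e w x = kerr_weight x * X x + kerr_weight x * Y x" for x
      by (simp add: perturbation_def kerr_lin_def X_def Y_def power2_eq_square algebra_simps)
    have mw: "w \<in> borel_measurable (lebesgue_on D)" using H1_measurable[OF w] .
    note mcw = cnj_measurable[OF mw]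
    have mX: "X \<in> borel_measurable (lebesgue_on D)" unfolding X_def[abs_def] using mUe mc mw mcw by measurable
    have mY: "Y \<in> borel_measurable (lebesgue_on D)" unfolding Y_def[abs_def] using mUe mc mw mcw by measurable
    have leY: "cmod (Y x) \<le> 3 * ((cmod (e x))\<^sup>2 * cmod (w x))" for x
    proof -
      have "cmod (Y x) \<le> cmod (2 * (e x * cnj (e x)) * w x) + cmod ((e x)\<^sup>2 * cnj (w x))"
        unfolding Y_def by (rule norm_triangle_ineq)
      also have "\<dots> = 3 * ((cmod (e x))\<^sup>2 * cmod (w x))"
        by (simp add: norm_mult norm_power power2_eq_square)
      finally show ?thesis .
    qed
    have leX: "AE x in lebesgue_on D. x \<in> \<Omega>\<^sub>0 \<longrightarrow> cmod (X x) \<le> 6 * m * (cmod (e x) * cmod (w x))"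
      using fld
    proof (eventually_elim, intro impI)
      fix x assume "x \<in> \<Omega>\<^sub>0 \<longrightarrow> cmod (U x) \<le> m" "x \<in> \<Omega>\<^sub>0"
      then have Um: "cmod (U x) \<le> m" by simp
      have "cmod (X x) \<le> cmod (2 * (U x * cnj (e x) + cnj (U x) * e x) * w x) + cmod (2 * U x * e x * cnj (w x))"
        unfolding X_def by (rule norm_triangle_ineq)
      also have "cmod (U x * cnj (e x) + cnj (U x) * e x) \<le> cmod (U x * cnj (e x)) + cmod (cnj (U x) * e x)"
        by (rule norm_triangle_ineq)
      then have "cmod (2 * (U x * cnj (e x) + cnj (U x) * e x) * w x) \<le> 4 * cmod (U x) * cmod (e x) * cmod (w x)"
        unfolding norm_mult complex_mod_cnj
        by (intro mult_right_mono) auto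
      also have "cmod (2 * U x * e x * cnj (w x)) = 2 * cmod (U x) * cmod (e x) * cmod (w x)"
        unfolding norm_mult complex_mod_cnj by simp
      also have "4 * cmod (U x) * cmod (e x) * cmod (w x) + 2 * cmod (U x) * cmod (e x) * cmod (w x)
          = 6 * cmod (U x) * (cmod (e x) * cmod (w x))" by simp
      also have "\<dots> \<le> 6 * m * (cmod (e x) * cmod (w x))"
        using Um by (intro mult_right_mono mult_left_mono) auto
      finally show "cmod (X x) \<le> 6 * m * (cmod (e x) * cmod (w x))" by simp
    qed
    have L2X: "in_Lp 2 D (\<lambda>x. kerr_weight x * X x)"
    proof -
      have "in_Lp 2 D (\<lambda>x. 2 * (kerr_weight x * (U x * cnj (e x) * w x)) + 2 * (kerr_weight x * (cnj (U x) * e x * w x))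
          + 2 * (kerr_weight x * (U x * e x * cnj (w x))))"
        by (intro in_L2_add in_L2_cmult in_L2_triple_product sextic_cnj sextic_U sextic_H1 e w)
      also have "(\<lambda>x. 2 * (kerr_weight x * (U x * cnj (e x) * w x)) + 2 * (kerr_weight x * (cnj (U x) * e x * w x))
          + 2 * (kerr_weight x * (U x * e x * cnj (w x)))) = (\<lambda>x. kerr_weight x * X x)"
        by (simp add: X_def algebra_simps fun_eq_iff)
      finally show ?thesis .
    qed
    have L2Y: "in_Lp 2 D (\<lambda>x. kerr_weight x * Y x)"
      using kerr_lin_in_L2[OF sextic_H1[OF e] sextic_H1[OF w]] by (simp add: Y_def kerr_lin_def)
    have "Lp_norm 2 D (perturbation e w) \<le> Lp_norm 2 D (\<lambda>x. kerr_weight x * X x) + Lp_norm 2 D (\<lambda>x. kerr_weight x * Y x)"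
      unfolding split[abs_def] by (rule L2_norm_add_le[OF L2X L2Y])
    also have "Lp_norm 2 D (\<lambda>x. kerr_weight x * X x) \<le> k\<^sup>2 * \<epsilon> * (6 * m * (K4 * En e * (K4 * En w)))"
      by (rule cubic_bound_4[OF mX e w _ leX]) (use m0 in simp)
    also have "\<dots> = 6 * \<epsilon> * S * m * En e * En w" by (rule S4')
    also have "Lp_norm 2 D (\<lambda>x. kerr_weight x * Y x) \<le> k\<^sup>2 * \<epsilon> * (3 * ((K6 * En e)\<^sup>2 * (K6 * En w)))"
      by (rule cubic_bound_6[OF mY e w _ leY]) simp
    also have "\<dots> \<le> 3 * \<epsilon> * S * m * En e * En w" by (rule S6'[OF _ Ew]) simp
    finally show ?thesis by (simp add: S_def d_def mult_ac)
  qed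
  show "Lp_norm 2 D (residual e) \<le> 5 * \<epsilon> * CN\<^sup>2 * k powr (real CARD('n) / 2) * m * (En e)\<^sup>2"
  proof -
    let ?X = "\<lambda>x. - (2 * U x * (e x * cnj (e x)) + (e x)\<^sup>2 * cnj (U x))"
    let ?Y = "\<lambda>x. - (2 * e x * (e x * cnj (e x)))"
    have mX: "?X \<in> borel_measurable (lebesgue_on D)" using mUe mc by measurable
    have mY: "?Y \<in> borel_measurable (lebesgue_on D)" using mUe mc by measurable
    have leX: "AE x in lebesgue_on D. x \<in> \<Omega>\<^sub>0 \<longrightarrow> cmod (?X x) \<le> 3 * m * (cmod (e x) * cmod (e x))"
      using fld
    proof (eventually_elim, intro impI)
      fix x assume "x \<in> \<Omega>\<^sub>0 \<longrightarrow> cmod (U x) \<le> m" "x \<in> \<Omega>\<^sub>0"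
      then have Um: "cmod (U x) \<le> m" by simp
      have eq: "cmod (2 * V * (z * cnj z)) + cmod (z\<^sup>2 * cnj V) = 3 * cmod V * (cmod z * cmod z)" for V z
        by (simp add: norm_mult norm_power power2_eq_square)
      have "cmod (?X x) \<le> cmod (2 * U x * (e x * cnj (e x))) + cmod ((e x)\<^sup>2 * cnj (U x))"
        unfolding norm_minus_cancel by (rule norm_triangle_ineq)
      also have "\<dots> = 3 * cmod (U x) * (cmod (e x) * cmod (e x))"
        by (rule eq)
      also have "\<dots> \<le> 3 * m * (cmod (e x) * cmod (e x))"
        using Um by (intro mult_right_mono mult_left_mono) auto
      finally show "cmod (?X x) \<le> 3 * m * (cmod (e x) * cmod (e x))" .
    qed
    have leY: "cmod (?Y x) \<le> 2 * ((cmod (e x))\<^sup>2 * cmod (e x))" for x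
      by (simp add: norm_mult power2_eq_square)
    have "Lp_norm 2 D (residual e) \<le> Lp_norm 2 D (\<lambda>x. kerr_weight x * ?X x) + Lp_norm 2 D (\<lambda>x. kerr_weight x * ?Y x)"
      unfolding residual_split[abs_def] by (rule L2_norm_add_le[OF residual_parts_in_L2[OF e]])
    also have "Lp_norm 2 D (\<lambda>x. kerr_weight x * ?X x) \<le> k\<^sup>2 * \<epsilon> * (3 * m * (K4 * En e * (K4 * En e)))"
      by (rule cubic_bound_4[OF mX e e _ leX]) (use m0 in simp)
    also have "\<dots> = 3 * \<epsilon> * S * m * En e * En e" by (rule S4')
    also have "Lp_norm 2 D (\<lambda>x. kerr_weight x * ?Y x) \<le> k\<^sup>2 * \<epsilon> * (2 * ((K6 * En e)\<^sup>2 * (K6 * En e)))"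
      by (rule cubic_bound_6[OF mY e e _ leY]) simp
    also have "\<dots> \<le> 2 * \<epsilon> * S * m * En e * En e" by (rule S6'[OF _ E]) simp
    finally show ?thesis by (simp add: S_def d_def power2_eq_square mult_ac)
  qed
qed

text \<open>
  The number \<open>\<nu>\<close> is the product of \<open>N*\<close> and the energy of \<open>e\<close>, read as 0 for an unbounded field;
  the factors \<open>3/5\<close> and \<open>1/3\<close> are \<open>9/15\<close> and \<open>5/15\<close>, with the 15 of the definition of
  \<open>N*\<close>.
\<close>

lemma contraction_factor:
  assumes e: "H1 D e" and small: "ereal (En e) \<le> thetastar"
  obtains \<nu> :: real where "0 \<le> \<nu>" "\<nu> \<le> 1"
    "\<And>w. H1 D w \<Longrightarrow> Cs * Lp_norm 2 D (perturbation e w) \<le> 3 / 5 * \<nu> * En w"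
    "Cs * Lp_norm 2 D (residual e) \<le> 1 / 3 * \<nu> * En e"
    "ereal (\<nu> * En e) \<le> Nstar * ereal ((En e)\<^sup>2)"
proof (cases "M = \<infinity>")
  case True
  define c where "c = 15 * Cs * CN\<^sup>2 * k powr (real CARD('n) / 2) * \<epsilon>"
  have "0 < c" using Cs C_le_CN(5) k eps by (simp add: c_def)
  moreover have "Nstar = ereal c * \<infinity>" by (simp only: newton_N_def True c_def)
  ultimately have "Nstar = \<infinity>" by simp
  then have "thetastar \<le> 0" by (simp add: newton_theta_def)
  with small have "ereal (En e) \<le> 0" by (rule order_trans)
  then have E0: "En e = 0" using energy_lower_bound(2)[OF e] by simp
  have e0: "AE x in lebesgue_on D. e x = 0" using energy_zero_AE[OF e] E0 by simp
  show thesis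
  proof (rule that[of 0])
    show "Cs * Lp_norm 2 D (perturbation e w) \<le> 3 / 5 * 0 * En w" if w: "H1 D w" for w
    proof -
      have "AE x in lebesgue_on D. perturbation e w x = 0"
        using e0 by eventually_elim (simp add: perturbation_def)
      then show ?thesis
        using AE_zero_L2_norm[OF in_L2_measurable[OF perturbation_in_L2[OF e w]]] by simp
    qed
    have "AE x in lebesgue_on D. residual e x = 0"
      using e0 by eventually_elim (simp add: residual_def)
    then show "Cs * Lp_norm 2 D (residual e) \<le> 1 / 3 * 0 * En e"
      using AE_zero_L2_norm[OF in_L2_measurable[OF residual_in_L2[OF e]]] by simp
  qed (use E0 in \<open>simp_all flip: zero_ereal_def\<close>)
next
  case False
  then obtain m where m: "M = ereal m" using M_nonneg by (cases M) auto
  have m0: "0 \<le> m" using M_nonneg m by simp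
  have E: "0 \<le> En e" using energy_lower_bound(2)[OF e] .
  define n where "n = 15 * Cs * CN\<^sup>2 * k powr (real CARD('n) / 2) * \<epsilon> * m"
  have n: "0 \<le> n" using Cs eps m0 by (simp add: n_def)
  have Nstar: "Nstar = ereal n" by (simp add: newton_N_def m n_def)
  have "ereal (En e) \<le> inverse Nstar" "ereal (En e) \<le> ereal (inverse CN * k powr (1 - real CARD('n) / 2)) * M"
    using small by (auto simp: newton_theta_def)
  then have s: "ereal (En e) \<le> inverse (ereal n)" "En e \<le> inverse CN * k powr (1 - real CARD('n) / 2) * m"
    by (simp_all only: Nstar) (simp add: m)
  note B = finite_field_bounds[OF m e s(2)]
  show thesis
  proof (rule that[of "n * En e"])
    show "n * En e \<le> 1"
    proof (cases "n = 0")
      case False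
      then have "En e \<le> inverse n" using s(1) n by simp
      then have "n * En e \<le> n * inverse n" using n by (rule mult_left_mono)
      then show ?thesis using False by simp
    qed simp
    show "Cs * Lp_norm 2 D (perturbation e w) \<le> 3 / 5 * (n * En e) * En w" if w: "H1 D w" for w
    proof -
      have "Cs * Lp_norm 2 D (perturbation e w)
          \<le> Cs * (9 * \<epsilon> * CN\<^sup>2 * k powr (real CARD('n) / 2) * m * En e * En w)"
        using B(1)[OF w] Cs by (intro mult_left_mono) auto
      also have "\<dots> = 3 / 5 * (n * En e) * En w" by (simp add: n_def)
      finally show ?thesis .
    qed
    have "Cs * Lp_norm 2 D (residual e)
        \<le> Cs * (5 * \<epsilon> * CN\<^sup>2 * k powr (real CARD('n) / 2) * m * (En e)\<^sup>2)"
      using B(2) Cs by (intro mult_left_mono) auto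
    also have "\<dots> = 1 / 3 * (n * En e) * En e" by (simp add: n_def power2_eq_square)
    finally show "Cs * Lp_norm 2 D (residual e) \<le> 1 / 3 * (n * En e) * En e" .
    show "ereal (n * En e * En e) \<le> Nstar * ereal ((En e)\<^sup>2)"
      by (simp add: Nstar power2_eq_square)
  qed (use n E in simp)
qed

text \<open>
  The right-hand side of the Newton step from the iterate \<open>v\<close>; the sum \<open>v + uinc\<close> is its total field.
\<close>

definition newton_data where
  "newton_data v x = f x - kerr_weight x * (2 * ((v x + uinc x) * cnj (v x + uinc x)) * v x - (v x + uinc x)\<^sup>2 * cnj (uinc x))"

abbreviation step_solution where
  "step_solution v w \<equiv> solves (\<lambda>x. newton_data v x + kerr_weight x * kerr_lin (v x + uinc x) (w x)) w"

lemma linearized_solution_iff: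
  "linearized_solution R Rh \<sigma>\<^sub>0 k \<epsilon> \<Omega>\<^sub>0 V g w
    \<longleftrightarrow> solves (\<lambda>x. g x + kerr_weight x * kerr_lin (V x) (w x)) w"
  unfolding linearized_solution_def kerr_weight_def kerr_lin_def complex_norm_square ..

abbreviation newton where "newton \<equiv> newton_sequence R Rh \<sigma>\<^sub>0 k \<epsilon> \<Omega>\<^sub>0 uinc f"

lemma newton_sequence_iff:
  "newton u0 u \<longleftrightarrow> u 0 = u0 \<and> (\<forall>l. step_solution (u l) (u (Suc l)))"
  unfolding newton_sequence_def linearized_solution_iff newton_data_def kerr_weight_def complex_norm_square ..

lemma newton_data_in_L2:
  assumes v: "H1 D v" shows "in_Lp 2 D (newton_data v)"
proof -
  note s = sextic_total[OF v] sextic_cnj[OF sextic_total[OF v]] sextic_H1[OF v] sextic_cnj[OF sextic_uinc]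
  have "in_Lp 2 D (\<lambda>x. f x - (2 * (kerr_weight x * ((v x + uinc x) * cnj (v x + uinc x) * v x))
      - kerr_weight x * ((v x + uinc x) * (v x + uinc x) * cnj (uinc x))))"
    by (intro in_L2_diff in_L2_cmult in_L2_triple_product f s)
  also have "(\<lambda>x. f x - (2 * (kerr_weight x * ((v x + uinc x) * cnj (v x + uinc x) * v x))
      - kerr_weight x * ((v x + uinc x) * (v x + uinc x) * cnj (uinc x)))) = newton_data v"
    by (simp add: newton_data_def fun_eq_iff power2_eq_square algebra_simps)
  finally show ?thesis .
qed

lemma us_solution:
  "solves (\<lambda>x. f x + kerr_weight x * (U x * cnj (U x) * U x)) us"
proof -
  have "of_real (k\<^sup>2 * \<epsilon> * indicat_real \<Omega>\<^sub>0 x * (cmod (U x))\<^sup>2) * U x = kerr_weight x * (U x * cnj (U x) * U x)" for x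
    unfolding kerr_weight_def complex_norm_square[symmetric] of_real_mult by (simp only: mult.assoc)
  then show ?thesis using us unfolding kerr_solution_def by (simp only:)
qed

lemma energy_stable:
  assumes g: "in_Lp 2 D g"
    and sol: "solves (\<lambda>x. g x + kerr_weight x * kerr_lin (U x) (w x)) w"
  shows "En w \<le> Cs * Lp_norm 2 D g"
  using stab[OF g] sol by (simp add: linearized_solution_iff)

text \<open>
  Subtracting the equation of the exact solution, the error \<open>e'\<close> of the new iterate solves the problem
  linearized at the exact solution with data \<open>residual e + perturbation e e'\<close>; the part with \<open>e'\<close> is
  absorbed into the left-hand side.
\<close>

lemma newton_step_error:
  assumes v: "H10 D v" and small: "ereal (En (\<lambda>x. v x - us x)) \<le> thetastar" and w: "step_solution v w"
  shows "H10 D w" "En (\<lambda>x. w x - us x) \<le> 5 / 6 * En (\<lambda>x. v x - us x)"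
    "ereal (En (\<lambda>x. w x - us x)) \<le> Nstar * ereal ((En (\<lambda>x. v x - us x))\<^sup>2)"
proof -
  define e where "e x = v x - us x" for x
  define e' where "e' x = w x - us x" for x
  show "H10 D w" using w by (simp add: pml_solution_def)
  then have H: "H1 D v" "H1 D w" "H1 D us" using v us_H10 by (auto intro: H10_H1)
  have eH: "H1 D e" "H1 D e'" unfolding e_def e'_def using H by (auto intro: H1_diff)
  have sm: "ereal (En e) \<le> thetastar" using small by (simp add: e_def[abs_def])
  obtain \<nu> where \<nu>: "0 \<le> \<nu>" "\<nu> \<le> 1"
    and P: "\<And>w. H1 D w \<Longrightarrow> Cs * Lp_norm 2 D (perturbation e w) \<le> 3 / 5 * \<nu> * En w"
    and r: "Cs * Lp_norm 2 D (residual e) \<le> 1 / 3 * \<nu> * En e"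
    and N: "ereal (\<nu> * En e) \<le> Nstar * ereal ((En e)\<^sup>2)"
    by (rule contraction_factor[OF eH(1) sm], rule that)
  have "in_Lp 2 D (\<lambda>x. newton_data v x + kerr_weight x * kerr_lin (v x + uinc x) (w x))"
    by (intro in_L2_add newton_data_in_L2 kerr_lin_in_L2 sextic_total sextic_H1 H)
  moreover have "in_Lp 2 D (\<lambda>x. f x + kerr_weight x * (U x * cnj (U x) * U x))"
    by (intro in_L2_add f in_L2_triple_product sextic_U sextic_cnj)
  ultimately have "solves (\<lambda>x. newton_data v x + kerr_weight x * kerr_lin (v x + uinc x) (w x)
      - (f x + kerr_weight x * (U x * cnj (U x) * U x))) (\<lambda>x. w x - us x)"
    using w us_solution by (intro pml_solution_diff)
  moreover have "newton_data v x + kerr_weight x * kerr_lin (v x + uinc x) (w x)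
      - (f x + kerr_weight x * (U x * cnj (U x) * U x))
    = (residual e x + perturbation e e' x) + kerr_weight x * kerr_lin (U x) (e' x)" for x
  proof -
    have vw: "v x = us x + e x" "w x = us x + e' x" by (simp_all add: e_def e'_def)
    show ?thesis
      unfolding newton_data_def residual_def perturbation_def kerr_lin_def vw
      by (simp add: algebra_simps power2_eq_square)
  qed
  ultimately have "solves
      (\<lambda>x. (residual e x + perturbation e e' x) + kerr_weight x * kerr_lin (U x) (e' x)) e'"
    by (simp add: e'_def[abs_def])
  then have "En e' \<le> Cs * Lp_norm 2 D (\<lambda>x. residual e x + perturbation e e' x)"
    by (rule energy_stable[rotated]) (intro in_L2_add residual_in_L2 perturbation_in_L2 eH)
  also have "\<dots> \<le> Cs * (Lp_norm 2 D (residual e) + Lp_norm 2 D (perturbation e e'))"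
    using Cs by (intro mult_left_mono L2_norm_add_le residual_in_L2 perturbation_in_L2 eH) auto
  also have "\<dots> \<le> 1 / 3 * \<nu> * En e + 3 / 5 * \<nu> * En e'"
    using r P[OF eH(2)] by (simp add: distrib_left)
  finally have *: "En e' \<le> 1 / 3 * \<nu> * En e + 3 / 5 * \<nu> * En e'" .
  have E: "0 \<le> En e" "0 \<le> En e'" using energy_lower_bound(2) eH by auto
  have "\<nu> * En e' \<le> 1 * En e'" using \<nu> E by (intro mult_right_mono) auto
  with * have le: "En e' \<le> 5 / 6 * (\<nu> * En e)" by simp
  have "\<nu> * En e \<le> 1 * En e" using \<nu> E by (intro mult_right_mono) auto
  with le show "En (\<lambda>x. w x - us x) \<le> 5 / 6 * En (\<lambda>x. v x - us x)"
    by (simp add: e_def[abs_def] e'_def[abs_def])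
  have "0 \<le> \<nu> * En e" using \<nu> E by simp
  then have "ereal (En e') \<le> ereal (\<nu> * En e)" using le by simp
  from order_trans[OF this N] show "ereal (En (\<lambda>x. w x - us x)) \<le> Nstar * ereal ((En (\<lambda>x. v x - us x))\<^sup>2)"
    by (simp add: e_def[abs_def] e'_def[abs_def])
qed

text \<open>
  The difference of two solutions solves the problem linearized at the exact solution, with its own
  perturbation as data, hence vanishes.  Iterates are determined only up to null sets, so the two
  steps start from iterates that agree almost everywhere.
\<close>

lemma newton_step_unique:
  assumes v: "H10 D v" "H10 D v'" and eq: "AE x in lebesgue_on D. v x = v' x"
    and small: "ereal (En (\<lambda>x. v x - us x)) \<le> thetastar"
    and w: "step_solution v w" "step_solution v' w'"
  shows "AE x in lebesgue_on D. w x = w' x"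
proof -
  define e where "e x = v x - us x" for x
  define z where "z x = w x - w' x" for x
  have H: "H1 D v" "H1 D v'" "H1 D w" "H1 D w'" "H1 D us"
    using v w us_H10 by (auto intro: H10_H1 simp: pml_solution_def)
  have eH: "H1 D e" "H1 D z" unfolding e_def z_def using H by (auto intro: H1_diff)
  have sm: "ereal (En e) \<le> thetastar" using small by (simp add: e_def[abs_def])
  obtain \<nu> where \<nu>: "0 \<le> \<nu>" "\<nu> \<le> 1"
    and P: "\<And>w. H1 D w \<Longrightarrow> Cs * Lp_norm 2 D (perturbation e w) \<le> 3 / 5 * \<nu> * En w"
    and "Cs * Lp_norm 2 D (residual e) \<le> 1 / 3 * \<nu> * En e"
    and "ereal (\<nu> * En e) \<le> Nstar * ereal ((En e)\<^sup>2)"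
    by (rule contraction_factor[OF eH(1) sm], rule that)
  have L2: "in_Lp 2 D (\<lambda>x. newton_data v x + kerr_weight x * kerr_lin (v x + uinc x) (w x))"
    "in_Lp 2 D (\<lambda>x. newton_data v' x + kerr_weight x * kerr_lin (v' x + uinc x) (w' x))"
    by (intro in_L2_add newton_data_in_L2 kerr_lin_in_L2 sextic_total sextic_H1 H)+
  have "solves (\<lambda>x. perturbation e z x + kerr_weight x * kerr_lin (U x) (z x)) z"
  proof (rule pml_solution_cong_AE)
    show "solves (\<lambda>x. newton_data v x + kerr_weight x * kerr_lin (v x + uinc x) (w x)
       - (newton_data v' x + kerr_weight x * kerr_lin (v' x + uinc x) (w' x))) z"
      unfolding z_def[abs_def] using w L2 by (intro pml_solution_diff)
    show "in_Lp 2 D (\<lambda>x. newton_data v x + kerr_weight x * kerr_lin (v x + uinc x) (w x)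
       - (newton_data v' x + kerr_weight x * kerr_lin (v' x + uinc x) (w' x)))"
      using L2 by (rule in_L2_diff)
    show "in_Lp 2 D (\<lambda>x. perturbation e z x + kerr_weight x * kerr_lin (U x) (z x))"
      by (intro in_L2_add perturbation_in_L2 kerr_lin_in_L2 sextic_U sextic_H1 eH)
    show "AE x in lebesgue_on D. newton_data v x + kerr_weight x * kerr_lin (v x + uinc x) (w x)
       - (newton_data v' x + kerr_weight x * kerr_lin (v' x + uinc x) (w' x))
       = perturbation e z x + kerr_weight x * kerr_lin (U x) (z x)"
      using eq
    proof eventually_elim
      fix x assume "v x = v' x"
      then have "newton_data v x = newton_data v' x" "v' x + uinc x = U x + e x" "v x + uinc x = U x + e x"
        by (simp_all add: newton_data_def e_def)
      show "newton_data v x + kerr_weight x * kerr_lin (v x + uinc x) (w x)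
         - (newton_data v' x + kerr_weight x * kerr_lin (v' x + uinc x) (w' x))
         = perturbation e z x + kerr_weight x * kerr_lin (U x) (z x)"
        unfolding \<open>newton_data v x = _\<close> \<open>v' x + uinc x = _\<close> \<open>v x + uinc x = _\<close>
        by (simp add: perturbation_def z_def kerr_lin_diff right_diff_distrib)
    qed
  qed
  then have "En z \<le> Cs * Lp_norm 2 D (perturbation e z)"
    by (rule energy_stable[rotated]) (intro perturbation_in_L2 eH)
  also have "\<dots> \<le> 3 / 5 * \<nu> * En z" by (rule P[OF eH(2)])
  finally have *: "En z \<le> 3 / 5 * \<nu> * En z" .
  have "\<nu> * En z \<le> 1 * En z" using \<nu> energy_lower_bound(2)[OF eH(2)] by (intro mult_right_mono) auto
  with * have "En z \<le> 0" by simp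
  from energy_zero_AE[OF eH(2) this] show ?thesis by eventually_elim (simp add: z_def)
qed

text \<open>
  With \<open>S\<close> the solution operator at the exact solution, \<open>S h\<close> solves the Newton step as soon as \<open>h\<close> is
  the Newton data plus the perturbation of \<open>S h\<close>.
\<close>

lemma newton_step_exists:
  assumes v: "H10 D v" and small: "ereal (En (\<lambda>x. v x - us x)) \<le> thetastar"
  obtains w where "step_solution v w"
proof -
  define e where "e x = v x - us x" for x
  have eH: "H1 D e" unfolding e_def using v us_H10 by (auto intro: H1_diff H10_H1)
  have sm: "ereal (En e) \<le> thetastar" using small by (simp add: e_def[abs_def])
  obtain \<nu> where \<nu>: "0 \<le> \<nu>" "\<nu> \<le> 1"
    and P: "\<And>w. H1 D w \<Longrightarrow> Cs * Lp_norm 2 D (perturbation e w) \<le> 3 / 5 * \<nu> * En w"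
    and "Cs * Lp_norm 2 D (residual e) \<le> 1 / 3 * \<nu> * En e"
    and "ereal (\<nu> * En e) \<le> Nstar * ereal ((En e)\<^sup>2)"
    by (rule contraction_factor[OF eH sm], rule that)
  define S where "S h = (SOME w. linearized_solution R Rh \<sigma>\<^sub>0 k \<epsilon> \<Omega>\<^sub>0 U h w)" for h
  have S: "solves (\<lambda>x. h x + kerr_weight x * kerr_lin (U x) (S h x)) (S h)" if "in_Lp 2 D h" for h
    using someI_ex[OF stab_ex[OF that]] unfolding S_def linearized_solution_iff .
  have SH: "H1 D (S h)" if "in_Lp 2 D h" for h
    using S[OF that] by (auto simp: pml_solution_def intro: H10_H1)
  define T where "T h x = newton_data v x + perturbation e (S h) x" for h x
  have vH: "H1 D v" using v by (rule H10_H1)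
  obtain h where h: "in_Lp 2 D h" and fix_h: "AE x in lebesgue_on D. T h x = h x"
  proof (rule L2_contraction_fixed_point[of D T "3 / 5"])
    show "in_Lp 2 D (T h)" if "in_Lp 2 D h" for h
      unfolding T_def[abs_def] by (intro in_L2_add newton_data_in_L2 perturbation_in_L2 vH eH SH that)
    show "Lp_norm 2 D (\<lambda>x. T h x - T h' x) \<le> 3 / 5 * Lp_norm 2 D (\<lambda>x. h x - h' x)"
      if h: "in_Lp 2 D h" "in_Lp 2 D h'" for h h'
    proof -
      define z where "z x = S h x - S h' x" for x
      have zH: "H1 D z" unfolding z_def using SH h by (auto intro: H1_diff)
      have "solves (\<lambda>x. h x + kerr_weight x * kerr_lin (U x) (S h x)
          - (h' x + kerr_weight x * kerr_lin (U x) (S h' x))) z"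
        unfolding z_def[abs_def]
        by (intro pml_solution_diff S h in_L2_add kerr_lin_in_L2 sextic_U sextic_H1 SH)
      moreover have "h x + kerr_weight x * kerr_lin (U x) (S h x) - (h' x + kerr_weight x * kerr_lin (U x) (S h' x))
          = (h x - h' x) + kerr_weight x * kerr_lin (U x) (z x)" for x
        by (simp add: z_def kerr_lin_diff right_diff_distrib)
      ultimately have "solves (\<lambda>x. (h x - h' x) + kerr_weight x * kerr_lin (U x) (z x)) z"
        by simp
      then have Ez: "En z \<le> Cs * Lp_norm 2 D (\<lambda>x. h x - h' x)"
        by (rule energy_stable[rotated]) (intro in_L2_diff h)
      have Tz: "(\<lambda>x. T h x - T h' x) = perturbation e z"
        by (simp add: T_def z_def[abs_def] perturbation_diff fun_eq_iff)
      have "\<nu> * En z \<le> 1 * En z" using \<nu> energy_lower_bound(2)[OF zH] by (intro mult_right_mono) auto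
      then have "Cs * Lp_norm 2 D (perturbation e z) \<le> 3 / 5 * En z" using P[OF zH] by simp
      also have "\<dots> \<le> 3 / 5 * (Cs * Lp_norm 2 D (\<lambda>x. h x - h' x))" using Ez by simp
      finally have "Cs * Lp_norm 2 D (perturbation e z) \<le> Cs * (3 / 5 * Lp_norm 2 D (\<lambda>x. h x - h' x))" by simp
      then show ?thesis unfolding Tz using Cs by (rule mult_left_le_imp_le)
    qed
  qed auto
  have "step_solution v (S h)"
  proof (rule pml_solution_cong_AE[OF S[OF h]])
    show "in_Lp 2 D (\<lambda>x. h x + kerr_weight x * kerr_lin (U x) (S h x))"
      by (intro in_L2_add h kerr_lin_in_L2 sextic_U sextic_H1 SH)
    show "in_Lp 2 D (\<lambda>x. newton_data v x + kerr_weight x * kerr_lin (v x + uinc x) (S h x))"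
      by (intro in_L2_add newton_data_in_L2 kerr_lin_in_L2 sextic_total vH sextic_H1 SH h)
    show "AE x in lebesgue_on D. h x + kerr_weight x * kerr_lin (U x) (S h x)
        = newton_data v x + kerr_weight x * kerr_lin (v x + uinc x) (S h x)"
      using fix_h
    proof eventually_elim
      fix x assume "T h x = h x"
      moreover have "v x + uinc x = U x + e x" by (simp add: e_def)
      ultimately show "h x + kerr_weight x * kerr_lin (U x) (S h x)
          = newton_data v x + kerr_weight x * kerr_lin (v x + uinc x) (S h x)"
        unfolding T_def perturbation_def by (metis add_diff_eq diff_add_cancel)
    qed
  qed
  then show thesis by (rule that)
qed

lemma error_stays_small:
  assumes "H10 D v" "ereal (En (\<lambda>x. v x - us x)) \<le> thetastar" "step_solution v w"
  shows "H10 D w" "ereal (En (\<lambda>x. w x - us x)) \<le> thetastar"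
proof -
  show H: "H10 D w" using newton_step_error(1)[OF assms] .
  have "0 \<le> En (\<lambda>x. v x - us x)"
    using assms(1) us_H10 by (intro energy_lower_bound(2) H1_diff H10_H1) auto
  then have "En (\<lambda>x. w x - us x) \<le> En (\<lambda>x. v x - us x)"
    using newton_step_error(2)[OF assms] by linarith
  then have "ereal (En (\<lambda>x. w x - us x)) \<le> ereal (En (\<lambda>x. v x - us x))" by simp
  with assms(2) show "ereal (En (\<lambda>x. w x - us x)) \<le> thetastar" by (rule order_trans[rotated])
qed

lemma newton_sequence_small:
  assumes "H10 D u0" "ereal (En (\<lambda>x. u0 x - us x)) \<le> thetastar"
    and u: "newton u0 u"
  shows "H10 D (u l) \<and> ereal (En (\<lambda>x. u l x - us x)) \<le> thetastar"
proof (induction l)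
  case 0
  then show ?case using assms by (simp add: newton_sequence_iff)
next
  case (Suc l)
  have "step_solution (u l) (u (Suc l))" using u by (simp add: newton_sequence_iff)
  with Suc show ?case using error_stays_small by blast
qed

theorem newton_converges:
  assumes u0: "H10 D u0" "ereal (En (\<lambda>x. u0 x - us x)) \<le> thetastar"
  shows "\<exists>u. newton u0 u"
    "newton u0 u \<Longrightarrow> newton u0 u' \<Longrightarrow>
      AE x in lebesgue_on D. u l x = u' l x"
    "newton u0 u \<Longrightarrow>
      ereal (En (\<lambda>x. u (Suc l) x - us x)) \<le> Nstar * ereal ((En (\<lambda>x. u l x - us x))\<^sup>2)"
    "newton u0 u \<Longrightarrow> (\<lambda>l. En (\<lambda>x. u l x - us x)) \<longlonglongrightarrow> 0"
proof -
  let ?P = "\<lambda>v. H10 D v \<and> ereal (En (\<lambda>x. v x - us x)) \<le> thetastar"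
  have "\<exists>u. \<forall>l. (?P (u l) \<and> (l = 0 \<longrightarrow> u l = u0)) \<and> step_solution (u l) (u (Suc l))"
  proof (rule dependent_nat_choice)
    show "\<exists>v. ?P v \<and> (0 = (0::nat) \<longrightarrow> v = u0)" using u0 by blast
    fix v and l :: nat assume "?P v \<and> (l = 0 \<longrightarrow> v = u0)"
    then have v: "H10 D v" "ereal (En (\<lambda>x. v x - us x)) \<le> thetastar" by auto
    obtain w where "step_solution v w" using newton_step_exists[OF v] .
    with error_stays_small[OF v this]
    show "\<exists>w. (?P w \<and> (Suc l = 0 \<longrightarrow> w = u0)) \<and> step_solution v w" by blast
  qed
  then show "\<exists>u. newton u0 u" by (auto simp: newton_sequence_iff)
next
  assume u: "newton u0 u" "newton u0 u'"
  show "AE x in lebesgue_on D. u l x = u' l x"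
  proof (induction l)
    case 0
    then show ?case using u by (simp add: newton_sequence_iff)
  next
    case (Suc l)
    have "step_solution (u l) (u (Suc l))" "step_solution (u' l) (u' (Suc l))"
      using u by (simp_all add: newton_sequence_iff)
    moreover have "H10 D (u l)" "H10 D (u' l)" "ereal (En (\<lambda>x. u l x - us x)) \<le> thetastar"
      using newton_sequence_small[OF u0 u(1), of l] newton_sequence_small[OF u0 u(2), of l] by auto
    ultimately show ?case using newton_step_unique Suc by blast
  qed
next
  assume u: "newton u0 u"
  have step: "step_solution (u l) (u (Suc l))" for l using u by (simp add: newton_sequence_iff)
  show "ereal (En (\<lambda>x. u (Suc l) x - us x)) \<le> Nstar * ereal ((En (\<lambda>x. u l x - us x))\<^sup>2)"
    using newton_sequence_small[OF u0 u, of l] step[of l] by (intro newton_step_error(3)) auto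
  have E0: "0 \<le> En (\<lambda>x. u l x - us x)" for l
    using newton_sequence_small[OF u0 u, of l] us_H10 by (intro energy_lower_bound(2) H1_diff H10_H1) auto
  have geo: "En (\<lambda>x. u l x - us x) \<le> (5 / 6) ^ l * En (\<lambda>x. u 0 x - us x)" for l
  proof (induction l)
    case (Suc l)
    have "En (\<lambda>x. u (Suc l) x - us x) \<le> 5 / 6 * En (\<lambda>x. u l x - us x)"
      using newton_sequence_small[OF u0 u, of l] step[of l] by (intro newton_step_error(2)) auto
    with Suc show ?case by simp
  qed simp
  have "(\<lambda>l. (5 / 6 :: real) ^ l * En (\<lambda>x. u 0 x - us x)) \<longlonglongrightarrow> 0 * En (\<lambda>x. u 0 x - us x)"
    by (intro tendsto_intros LIMSEQ_realpow_zero) auto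
  then have lim: "(\<lambda>l. (5 / 6 :: real) ^ l * En (\<lambda>x. u 0 x - us x)) \<longlonglongrightarrow> 0" by simp
  show "(\<lambda>l. En (\<lambda>x. u l x - us x)) \<longlonglongrightarrow> 0"
    by (rule tendsto_sandwich[OF always_eventually always_eventually tendsto_const lim]) (use E0 geo in blast)+
qed

end

section \<open>Dependence on the incident wave\<close>

lemma Linf_norm_cong: "(\<And>x. x \<in> G \<Longrightarrow> u x = v x) \<Longrightarrow> Linf_norm G u = Linf_norm G v"
proof -
  assume eq: "\<And>x. x \<in> G \<Longrightarrow> u x = v x"
  have m: "(\<lambda>x. ereal (cmod (u x))) \<in> borel_measurable (lebesgue_on G)
      \<longleftrightarrow> (\<lambda>x. ereal (cmod (v x))) \<in> borel_measurable (lebesgue_on G)"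
    by (rule measurable_cong) (simp add: eq)
  show ?thesis
  proof (cases "(\<lambda>x. ereal (cmod (u x))) \<in> borel_measurable (lebesgue_on G)")
    case True
    have "AE x in lebesgue_on G. ereal (cmod (u x)) = ereal (cmod (v x))"
      by (rule AE_I2) (simp add: eq)
    with True m show ?thesis unfolding Linf_norm_def by (intro esssup_AE_cong) auto
  next
    case False
    with m show ?thesis unfolding Linf_norm_def by (simp add: esssup_non_measurable)
  qed
qed

lemma kerr_solution_cong:
  fixes \<Omega>\<^sub>0 :: "(real^'n::{finite,comm_ring_1}) set"
  assumes "\<And>x. x \<in> \<Omega>\<^sub>0 \<Longrightarrow> uinc x = uinc' x"
  shows "kerr_solution R Rh \<sigma>\<^sub>0 k \<epsilon> \<Omega>\<^sub>0 uinc f u = kerr_solution R Rh \<sigma>\<^sub>0 k \<epsilon> \<Omega>\<^sub>0 uinc' f u"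
proof -
  have "(\<lambda>x. f x + of_real (k\<^sup>2 * \<epsilon> * indicat_real \<Omega>\<^sub>0 x * (cmod (u x + uinc x))\<^sup>2) * (u x + uinc x))
      = (\<lambda>x. f x + of_real (k\<^sup>2 * \<epsilon> * indicat_real \<Omega>\<^sub>0 x * (cmod (u x + uinc' x))\<^sup>2) * (u x + uinc' x))"
    using assms by (auto simp: indicator_def fun_eq_iff)
  then show ?thesis unfolding kerr_solution_def by simp
qed

lemma linearized_solution_cong:
  fixes \<Omega>\<^sub>0 :: "(real^'n::{finite,comm_ring_1}) set"
  assumes "\<And>x. x \<in> \<Omega>\<^sub>0 \<Longrightarrow> V x = V' x" "g = g'"
  shows "linearized_solution R Rh \<sigma>\<^sub>0 k \<epsilon> \<Omega>\<^sub>0 V g w = linearized_solution R Rh \<sigma>\<^sub>0 k \<epsilon> \<Omega>\<^sub>0 V' g' w"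
proof -
  have "(\<lambda>x. g x + of_real (k\<^sup>2 * \<epsilon> * indicat_real \<Omega>\<^sub>0 x) * (2 * of_real ((cmod (V x))\<^sup>2) * w x + (V x)\<^sup>2 * cnj (w x)))
      = (\<lambda>x. g' x + of_real (k\<^sup>2 * \<epsilon> * indicat_real \<Omega>\<^sub>0 x) * (2 * of_real ((cmod (V' x))\<^sup>2) * w x + (V' x)\<^sup>2 * cnj (w x)))"
    using assms by (auto simp: indicator_def fun_eq_iff)
  then show ?thesis unfolding linearized_solution_def by simp
qed

lemma newton_sequence_cong:
  fixes \<Omega>\<^sub>0 :: "(real^'n::{finite,comm_ring_1}) set"
  assumes "\<And>x. x \<in> \<Omega>\<^sub>0 \<Longrightarrow> uinc x = uinc' x"
  shows "newton_sequence R Rh \<sigma>\<^sub>0 k \<epsilon> \<Omega>\<^sub>0 uinc f u0 u = newton_sequence R Rh \<sigma>\<^sub>0 k \<epsilon> \<Omega>\<^sub>0 uinc' f u0 u"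
proof -
  have "linearized_solution R Rh \<sigma>\<^sub>0 k \<epsilon> \<Omega>\<^sub>0 (\<lambda>x. u l x + uinc x)
      (\<lambda>x. f x - of_real (k\<^sup>2 * \<epsilon> * indicat_real \<Omega>\<^sub>0 x) *
               (2 * of_real ((cmod (u l x + uinc x))\<^sup>2) * u l x - (u l x + uinc x)\<^sup>2 * cnj (uinc x))) w
    = linearized_solution R Rh \<sigma>\<^sub>0 k \<epsilon> \<Omega>\<^sub>0 (\<lambda>x. u l x + uinc' x)
      (\<lambda>x. f x - of_real (k\<^sup>2 * \<epsilon> * indicat_real \<Omega>\<^sub>0 x) *
               (2 * of_real ((cmod (u l x + uinc' x))\<^sup>2) * u l x - (u l x + uinc' x)\<^sup>2 * cnj (uinc' x))) w" for l w
    using assms by (intro linearized_solution_cong) (auto simp: indicator_def fun_eq_iff)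
  then show ?thesis unfolding newton_sequence_def by simp
qed

theorem theorem3p9:
  fixes \<Omega>\<^sub>0 :: "(real^'n::{finite,comm_ring_1}) set"
    and R c C4 C6 :: real
  assumes dim: "CARD('n) = 2 \<or> CARD('n) = 3"
    and R: "0 < R"
    and Omega0: "open \<Omega>\<^sub>0" "\<Omega>\<^sub>0 \<noteq> {}" "\<Omega>\<^sub>0 \<subseteq> ball 0 R"
    and c: "0 < c" "setdist (sphere 0 R) \<Omega>\<^sub>0 \<ge> c * diameter \<Omega>\<^sub>0"
    and C4: "nirenberg_constant TYPE('n) R 4 C4"
    and C6: "nirenberg_constant TYPE('n) R 6 C6"
  shows "\<exists>C>0. \<exists>m::nat.
    \<forall>\<sigma>\<^sub>0>0. \<forall>Rh>R. \<forall>k>1. \<forall>\<epsilon>. 0 < \<epsilon> \<and> \<epsilon> < 1 \<longrightarrow>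
    (\<forall>uinc f us u0 :: real^'n::{finite,comm_ring_1} \<Rightarrow> complex. \<forall>Cs>0.
      let D = ball 0 Rh;
          N = newton_N CARD('n) k \<epsilon> Cs (nirenberg_max TYPE('n) \<sigma>\<^sub>0 C4 C6)
                (Linf_norm \<Omega>\<^sub>0 (\<lambda>x. us x + uinc x));
          \<theta> = newton_theta CARD('n) k \<epsilon> Cs (nirenberg_max TYPE('n) \<sigma>\<^sub>0 C4 C6)
                (Linf_norm \<Omega>\<^sub>0 (\<lambda>x. us x + uinc x));
          err = (\<lambda>v. energy_norm R Rh \<sigma>\<^sub>0 k (\<lambda>x. v x - us x))
      in
        uinc \<in> borel_measurable (lebesgue_on \<Omega>\<^sub>0) \<and> bounded (uinc ` \<Omega>\<^sub>0) \<and>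
        in_Lp 2 D f \<and> (AE x in lebesgue_on D. x \<notin> ball 0 R \<longrightarrow> f x = 0) \<and>
        kerr_solution R Rh \<sigma>\<^sub>0 k \<epsilon> \<Omega>\<^sub>0 uinc f us \<and>
        (\<forall>g. in_Lp 2 D g \<longrightarrow>
          (\<exists>w. linearized_solution R Rh \<sigma>\<^sub>0 k \<epsilon> \<Omega>\<^sub>0 (\<lambda>x. us x + uinc x) g w) \<and>
          (\<forall>w. linearized_solution R Rh \<sigma>\<^sub>0 k \<epsilon> \<Omega>\<^sub>0 (\<lambda>x. us x + uinc x) g w \<longrightarrow>
             energy_norm R Rh \<sigma>\<^sub>0 k w \<le> Cs * Lp_norm 2 D g)) \<and>
        H10 D u0 \<and> ereal (err u0) \<le> \<theta>
        \<longrightarrow>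
        (\<exists>u. newton_sequence R Rh \<sigma>\<^sub>0 k \<epsilon> \<Omega>\<^sub>0 uinc f u0 u) \<and>
        (\<forall>u u'. newton_sequence R Rh \<sigma>\<^sub>0 k \<epsilon> \<Omega>\<^sub>0 uinc f u0 u \<and>
           newton_sequence R Rh \<sigma>\<^sub>0 k \<epsilon> \<Omega>\<^sub>0 uinc f u0 u' \<longrightarrow>
           (\<forall>l. AE x in lebesgue_on D. u l x = u' l x)) \<and>
        (\<forall>u. newton_sequence R Rh \<sigma>\<^sub>0 k \<epsilon> \<Omega>\<^sub>0 uinc f u0 u \<longrightarrow>
           (\<forall>l. ereal (err (u (Suc l)))
              \<le> ereal (C * (1 + \<sigma>\<^sub>0) ^ m * (1 + (Rh - R)) ^ m) * N * ereal ((err (u l))\<^sup>2)) \<and>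
           (\<lambda>l. err (u l)) \<longlonglongrightarrow> 0))"
proof (intro exI[of _ "1::real"] conjI exI[of _ "0::nat"] allI impI, goal_cases)
  case 1
  show ?case by simp
next
  case (2 \<sigma>\<^sub>0 Rh k \<epsilon> uinc f us u0 Cs)
  let ?D = "ball (0 :: real^'n::{finite,comm_ring_1}) Rh"
  let ?CN = "nirenberg_max TYPE('n) \<sigma>\<^sub>0 C4 C6"
  let ?M = "Linf_norm \<Omega>\<^sub>0 (\<lambda>x. us x + uinc x)"
  let ?N = "newton_N CARD('n) k \<epsilon> Cs ?CN ?M"
  let ?err = "\<lambda>v. energy_norm R Rh \<sigma>\<^sub>0 k (\<lambda>x. v x - us x)"
  have main: "(\<exists>u. newton_sequence R Rh \<sigma>\<^sub>0 k \<epsilon> \<Omega>\<^sub>0 uinc f u0 u) \<and>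
      (\<forall>u u'. newton_sequence R Rh \<sigma>\<^sub>0 k \<epsilon> \<Omega>\<^sub>0 uinc f u0 u \<and> newton_sequence R Rh \<sigma>\<^sub>0 k \<epsilon> \<Omega>\<^sub>0 uinc f u0 u' \<longrightarrow>
         (\<forall>l. AE x in lebesgue_on ?D. u l x = u' l x)) \<and>
      (\<forall>u. newton_sequence R Rh \<sigma>\<^sub>0 k \<epsilon> \<Omega>\<^sub>0 uinc f u0 u \<longrightarrow>
         (\<forall>l. ereal (?err (u (Suc l))) \<le> ?N * ereal ((?err (u l))\<^sup>2)) \<and> (\<lambda>l. ?err (u l)) \<longlonglongrightarrow> 0)"
    if meas: "uinc \<in> borel_measurable (lebesgue_on \<Omega>\<^sub>0)" and bdd: "bounded (uinc ` \<Omega>\<^sub>0)"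
      and f: "in_Lp 2 ?D f" and us: "kerr_solution R Rh \<sigma>\<^sub>0 k \<epsilon> \<Omega>\<^sub>0 uinc f us"
      and stab: "\<forall>g. in_Lp 2 ?D g \<longrightarrow>
          (\<exists>w. linearized_solution R Rh \<sigma>\<^sub>0 k \<epsilon> \<Omega>\<^sub>0 (\<lambda>x. us x + uinc x) g w) \<and>
          (\<forall>w. linearized_solution R Rh \<sigma>\<^sub>0 k \<epsilon> \<Omega>\<^sub>0 (\<lambda>x. us x + uinc x) g w \<longrightarrow>
             energy_norm R Rh \<sigma>\<^sub>0 k w \<le> Cs * Lp_norm 2 ?D g)"
      and u0: "H10 ?D u0" "ereal (?err u0) \<le> newton_theta CARD('n) k \<epsilon> Cs ?CN ?M"
  proof -
    \<comment> \<open>The values of the incident wave outside the Kerr medium are arbitrary; cutting them off yields a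
      function that is measurable and bounded on the whole domain and has the same Newton sequences.\<close>
    define uinc' where "uinc' x = indicat_real \<Omega>\<^sub>0 x *\<^sub>R uinc x" for x
    have on: "uinc x = uinc' x" if "x \<in> \<Omega>\<^sub>0" for x using that by (simp add: uinc'_def)
    have O: "\<Omega>\<^sub>0 \<inter> space lebesgue \<in> sets lebesgue" using Omega0(1) by auto
    have "uinc' \<in> borel_measurable lebesgue"
      using meas unfolding uinc'_def[abs_def] borel_measurable_restrict_space_iff[OF O] .
    then have m': "uinc' \<in> borel_measurable (lebesgue_on ?D)" by (rule measurable_restrict_space1)
    have b': "bounded (range uinc')"
    proof -
      obtain B where B: "\<And>x. x \<in> \<Omega>\<^sub>0 \<Longrightarrow> cmod (uinc x) \<le> B" using bdd by (auto simp: bounded_iff)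
      have "cmod (uinc' x) \<le> max B 0" for x
        using B[of x] by (cases "x \<in> \<Omega>\<^sub>0") (auto simp: uinc'_def)
      then show ?thesis by (auto simp: bounded_iff)
    qed
    have lin: "linearized_solution R Rh \<sigma>\<^sub>0 k \<epsilon> \<Omega>\<^sub>0 (\<lambda>x. us x + uinc' x) g w
        = linearized_solution R Rh \<sigma>\<^sub>0 k \<epsilon> \<Omega>\<^sub>0 (\<lambda>x. us x + uinc x) g w" for g w
      by (rule linearized_solution_cong) (simp_all add: on)
    have ns: "newton_sequence R Rh \<sigma>\<^sub>0 k \<epsilon> \<Omega>\<^sub>0 uinc' f u0 u = newton_sequence R Rh \<sigma>\<^sub>0 k \<epsilon> \<Omega>\<^sub>0 uinc f u0 u" for u
      by (rule newton_sequence_cong) (simp add: on)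
    have ks: "kerr_solution R Rh \<sigma>\<^sub>0 k \<epsilon> \<Omega>\<^sub>0 uinc' f us"
      using us by (simp add: kerr_solution_cong[of \<Omega>\<^sub>0 uinc' uinc] on)
    have M': "Linf_norm \<Omega>\<^sub>0 (\<lambda>x. us x + uinc' x) = ?M"
      by (rule Linf_norm_cong) (simp add: on)
    interpret kerr_newton "TYPE('n)" R Rh \<sigma>\<^sub>0 k \<Omega>\<^sub>0 \<epsilon> Cs C4 C6 uinc' f us
    proof
      show "\<exists>w. linearized_solution R Rh \<sigma>\<^sub>0 k \<epsilon> \<Omega>\<^sub>0 (\<lambda>x. us x + uinc' x) g w" if "in_Lp 2 ?D g" for g
        unfolding lin using stab that by blast
      show "energy_norm R Rh \<sigma>\<^sub>0 k w \<le> Cs * Lp_norm 2 ?D g"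
        if "in_Lp 2 ?D g" "linearized_solution R Rh \<sigma>\<^sub>0 k \<epsilon> \<Omega>\<^sub>0 (\<lambda>x. us x + uinc' x) g w" for g w
        using stab that unfolding lin by blast
    qed (use dim R Omega0 C4 C6 2 m' b' f ks in auto)
    have Meq: "M = ?M" by (simp add: M_def M')
    have small: "ereal (?err u0) \<le> newton_theta CARD('n) k \<epsilon> Cs CN M"
      using u0(2) unfolding Meq CN_def .
    note conv = newton_converges[OF u0(1) small, unfolded ns Meq CN_def]
    show ?thesis using conv by blast
  qed
  show ?case
    unfolding Let_def power_0 mult_1 one_ereal_def[symmetric]
    by (intro impI main; elim conjE; assumption)
qed

end
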